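(* Let $\{\mathcal F,\mathcal G\}$ be a Hilbert C*-system with fixed point algebra $\mathcal A$, and let $\mathcal Z$ be the center of $\mathcal A$. Then $\mathcal A'\cap\mathcal F=\mathcal Z$ if and only if $(\rho_D,\rho_{D'})=\{0\}$ for all $D\neq D'$ in $\widehat{\mathcal G}$, i.e. if and only if the set $\{\rho_D\mid D\in\widehat{\mathcal G}\}$ is mutually disjoint.
   Context: C*-algebras are unital. An algebraic Hilbert space in $\mathcal F$ is a finite-dimensional subspace $\mathcal H\subset\mathcal F$ with $A^*B\in\mathbb C\mathbf 1$ for $A,B\in\mathcal H$, scalar product $\langle A,B\rangle\mathbf 1=A^*B$, always assumed to have support $\sum_j\Phi_j\Phi_j^*=\mathbf 1$ ($\{\Phi_j\}$ an orthonormal basis). For a compact group $\mathcal G$ acting on $\mathcal F$ by a pointwise norm-continuous homomorphism $\alpha:\mathcal G\to\mathrm{Aut}\,\mathcal F$ and $D\in\widehat{\mathcal G}$ (classes of irreducible unitary representations) put $\Pi_D(F)=\int_{\mathcal G}\overline{\chi_D(g)}\,\alpha_g(F)\,dg$, $\chi_D(g)=\dim D\cdot\mathrm{Tr}\,\pi(g)$, $\pi\in D$. The system is a Hilbert C*-system if for each $D$ there is an $\alpha_{\mathcal G}$-invariant algebraic Hilbert space $\mathcal H_D\subset\Pi_D\mathcal F$ carrying a representation of class $D$. One identifies $\mathcal G$ with $\alpha_{\mathcal G}$ and writes $\{\mathcal F,\mathcal G\}$; $\mathcal A$ is the fixed point algebra and $\mathcal Z=\mathcal A'\cap\mathcal A$.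 $\rho_D$ is the canonical endomorphism $\rho_D(A)=\sum_j\Phi_jA\Phi_j^*$ of $\mathcal A$, with $\{\Phi_j\}$ an orthonormal basis of $\mathcal H_D$. For endomorphisms $\sigma,\tau$ of $\mathcal A$, $(\sigma,\tau)=\{X\in\mathcal A:X\sigma(A)=\tau(A)X\ \forall A\in\mathcal A\}$; $\sigma,\tau$ are disjoint if $(\sigma,\tau)=\{0\}$. *)

theory Defs
  imports "HOL-Probability.Probability" "Jordan_Normal_Form.Schur_Decomposition"
begin

section \<open>Unital C*-algebras\<close>

class unital_cstar_algebra = real_normed_algebra_1 + banach +
  fixes scaleC :: "complex \<Rightarrow> 'a \<Rightarrow> 'a" (infixr "*\<^sub>C" 75)
    and adj :: "'a \<Rightarrow> 'a"
  assumes scaleC_add_right: "c *\<^sub>C (x + y) = c *\<^sub>C x + c *\<^sub>C y"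
    and scaleC_add_left: "(c + d) *\<^sub>C x = c *\<^sub>C x + d *\<^sub>C x"
    and scaleC_scaleC: "c *\<^sub>C d *\<^sub>C x = (c * d) *\<^sub>C x"
    and scaleC_of_real: "complex_of_real r *\<^sub>C x = r *\<^sub>R x"
    and mult_scaleC_left: "(c *\<^sub>C x) * y = c *\<^sub>C (x * y)"
    and mult_scaleC_right: "x * (c *\<^sub>C y) = c *\<^sub>C (x * y)"
    and norm_scaleC: "norm (c *\<^sub>C x) = cmod c * norm x"
    and adj_adj: "adj (adj x) = x"
    and adj_add: "adj (x + y) = adj x + adj y"
    and adj_scaleC: "adj (c *\<^sub>C x) = cnj c *\<^sub>C adj x"
    and adj_mult: "adj (x * y) = adj y * adj x"
    and cstar_identity: "norm (adj x * x) = (norm x)\<^sup>2"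

interpretation complex_vec: vector_space "scaleC :: complex \<Rightarrow> 'a \<Rightarrow> 'a::unital_cstar_algebra"
proof
  fix x :: 'a
  show "1 *\<^sub>C x = x"
    using scaleC_of_real[of 1 x] by simp
qed (simp_all add: scaleC_add_right scaleC_add_left scaleC_scaleC)

definition star_automorphism :: "('f::unital_cstar_algebra \<Rightarrow> 'f) \<Rightarrow> bool" where
  "star_automorphism \<theta> \<longleftrightarrow> bij \<theta> \<and>
     (\<forall>x y. \<theta> (x + y) = \<theta> x + \<theta> y) \<and>
     (\<forall>c x. \<theta> (c *\<^sub>C x) = c *\<^sub>C \<theta> x) \<and>
     (\<forall>x y. \<theta> (x * y) = \<theta> x * \<theta> y) \<and>
     (\<forall>x. \<theta> (adj x) = adj (\<theta> x))"


section \<open>Integration over a compact group\<close>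

text \<open>Groups are written additively, as in the library class \<open>topological_group_add\<close>;
  they are not assumed to be commutative.\<close>

definition normalized_haar_measure :: "('g::{topological_group_add, t2_space}) measure \<Rightarrow> bool" where
  "normalized_haar_measure \<mu> \<longleftrightarrow> prob_space \<mu> \<and> sets \<mu> = sets borel \<and>
     (\<forall>g. distr \<mu> \<mu> (\<lambda>h. g + h) = \<mu>) \<and>
     (\<forall>A\<in>sets \<mu>. emeasure \<mu> A = (SUP K\<in>{K. compact K \<and> K \<subseteq> A}. emeasure \<mu> K)) \<and>
     (\<forall>A\<in>sets \<mu>. emeasure \<mu> A = (INF U\<in>{U. open U \<and> A \<subseteq> U}. emeasure \<mu> U))"

text \<open>The library's Bochner integral is restricted to second countable spaces, which would
  exclude non-separable C*-algebras.  The following is the definition of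
  \<open>has_bochner_integral\<close> without that restriction.\<close>

definition has_banach_integral :: "'x measure \<Rightarrow> ('x \<Rightarrow> 'b::banach) \<Rightarrow> 'b \<Rightarrow> bool" where
  "has_banach_integral M f y \<longleftrightarrow> f \<in> borel_measurable M \<and>
     (\<exists>s. (\<forall>i::nat. Bochner_Integration.simple_bochner_integrable M (s i)) \<and>
          (\<lambda>i. \<integral>\<^sup>+x. ennreal (norm (f x - s i x)) \<partial>M) \<longlonglongrightarrow> 0 \<and>
          (\<lambda>i. Bochner_Integration.simple_bochner_integral M (s i)) \<longlonglongrightarrow> y)"

definition banach_integral :: "'x measure \<Rightarrow> ('x \<Rightarrow> 'b::banach) \<Rightarrow> 'b" where
  "banach_integral M f = (THE y. has_banach_integral M f y)"


section \<open>The dual of a compact group\<close>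

text \<open>Irreducible unitary representations of a compact group are finite-dimensional, so up to
  unitary equivalence they are continuous homomorphisms into unitary matrices.\<close>

definition unitary_rep :: "nat \<Rightarrow> ('g::topological_group_add \<Rightarrow> complex mat) \<Rightarrow> bool" where
  "unitary_rep n \<pi> \<longleftrightarrow>
     (\<forall>g. \<pi> g \<in> carrier_mat n n \<and> mat_adjoint (\<pi> g) * \<pi> g = 1\<^sub>m n) \<and>
     (\<forall>g h. \<pi> (g + h) = \<pi> g * \<pi> h) \<and>
     (\<forall>i<n. \<forall>j<n. continuous_on UNIV (\<lambda>g. \<pi> g $$ (i, j)))"

definition irreducible_unitary_rep :: "nat \<Rightarrow> ('g::topological_group_add \<Rightarrow> complex mat) \<Rightarrow> bool" where
  "irreducible_unitary_rep n \<pi> \<longleftrightarrow> n > 0 \<and> unitary_rep n \<pi> \<and>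
     (\<forall>W. VectorSpace.subspace class_ring W (module_vec TYPE(complex) n) \<and>
          (\<forall>g. \<forall>v\<in>W. \<pi> g *\<^sub>v v \<in> W) \<longrightarrow> W = {0\<^sub>v n} \<or> W = carrier_vec n)"

definition unitary_equivalence ::
    "(('g::topological_group_add \<Rightarrow> complex mat) \<times> ('g \<Rightarrow> complex mat)) set" where
  "unitary_equivalence = {(\<pi>, \<pi>'). \<exists>n. irreducible_unitary_rep n \<pi> \<and> irreducible_unitary_rep n \<pi>' \<and>
     (\<exists>U\<in>carrier_mat n n. mat_adjoint U * U = 1\<^sub>m n \<and> (\<forall>g. U * \<pi> g = \<pi>' g * U))}"

definition unitary_dual :: "('g::topological_group_add \<Rightarrow> complex mat) set set" where
  "unitary_dual = {\<pi>. \<exists>n. irreducible_unitary_rep n \<pi>} // unitary_equivalence"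

text \<open>The character includes the factor \<open>dim D\<close>; it does not depend on the representative.\<close>

definition dual_character :: "('g::topological_group_add \<Rightarrow> complex mat) set \<Rightarrow> 'g \<Rightarrow> complex" where
  "dual_character D g = (let \<pi> = (SOME \<pi>. \<pi> \<in> D); n = dim_row (\<pi> 0)
     in of_nat n * (\<Sum>i<n. \<pi> g $$ (i, i)))"


section \<open>Algebraic Hilbert spaces\<close>

text \<open>Orthonormality refers to the scalar product \<open>\<langle>A, B\<rangle>\<close> determined by \<open>\<langle>A, B\<rangle> 1 = A\<^sup>* B\<close>.\<close>

definition orthonormal_basis :: "'f::unital_cstar_algebra set \<Rightarrow> 'f list \<Rightarrow> bool" where
  "orthonormal_basis H \<Phi> \<longleftrightarrow>
     (\<forall>i<length \<Phi>. \<forall>j<length \<Phi>. adj (\<Phi> ! i) * \<Phi> ! j = (if i = j then 1 else 0)) \<and>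
     complex_vec.span (set \<Phi>) = H"

definition algebraic_hilbert_space :: "'f::unital_cstar_algebra set \<Rightarrow> bool" where
  "algebraic_hilbert_space H \<longleftrightarrow> complex_vec.subspace H \<and>
     (\<exists>B. finite B \<and> complex_vec.span B = H) \<and>
     (\<forall>A\<in>H. \<forall>B\<in>H. \<exists>c. adj A * B = c *\<^sub>C 1) \<and>
     (\<exists>\<Phi>. orthonormal_basis H \<Phi> \<and> (\<Sum>j<length \<Phi>. \<Phi> ! j * adj (\<Phi> ! j)) = 1)"

text \<open>Independent of the orthonormal basis; for \<open>H = H\<^sub>D\<close> this is the canonical
  endomorphism of class \<open>D\<close>, of which only the values on the fixed point algebra matter.\<close>

definition canonical_endo :: "'f::unital_cstar_algebra set \<Rightarrow> 'f \<Rightarrow> 'f" where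
  "canonical_endo H A = (let \<Phi> = (SOME \<Phi>. orthonormal_basis H \<Phi>)
     in \<Sum>j<length \<Phi>. \<Phi> ! j * A * adj (\<Phi> ! j))"


section \<open>Hilbert C*-systems\<close>

definition cstar_action :: "('g::topological_group_add \<Rightarrow> 'f::unital_cstar_algebra \<Rightarrow> 'f) \<Rightarrow> bool" where
  "cstar_action \<alpha> \<longleftrightarrow> (\<forall>g. star_automorphism (\<alpha> g)) \<and>
     (\<forall>g h. \<alpha> (g + h) = \<alpha> g \<circ> \<alpha> h) \<and>
     (\<forall>F. continuous_on UNIV (\<lambda>g. \<alpha> g F))"

definition spectral_projection ::
    "'g::topological_group_add measure \<Rightarrow> ('g \<Rightarrow> 'f::unital_cstar_algebra \<Rightarrow> 'f) \<Rightarrow>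
     ('g \<Rightarrow> complex mat) set \<Rightarrow> 'f \<Rightarrow> 'f" where
  "spectral_projection \<mu> \<alpha> D F = banach_integral \<mu> (\<lambda>g. cnj (dual_character D g) *\<^sub>C \<alpha> g F)"

text \<open>The restriction of the action to \<open>H\<close> is of class \<open>D\<close> iff its matrix with respect to some
  orthonormal basis is a member of \<open>D\<close>, as \<open>D\<close> is closed under unitary equivalence.\<close>

definition carries_class ::
    "('g::topological_group_add \<Rightarrow> 'f::unital_cstar_algebra \<Rightarrow> 'f) \<Rightarrow> 'f set \<Rightarrow>
     ('g \<Rightarrow> complex mat) set \<Rightarrow> bool" where
  "carries_class \<alpha> H D \<longleftrightarrow> (\<exists>\<Phi> \<pi>. orthonormal_basis H \<Phi> \<and> \<pi> \<in> D \<and>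
     (\<forall>g. \<pi> g \<in> carrier_mat (length \<Phi>) (length \<Phi>)) \<and>
     (\<forall>g. \<forall>j<length \<Phi>. \<alpha> g (\<Phi> ! j) = (\<Sum>i<length \<Phi>. \<pi> g $$ (i, j) *\<^sub>C \<Phi> ! i)))"

definition spectral_hilbert_space ::
    "'g::topological_group_add measure \<Rightarrow> ('g \<Rightarrow> 'f::unital_cstar_algebra \<Rightarrow> 'f) \<Rightarrow>
     ('g \<Rightarrow> complex mat) set \<Rightarrow> 'f set \<Rightarrow> bool" where
  "spectral_hilbert_space \<mu> \<alpha> D H \<longleftrightarrow> algebraic_hilbert_space H \<and>
     (\<forall>g. \<alpha> g ` H \<subseteq> H) \<and> H \<subseteq> range (spectral_projection \<mu> \<alpha> D) \<and> carries_class \<alpha> H D"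

definition hilbert_cstar_system ::
    "('g::{topological_group_add, t2_space}) measure \<Rightarrow>
     ('g \<Rightarrow> 'f::unital_cstar_algebra \<Rightarrow> 'f) \<Rightarrow> bool" where
  "hilbert_cstar_system \<mu> \<alpha> \<longleftrightarrow> compact (UNIV :: 'g set) \<and> normalized_haar_measure \<mu> \<and>
     cstar_action \<alpha> \<and> (\<forall>D\<in>unitary_dual. \<exists>H. spectral_hilbert_space \<mu> \<alpha> D H)"

definition fixed_point_algebra :: "('g \<Rightarrow> 'f \<Rightarrow> 'f) \<Rightarrow> 'f set" where
  "fixed_point_algebra \<alpha> = {A. \<forall>g. \<alpha> g A = A}"

definition commutant :: "'f::unital_cstar_algebra set \<Rightarrow> 'f set" where
  "commutant S = {X. \<forall>A\<in>S. X * A = A * X}"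

definition intertwiners ::
    "'f::unital_cstar_algebra set \<Rightarrow> ('f \<Rightarrow> 'f) \<Rightarrow> ('f \<Rightarrow> 'f) \<Rightarrow> 'f set" where
  "intertwiners \<A> \<sigma> \<tau> = {X\<in>\<A>. \<forall>A\<in>\<A>. X * \<sigma> A = \<tau> A * X}"

definition disjoint_endos ::
    "'f::unital_cstar_algebra set \<Rightarrow> ('f \<Rightarrow> 'f) \<Rightarrow> ('f \<Rightarrow> 'f) \<Rightarrow> bool" where
  "disjoint_endos \<A> \<sigma> \<tau> \<longleftrightarrow> intertwiners \<A> \<sigma> \<tau> = {0}"

end

theory Submission
  imports Defs "Jordan_Normal_Form.Spectral_Radius" "HOL-Analysis.Generalised_Binomial_Theorem"
begin

text \<open>Suppose \<open>\<A>' \<inter> \<F> \<subseteq> \<A>\<close> and let \<open>X\<close> intertwine \<open>\<rho>\<^sub>D\<close> and \<open>\<rho>\<^bsub>D'\<^esub>\<close>.  The elements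
  \<open>\<Psi>\<^sub>j\<^sup>* X \<Phi>\<^sub>i\<close> commute with \<open>\<A>\<close>, hence are fixed by the group; so they form an \<open>\<F>\<close>-valued intertwiner
  between two inequivalent irreducible representations, which vanishes by Schur's lemma.

  Conversely, for \<open>F \<in> \<A>' \<inter> \<F>\<close> the average \<open>X\<close> of \<open>\<alpha>\<^sub>g(F \<Phi>\<^sub>j\<^sup>*)\<close> is a fixed element intertwining
  \<open>\<rho>\<^sub>D\<close> and the identity, and \<open>X \<Phi>\<^sub>i\<close> is the integral of \<open>\<alpha>\<^sub>g(F)\<close> against the conjugate of a matrix
  coefficient of \<open>D\<close>.  Disjointness makes these integrals vanish for all nontrivial \<open>D\<close>, and
  \<open>F\<close> is fixed by the Peter-Weyl theorem.

  The finite-dimensional invariant spaces needed for the Peter-Weyl theorem come from the power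
  method: for a hermitian continuous \<open>h\<close> with convolution powers \<open>h\<^sup>n\<close>, the numbers \<open>\<parallel>h\<^sup>n\<parallel>\<^sub>2\<^sup>2\<close> are both
  log-convex and submultiplicative in \<open>n\<close>, so that \<open>h\<^sup>2\<^sup>n / l\<^sup>n\<close> converges uniformly, for a suitable
  \<open>l > 0\<close>, to a nonzero convolution projection; compactness of operators is not needed.\<close>

section \<open>Averages of continuous functions over a compact group\<close>

text \<open>Neither the group nor the algebra is restricted in size, so separable ranges and
  measurability on products are not at hand. Only continuous functions are therefore averaged, as
  uniform limits of simple functions, and compactness takes the place of Fubini's theorem for
  measurable functions. Likewise the square integrable functions are never completed: a sequence
  that is Cauchy for the scalar product is convolved with a fixed continuous function, after which
  it converges uniformly.

  Automorphisms are assumed to be algebraic only; their boundedness, used to move them past an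
  average, is derived from the C*-identity.

  The endomorphism of the trivial class need not be the identity, but it is implemented by a fixed
  isometry, which converts intertwiners into the identity into intertwiners into that endomorphism.
  The trivial coefficient of F is its average and need not vanish, so the average is subtracted
  first. The Peter-Weyl theorem enters in scalar form: the functions annihilating an orbit form a
  left convolution ideal, closed under uniform limits and containing all matrix coefficients, and
  such an ideal contains every convolution of two continuous functions.\<close>

lemma simple_bochner_integrable_finite_measure:
  "finite_measure M \<Longrightarrow> Bochner_Integration.simple_bochner_integrable M s \<longleftrightarrow> simple_function M s"
  using finite_measure.emeasure_finite[of M]
  by (auto intro: simple_bochner_integrable.intros elim: simple_bochner_integrable.cases)

text \<open>Finitely many of the sets \<open>U c\<close> cover the space; in a fixed list of these
  tags each point receives the first one whose set contains it, and this choice by order makes the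
  level sets Borel. The same discretisation serves the approximation by simple functions and the
  exchange of averages.\<close>

lemma tagged_cover:
  fixes U :: "'g::topological_space \<Rightarrow> 'g set"
  assumes "compact (UNIV :: 'g set)" and "sets M = sets borel"
    and U: "\<And>x. open (U x)" "\<And>x. x \<in> U x"
  shows "\<exists>t. simple_function M t \<and> (\<forall>x. x \<in> U (t x))"
proof -
  have sp: "space M = UNIV" using assms(2) by (metis sets_eq_imp_space_eq space_borel)
  obtain C where C: "finite C" "UNIV \<subseteq> \<Union> (U ` C)"
    using compactE_image[OF assms(1), of UNIV U] U by (metis UNIV_I UN_I subsetI)
  obtain cs where cs: "set cs = C" using C(1) finite_list by blast
  define t where "t x = the (find (\<lambda>c. x \<in> U c) cs)" for x
  have ex: "\<exists>c\<in>set cs. x \<in> U c" for x using C(2) cs by blast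
  have f: "\<exists>c. find (\<lambda>c. x \<in> U c) cs = Some c \<and> c \<in> set cs \<and> x \<in> U c" for x
    using ex[of x] by (metis find_None_iff find_Some_iff not_None_eq nth_mem)
  have tU: "x \<in> U (t x)" and tC: "t x \<in> set cs" for x
    using f[of x] by (auto simp: t_def)
  have "{x. find (\<lambda>c. x \<in> U c) ds = Some c} \<in> sets borel" for c ds
  proof (induction ds)
    case (Cons d ds)
    have "{x. find (\<lambda>c. x \<in> U c) (d # ds) = Some c} =
       (if d = c then U d else {}) \<union> ({x. find (\<lambda>c. x \<in> U c) ds = Some c} - U d)"
      by auto
    then show ?case using Cons U(1) by (auto intro!: sets.Un sets.Diff)
  qed auto
  moreover have "t -` {c} = {x. find (\<lambda>c. x \<in> U c) cs = Some c}" for c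
  proof -
    have "t x = c \<longleftrightarrow> find (\<lambda>c. x \<in> U c) cs = Some c" for x
      using f[of x] by (auto simp: t_def)
    then show ?thesis by auto
  qed
  ultimately have "simple_function M t"
    unfolding simple_function_def using sp assms(2) tC by (auto intro: finite_subset[of _ "set cs"])
  then show ?thesis using tU by blast
qed

lemma simple_approximation:
  fixes f :: "'g::topological_space \<Rightarrow> 'b::metric_space"
  assumes "compact (UNIV :: 'g set)" and "sets M = sets borel"
    and f: "continuous_on UNIV f" and e: "0 < e"
  shows "\<exists>s. simple_function M s \<and> (\<forall>x. dist (s x) (f x) < e)"
proof -
  have "open {y. dist (f x) (f y) < e}" for x
    by (intro open_Collect_less continuous_intros f)
  then obtain t where "simple_function M t" "\<forall>x. x \<in> {y. dist (f (t x)) (f y) < e}"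
    using tagged_cover[OF assms(1,2), of "\<lambda>x. {y. dist (f x) (f y) < e}"] e by auto
  then show ?thesis
    by (intro exI[of _ "f \<circ> t"]) (auto intro: simple_function_compose)
qed

text \<open>A form of the tube lemma. Uniformity in \<open>y\<close> permits replacing
  \<open>x\<close> by a nearby tag under an average over \<open>y\<close>.\<close>

lemma continuous_uniformly_in_compact_variable:
  fixes f :: "'a::topological_space \<Rightarrow> 'b::topological_space \<Rightarrow> 'c::metric_space"
  assumes "continuous_on UNIV (\<lambda>(x, y). f x y)" "compact (UNIV :: 'b set)" "0 < e"
  shows "\<exists>U. open U \<and> x0 \<in> U \<and> (\<forall>x\<in>U. \<forall>y. dist (f x y) (f x0 y) \<le> e)"
proof -
  obtain X where "x0 \<in> X" "open X"
    "\<forall>x\<in>X \<inter> UNIV. \<forall>t\<in>UNIV. dist (case (x, t) of (x, y) \<Rightarrow> f x y) (case (x0, t) of (x, y) \<Rightarrow> f x y) \<le> e"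
    by (rule continuous_on_prod_compactE[of UNIV UNIV "\<lambda>(x, y). f x y" x0 e]) (use assms in auto)
  then show ?thesis by auto
qed

lemma continuous_on_curry:
  assumes "continuous_on UNIV (\<lambda>(x, y). f x y)"
  shows "continuous_on UNIV (f x)" "continuous_on UNIV (\<lambda>x. f x y)"
proof -
  have "continuous_on UNIV (\<lambda>y. case (x, y) of (x, y) \<Rightarrow> f x y)"
    by (rule continuous_on_compose2[OF assms]) (intro continuous_intros, simp)
  then show "continuous_on UNIV (f x)" by simp
  have "continuous_on UNIV (\<lambda>x. case (x, y) of (x, y) \<Rightarrow> f x y)"
    by (rule continuous_on_compose2[OF assms]) (intro continuous_intros, simp)
  then show "continuous_on UNIV (\<lambda>x. f x y)" by simp
qed

section \<open>Averages of continuous functions with values in a Banach space\<close>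

locale compact_haar =
  fixes \<mu> :: "('g::{topological_group_add, t2_space}) measure"
  assumes compact_group: "compact (UNIV :: 'g set)"
    and haar: "normalized_haar_measure \<mu>"
begin

lemma prob_haar: "prob_space \<mu>" and sets_haar: "sets \<mu> = sets borel"
  and distr_haar: "distr \<mu> \<mu> (\<lambda>h. g + h) = \<mu>"
  using haar by (auto simp: normalized_haar_measure_def)

lemma space_haar [simp]: "space \<mu> = UNIV"
  using sets_haar by (metis sets_eq_imp_space_eq space_borel)

abbreviation "sint \<equiv> Bochner_Integration.simple_bochner_integral \<mu>"
abbreviation "simple \<equiv> simple_function \<mu>"

lemma simple_integrable [simp]: "Bochner_Integration.simple_bochner_integrable \<mu> s \<longleftrightarrow> simple s"
  by (rule simple_bochner_integrable_finite_measure[OF prob_space.finite_measure[OF prob_haar]])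

lemma sint_const: "sint (\<lambda>x. c) = c"
  using prob_space.prob_space[OF prob_haar] by (simp add: simple_bochner_integral_def)

lemma norm_sint_le:
  assumes s: "simple s" and le: "\<And>x. norm (s x) \<le> C"
  shows "norm (sint s) \<le> C"
proof -
  have n: "simple (\<lambda>x. norm (s x))" by (rule simple_function_compose1[OF s])
  have "sint (\<lambda>x. C - norm (s x)) \<ge> 0" using le by simp
  then have "sint (\<lambda>x. norm (s x)) \<le> C"
    using n by (subst (asm) simple_bochner_integral_diff) (auto simp: sint_const)
  then show ?thesis
    using simple_bochner_integral_norm_bound[of \<mu> s] s by simp
qed

lemma sint_translate:
  assumes s: "simple s"
  shows "simple (\<lambda>x. s (g + x))" "sint (\<lambda>x. s (g + x)) = sint s"
proof -
  have tr: "(\<lambda>h. g + h) \<in> measurable \<mu> \<mu>"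
  proof -
    have "(\<lambda>h. g + h) \<in> borel_measurable borel"
      by (intro borel_measurable_continuous_onI continuous_intros)
    then show ?thesis using sets_haar by (simp cong: measurable_cong_sets)
  qed
  have range: "(\<lambda>x. s (g + x)) ` UNIV = s ` UNIV"
    by (auto simp: image_iff) (metis add.assoc add.left_neutral add.right_inverse)
  have m: "{x. s x = y} \<in> sets \<mu>" for y
    using s simple_functionD(2)[OF s, of "{y}"] by (simp add: vimage_def)
  have eq: "{x. s (g + x) = y} = (\<lambda>h. g + h) -` {x. s x = y} \<inter> space \<mu>" for y by auto
  show "simple (\<lambda>x. s (g + x))"
    unfolding simple_function_def
  proof (intro conjI ballI)
    show "finite ((\<lambda>x. s (g + x)) ` space \<mu>)"
      using simple_functionD(1)[OF s] range by simp
    show "(\<lambda>x. s (g + x)) -` {y} \<inter> space \<mu> \<in> sets \<mu>" for y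
      using measurable_sets[OF tr m[of y]] by (simp add: vimage_def)
  qed
  have "measure \<mu> {x. s (g + x) = y} = measure \<mu> {x. s x = y}" for y
    unfolding eq using measure_distr[OF tr m] by (simp only: distr_haar)
  then show "sint (\<lambda>x. s (g + x)) = sint s"
    using range by (simp add: simple_bochner_integral_def)
qed

text \<open>Quantifying over all uniformly approximating sequences, instead of choosing one, lets
  any convenient sequence compute the average. The description is meaningful for continuous
  \<open>f\<close>, which always has such sequences.\<close>

definition mean :: "('g \<Rightarrow> 'b::banach) \<Rightarrow> 'b" where
  "mean f = (THE y. \<forall>s. (\<forall>n. simple (s n)) \<longrightarrow> uniform_limit UNIV s f sequentially \<longrightarrow>
      (\<lambda>n. sint (s n)) \<longlonglongrightarrow> y)"

lemma sint_diff_le: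
  assumes "simple s" "simple t" "\<And>x. norm (s x - t x) \<le> C"
  shows "norm (sint s - sint t) \<le> C"
proof -
  have "simple (\<lambda>x. s x - t x)" by (rule simple_function_compose2[OF assms(1,2)])
  from norm_sint_le[OF this assms(3)] show ?thesis
    using assms(1,2) by (simp add: simple_bochner_integral_diff)
qed

lemma simple_sequence:
  fixes f :: "'g \<Rightarrow> 'b::metric_space"
  assumes f: "continuous_on UNIV f"
  obtains s where "\<And>n::nat. simple (s n)" "uniform_limit UNIV s f sequentially"
proof -
  have "\<forall>n::nat. \<exists>s. simple s \<and> (\<forall>x. dist (s x) (f x) < inverse (of_nat (Suc n)))"
    using simple_approximation[OF compact_group sets_haar f] by simp
  then obtain s where s: "\<And>n::nat. simple (s n)"
    "\<And>n x. dist (s n x) (f x) < inverse (of_nat (Suc n))" by metis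
  have "uniform_limit UNIV s f sequentially"
  proof (rule uniform_limitI)
    fix e :: real assume "e > 0"
    then have "\<forall>\<^sub>F n in sequentially. inverse (of_nat (Suc n)) < e"
      by (intro order_tendstoD[OF LIMSEQ_inverse_real_of_nat])
    then show "\<forall>\<^sub>F n in sequentially. \<forall>x\<in>UNIV. dist (s n x) (f x) < e"
      by eventually_elim (meson s(2) order.strict_trans)
  qed
  then show ?thesis using s(1) that by blast
qed

lemma sint_limits_agree:
  fixes s t :: "nat \<Rightarrow> 'g \<Rightarrow> 'b::banach"
  assumes "\<And>n. simple (s n)" "\<And>n. simple (t n)"
    and "uniform_limit UNIV s f sequentially" "uniform_limit UNIV t f sequentially"
  shows "(\<lambda>n. sint (s n) - sint (t n)) \<longlonglongrightarrow> 0"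
proof (rule tendstoI)
  fix e :: real assume e: "e > 0"
  have "uniform_limit UNIV (\<lambda>n x. s n x - t n x) (\<lambda>x. f x - f x) sequentially"
    by (intro uniform_limit_minus assms)
  from uniform_limitD[OF this, of "e/2"] e
  have "\<forall>\<^sub>F n in sequentially. \<forall>x. norm (s n x - t n x) < e/2" by simp
  then show "\<forall>\<^sub>F n in sequentially. dist (sint (s n) - sint (t n)) 0 < e"
  proof eventually_elim
    case (elim n)
    then have "norm (sint (s n) - sint (t n)) \<le> e/2"
      by (intro sint_diff_le assms) (auto intro: less_imp_le)
    then show ?case using e by simp
  qed
qed

text \<open>Integration of simple functions is a contraction for the sup norm, so uniformly close
  approximants have close integrals; completeness of the target gives the limit.\<close>

lemma mean_tendsto:
  assumes f: "continuous_on UNIV f" and s: "\<And>n. simple (s n)" "uniform_limit UNIV s f sequentially"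
  shows "(\<lambda>n. sint (s n)) \<longlonglongrightarrow> mean f"
proof -
  obtain t where t: "\<And>n::nat. simple (t n)" "uniform_limit UNIV t f sequentially"
    using simple_sequence[OF f] by blast
  have "Cauchy (\<lambda>n. sint (t n))"
  proof (rule metric_CauchyI)
    fix e :: real assume e: "e > 0"
    obtain M where M: "\<forall>m\<ge>M. \<forall>x. dist (t m x) (f x) < e/4"
      using uniform_limitD[OF t(2), of "e/4"] e by (auto simp: eventually_sequentially)
    show "\<exists>M. \<forall>m\<ge>M. \<forall>n\<ge>M. dist (sint (t m)) (sint (t n)) < e"
    proof (intro exI allI impI)
      fix m n assume "m \<ge> M" "n \<ge> M"
      have "norm (t m x - t n x) \<le> e/2" for x
      proof -
        have "dist (t m x) (f x) < e/4" "dist (t n x) (f x) < e/4"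
          using M \<open>m \<ge> M\<close> \<open>n \<ge> M\<close> by auto
        then show ?thesis
          using dist_triangle2[of "t m x" "t n x" "f x"] by (simp add: dist_norm)
      qed
      then have "norm (sint (t m) - sint (t n)) \<le> e/2"
        by (intro sint_diff_le t)
      then show "dist (sint (t m)) (sint (t n)) < e" using e by (simp add: dist_norm)
    qed
  qed
  then obtain y where y: "(\<lambda>n. sint (t n)) \<longlonglongrightarrow> y" using Cauchy_convergent convergent_def by blast
  have *: "(\<lambda>n. sint (s n)) \<longlonglongrightarrow> y"
    if "\<And>n. simple (s n)" "uniform_limit UNIV s f sequentially" for s
    using tendsto_add[OF sint_limits_agree[OF that(1) t(1) that(2) t(2)] y] by simp
  have "mean f = y"
    unfolding mean_def
  proof (rule the_equality)
    fix z assume "\<forall>s. (\<forall>n. simple (s n)) \<longrightarrow> uniform_limit UNIV s f sequentially \<longrightarrow>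
      (\<lambda>n. sint (s n)) \<longlonglongrightarrow> z"
    then show "z = y" using t y LIMSEQ_unique by blast
  qed (use * in blast)
  then show ?thesis using *[OF s] by simp
qed

lemma mean_const [simp]: "mean (\<lambda>x. c) = c"
  using mean_tendsto[of "\<lambda>x. c" "\<lambda>n x. c"] by (simp add: sint_const LIMSEQ_const_iff uniform_limit_const)

lemma mean_add:
  assumes f: "continuous_on UNIV f" and g: "continuous_on UNIV g"
  shows "mean (\<lambda>x. f x + g x) = mean f + mean g"
proof -
  obtain s where s: "\<And>n::nat. simple (s n)" "uniform_limit UNIV s f sequentially"
    using simple_sequence[OF f] by blast
  obtain t where t: "\<And>n::nat. simple (t n)" "uniform_limit UNIV t g sequentially"
    using simple_sequence[OF g] by blast
  have "(\<lambda>n. sint (\<lambda>x. s n x + t n x)) \<longlonglongrightarrow> mean (\<lambda>x. f x + g x)"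
    by (intro mean_tendsto continuous_intros f g uniform_limit_add s t simple_function_compose2[OF s(1) t(1)])
  then have "(\<lambda>n. sint (s n) + sint (t n)) \<longlonglongrightarrow> mean (\<lambda>x. f x + g x)"
    using s(1) t(1) by (simp add: simple_bochner_integral_add)
  then show ?thesis
    using LIMSEQ_unique tendsto_add[OF mean_tendsto[OF f s] mean_tendsto[OF g t]] by blast
qed

lemma mean_bounded_linear:
  assumes L: "bounded_linear L" and f: "continuous_on UNIV f"
  shows "mean (\<lambda>x. L (f x)) = L (mean f)"
proof -
  interpret bounded_linear L by fact
  obtain s where s: "\<And>n::nat. simple (s n)" "uniform_limit UNIV s f sequentially"
    using simple_sequence[OF f] by blast
  have "(\<lambda>n. sint (\<lambda>x. L (s n x))) \<longlonglongrightarrow> mean (\<lambda>x. L (f x))"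
    by (intro mean_tendsto continuous_on f bounded_linear.uniform_limit[OF L] s
        simple_function_compose1[OF s(1)])
  moreover have "sint (\<lambda>x. L (s n x)) = L (sint (s n))" for n
    using s(1) by (intro simple_bochner_integral_linear linear_axioms) auto
  ultimately show ?thesis
    using LIMSEQ_unique tendsto[OF mean_tendsto[OF f s]] by auto
qed

lemma norm_mean_bound:
  assumes f: "continuous_on UNIV f" and le: "\<And>x. norm (f x) \<le> C"
  shows "norm (mean f) \<le> C"
proof (rule field_le_epsilon)
  fix e :: real assume e: "e > 0"
  obtain s where s: "\<And>n::nat. simple (s n)" "uniform_limit UNIV s f sequentially"
    using simple_sequence[OF f] by blast
  have "\<forall>\<^sub>F n in sequentially. \<forall>x. dist (s n x) (f x) < e"
    using uniform_limitD[OF s(2) e] by simp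
  then have "\<forall>\<^sub>F n in sequentially. norm (sint (s n)) \<le> C + e"
  proof eventually_elim
    case (elim n)
    have "norm (s n x) \<le> C + e" for x
      using elim[rule_format, of x] le[of x] norm_triangle_sub[of "s n x" "f x"] by (simp add: dist_norm)
    then show ?case by (rule norm_sint_le[OF s(1)])
  qed
  then show "norm (mean f) \<le> C + e"
    using tendsto_upperbound[OF tendsto_norm[OF mean_tendsto[OF f s]]] by simp
qed

lemma mean_translate:
  assumes f: "continuous_on UNIV f"
  shows "mean (\<lambda>x. f (g + x)) = mean f"
proof -
  obtain s where s: "\<And>n::nat. simple (s n)" "uniform_limit UNIV s f sequentially"
    using simple_sequence[OF f] by blast
  have "(\<lambda>n. sint (\<lambda>x. s n (g + x))) \<longlonglongrightarrow> mean (\<lambda>x. f (g + x))"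
  proof (rule mean_tendsto)
    show "continuous_on UNIV (\<lambda>x. f (g + x))"
      by (intro continuous_intros continuous_on_compose2[OF f]) auto
    show "uniform_limit UNIV (\<lambda>n x. s n (g + x)) (\<lambda>x. f (g + x)) sequentially"
      using s(2) by (auto simp: uniform_limit_iff elim!: eventually_mono)
  qed (rule sint_translate(1)[OF s(1)])
  then show ?thesis
    using LIMSEQ_unique[OF mean_tendsto[OF f s]] sint_translate(2)[OF s(1)] by auto
qed

lemma mean_uminus:
  assumes f: "continuous_on UNIV f"
  shows "mean (\<lambda>x. - f x) = - mean f"
  by (rule mean_bounded_linear[OF bounded_linear_minus[OF bounded_linear_ident] f])

lemma mean_diff:
  assumes f: "continuous_on UNIV f" and g: "continuous_on UNIV g"
  shows "mean (\<lambda>x. f x - g x) = mean f - mean g"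
  using mean_add[OF f continuous_on_minus[OF g]] by (simp add: mean_uminus[OF g])

lemma mean_scaleR:
  assumes f: "continuous_on UNIV f"
  shows "mean (\<lambda>x. c *\<^sub>R f x) = c *\<^sub>R mean f"
  by (rule mean_bounded_linear[OF bounded_linear_scaleR_right f])

lemma mean_sum:
  assumes "\<And>i. i \<in> A \<Longrightarrow> continuous_on UNIV (f i)"
  shows "mean (\<lambda>x. \<Sum>i\<in>A. f i x) = (\<Sum>i\<in>A. mean (f i))"
  using assms
proof (induction A rule: infinite_finite_induct)
  case (insert a A)
  have "continuous_on UNIV (\<lambda>x. \<Sum>i\<in>A. f i x)"
    by (intro continuous_intros) (use insert in auto)
  then show ?case using insert by (simp add: mean_add)
qed auto

lemma mean_approx:
  assumes h: "continuous_on UNIV h" and s: "simple s" and le: "\<And>x. norm (h x - s x) \<le> e"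
  shows "norm (mean h - sint s) \<le> e"
proof (rule field_le_epsilon)
  fix d :: real assume d: "d > 0"
  obtain t where t: "\<And>n::nat. simple (t n)" "uniform_limit UNIV t h sequentially"
    using simple_sequence[OF h] by blast
  have "\<forall>\<^sub>F n in sequentially. \<forall>x. dist (t n x) (h x) < d"
    using uniform_limitD[OF t(2) d] by simp
  then have "\<forall>\<^sub>F n in sequentially. norm (sint (t n) - sint s) \<le> e + d"
  proof eventually_elim
    case (elim n)
    have "norm (t n x - s x) \<le> e + d" for x
      using elim[rule_format, of x] le[of x] norm_triangle_ineq[of "t n x - h x" "h x - s x"]
      by (simp add: dist_norm)
    then show ?case by (rule sint_diff_le[OF t(1) s])
  qed
  then show "norm (mean h - sint s) \<le> e + d"
    using tendsto_upperbound[OF tendsto_norm[OF tendsto_diff[OF mean_tendsto[OF h t] tendsto_const]]]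
    by simp
qed

section \<open>Averages depending on a parameter and iterated averages\<close>

lemma continuous_on_mean:
  fixes f :: "'x::t2_space \<Rightarrow> 'g \<Rightarrow> 'b::banach"
  assumes f: "continuous_on UNIV (\<lambda>(x, y). f x y)"
  shows "continuous_on UNIV (\<lambda>x. mean (f x))"
proof -
  have "isCont (\<lambda>x. mean (f x)) x0" for x0
    unfolding continuous_at
  proof (rule tendstoI)
    fix e :: real assume e: "e > 0"
    obtain U where U: "open U" "x0 \<in> U" "\<forall>x\<in>U. \<forall>y. dist (f x y) (f x0 y) \<le> e/2"
      using continuous_uniformly_in_compact_variable[OF f compact_group, of "e/2" x0] e by auto
    have "dist (mean (f x)) (mean (f x0)) < e" if "x \<in> U" for x
    proof -
      have "norm (mean (\<lambda>y. f x y - f x0 y)) \<le> e/2"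
        by (rule norm_mean_bound)
          (use U that in \<open>auto intro!: continuous_intros continuous_on_curry[OF f] simp: dist_norm\<close>)
      then show ?thesis
        using e by (simp add: dist_norm mean_diff continuous_on_curry[OF f])
    qed
    then show "\<forall>\<^sub>F x in at x0. dist (mean (f x)) (mean (f x0)) < e"
      using U(1,2) by (auto simp: eventually_at_topological)
  qed
  then show ?thesis by (simp add: continuous_at_imp_continuous_on)
qed

text \<open>Fubini's theorem without a product measure. A simple function \<open>t\<close> tags the
  points so that \<open>f x\<close> and \<open>f (t x)\<close> are uniformly within
  \<open>e/2\<close>. Both iterated averages are then within \<open>e/2\<close> of one finite sum:
  the averages \<open>mean (f c)\<close>, weighted with the measures of the level sets of
  \<open>t\<close>.\<close>

lemma mean_swap:
  fixes f :: "'g \<Rightarrow> 'g \<Rightarrow> 'b::banach"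
  assumes f: "continuous_on UNIV (\<lambda>(x, y). f x y)"
  shows "mean (\<lambda>x. mean (\<lambda>y. f x y)) = mean (\<lambda>y. mean (\<lambda>x. f x y))"
proof -
  note fc = continuous_on_curry[OF f]
  have "continuous_on UNIV (\<lambda>p. case (snd p, fst p) of (x, y) \<Rightarrow> f x y)"
    by (rule continuous_on_compose2[OF f]) (intro continuous_intros, simp)
  then have "continuous_on UNIV (\<lambda>(y, x). f x y)" by (simp add: case_prod_beta)
  note fm = continuous_on_mean[OF f] continuous_on_mean[OF this]
  have "norm (mean (\<lambda>x. mean (\<lambda>y. f x y)) - mean (\<lambda>y. mean (\<lambda>x. f x y))) \<le> e" if "e > 0" for e
  proof -
    have "\<forall>x0. \<exists>U. open U \<and> x0 \<in> U \<and> (\<forall>x\<in>U. \<forall>y. dist (f x y) (f x0 y) \<le> e/2)"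
      using continuous_uniformly_in_compact_variable[OF f compact_group, of "e/2"] that by auto
    from choice[OF this] obtain U where "\<forall>x0. open (U x0) \<and> x0 \<in> U x0 \<and> (\<forall>x\<in>U x0. \<forall>y. dist (f x y) (f x0 y) \<le> e/2)"
      by blast
    then have U: "\<And>x. open (U x)" "\<And>x. x \<in> U x"
      "\<And>x0 x y. x \<in> U x0 \<Longrightarrow> dist (f x y) (f x0 y) \<le> e/2" by blast+
    obtain t where t: "simple t" "\<And>x. x \<in> U (t x)"
      using tagged_cover[OF compact_group sets_haar U(1,2)] by blast
    have near: "norm (f x y - f (t x) y) \<le> e/2" for x y
      using U(3)[OF t(2)] by (simp add: dist_norm)
    define m where "m c = measure \<mu> {x \<in> space \<mu>. t x = c}" for c
    have sum: "simple (\<lambda>x. h (t x))" "sint (\<lambda>x. h (t x)) = (\<Sum>c\<in>range t. m c *\<^sub>R h c)"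
      for h :: "'g \<Rightarrow> 'b"
    proof -
      show "simple (\<lambda>x. h (t x))" by (rule simple_function_compose1[OF t(1)])
      then have "sint (\<lambda>x. h (t x)) = (\<Sum>c\<in>t ` space \<mu>. measure \<mu> {x \<in> space \<mu>. t x = c} *\<^sub>R h c)"
        by (intro simple_bochner_integral_partition t(1)) simp_all
      then show "sint (\<lambda>x. h (t x)) = (\<Sum>c\<in>range t. m c *\<^sub>R h c)" by (simp add: m_def)
    qed
    have "norm (mean (f x) - mean (f (t x))) \<le> e/2" for x
      using norm_mean_bound[OF continuous_on_diff[OF fc(1) fc(1)] near]
      by (simp only: mean_diff[OF fc(1) fc(1)])
    from mean_approx[OF fm(1) sum(1)[of "\<lambda>c. mean (f c)"] this]
    have 1: "norm (mean (\<lambda>x. mean (f x)) - (\<Sum>c\<in>range t. m c *\<^sub>R mean (f c))) \<le> e/2"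
      by (simp only: sum(2)[of "\<lambda>c. mean (f c)"])
    have "norm (mean (\<lambda>x. f x y) - (\<Sum>c\<in>range t. m c *\<^sub>R f c y)) \<le> e/2" for y
      using mean_approx[OF fc(2) sum(1)[of "\<lambda>c. f c y"] near]
      by (simp only: sum(2)[of "\<lambda>c. f c y"])
    moreover have sc: "continuous_on UNIV (\<lambda>y. m c *\<^sub>R f c y)" for c
      by (intro continuous_intros fc)
    ultimately have "norm (mean (\<lambda>y. mean (\<lambda>x. f x y) - (\<Sum>c\<in>range t. m c *\<^sub>R f c y))) \<le> e/2"
      by (intro norm_mean_bound continuous_on_diff fm(2) continuous_on_sum)
    moreover have "mean (\<lambda>y. \<Sum>c\<in>range t. m c *\<^sub>R f c y) = (\<Sum>c\<in>range t. m c *\<^sub>R mean (f c))"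
      by (simp only: mean_sum[OF sc] mean_scaleR[OF fc(1)])
    ultimately have 2: "norm (mean (\<lambda>y. mean (\<lambda>x. f x y)) - (\<Sum>c\<in>range t. m c *\<^sub>R mean (f c))) \<le> e/2"
      by (simp only: mean_diff[OF fm(2) continuous_on_sum[OF sc]])
    have "norm (mean (\<lambda>x. mean (f x)) - mean (\<lambda>y. mean (\<lambda>x. f x y))) \<le> e/2 + e/2"
      using norm_diff_triangle_le[OF 1 2[unfolded norm_minus_commute[of "mean (\<lambda>y. mean (\<lambda>x. f x y))"]]] .
    then show ?thesis by simp
  qed
  then have "norm (mean (\<lambda>x. mean (\<lambda>y. f x y)) - mean (\<lambda>y. mean (\<lambda>x. f x y))) \<le> 0"
    by (metis add_0 field_le_epsilon)
  then show ?thesis by (metis eq_iff_diff_eq_0 norm_le_zero_iff)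
qed

section \<open>Inversion and right translations\<close>

lemma continuous_on_translate:
  fixes f :: "'g \<Rightarrow> 'b::topological_space"
  assumes "continuous_on UNIV f"
  shows "continuous_on UNIV (\<lambda>x. f (g + x))" "continuous_on UNIV (\<lambda>x. f (x + g))"
    "continuous_on UNIV (\<lambda>x. f (- x))"
  by (rule continuous_on_compose2[OF assms], intro continuous_intros, simp)+

text \<open>Unimodularity of compact groups. Averaging \<open>f (- y + x)\<close> over
  \<open>x\<close> alone gives \<open>mean f\<close>, over \<open>y\<close> alone the average of the
  inverted function, both by left invariance; exchanging the two averages compares them.\<close>

lemma mean_inverse:
  assumes f: "continuous_on UNIV f"
  shows "mean (\<lambda>x. f (- x)) = mean f"
proof -
  have c: "continuous_on UNIV (\<lambda>(x, y). f (- y + x))"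
    unfolding case_prod_beta by (auto intro!: continuous_on_compose2[OF f] continuous_intros)
  have "mean (\<lambda>x. mean (\<lambda>y. f (- y + x))) = mean (\<lambda>x. f (- x))"
  proof -
    have "mean (\<lambda>y. f (- y + x)) = mean (\<lambda>y. f (- y))" for x
      using mean_translate[OF continuous_on_translate(3)[OF f], of "- x"]
      by (simp add: minus_add)
    then show ?thesis by simp
  qed
  moreover have "mean (\<lambda>y. mean (\<lambda>x. f (- y + x))) = mean f"
    by (simp add: mean_translate[OF f])
  ultimately show ?thesis using mean_swap[OF c] by simp
qed

lemma mean_translate_right:
  assumes f: "continuous_on UNIV f"
  shows "mean (\<lambda>x. f (x + g)) = mean f"
proof -
  have "mean (\<lambda>x. f (x + g)) = mean (\<lambda>x. f (- x + g))"
    by (rule mean_inverse[OF continuous_on_translate(2)[OF f], symmetric])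
  also have "\<dots> = mean (\<lambda>x. f (- (- g + x)))" by (simp only: minus_add minus_minus)
  also have "\<dots> = mean f"
    by (simp only: mean_translate[OF continuous_on_translate(3)[OF f], of "- g"] mean_inverse[OF f])
  finally show ?thesis .
qed

section \<open>Positivity, norm estimates and limits\<close>

lemma bounded_continuous:
  fixes f :: "'g \<Rightarrow> 'b::real_normed_vector"
  assumes "continuous_on UNIV f"
  obtains C where "0 < C" "\<And>x. norm (f x) \<le> C"
proof -
  have "bounded (range f)"
    using compact_imp_bounded compact_continuous_image[OF assms compact_group] by blast
  then show ?thesis using that by (auto simp: bounded_pos)
qed

lemma mean_nonneg:
  fixes f :: "'g \<Rightarrow> real"
  assumes f: "continuous_on UNIV f" and pos: "\<And>x. 0 \<le> f x"
  shows "0 \<le> mean f"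
proof -
  obtain C where C: "0 < C" "\<And>x. norm (f x) \<le> C" using bounded_continuous[OF f] by blast
  have "norm (mean (\<lambda>x. C - f x)) \<le> C"
  proof (rule norm_mean_bound)
    show "norm (C - f x) \<le> C" for x using C(2)[of x] pos[of x] by simp
  qed (intro continuous_intros f)
  then show ?thesis using mean_diff[OF continuous_on_const f, of C] by simp
qed

lemma mean_mono:
  fixes f g :: "'g \<Rightarrow> real"
  assumes "continuous_on UNIV f" "continuous_on UNIV g" "\<And>x. f x \<le> g x"
  shows "mean f \<le> mean g"
proof -
  have "0 \<le> mean (\<lambda>x. g x - f x)"
    using assms(3) by (intro mean_nonneg continuous_on_diff assms) simp
  then show ?thesis using mean_diff[OF assms(2,1)] by simp
qed

text \<open>Finitely many translates of the open set where \<open>f\<close> exceeds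
  \<open>f x0 / 2\<close> cover the group. The sum of the corresponding translates of
  \<open>f\<close> is therefore at least \<open>f x0 / 2\<close> everywhere, while its average is a
  multiple of \<open>mean f\<close>.\<close>

lemma mean_pos:
  fixes f :: "'g \<Rightarrow> real"
  assumes f: "continuous_on UNIV f" and pos: "\<And>x. 0 \<le> f x" and x0: "0 < f x0"
  shows "0 < mean f"
proof -
  have op: "open {y. f x0 / 2 < f (x0 - z + y)}" for z
    by (intro open_Collect_less continuous_intros continuous_on_translate f)
  have mem: "z \<in> {y. f x0 / 2 < f (x0 - z + y)}" for z using x0 by simp
  obtain C where C: "finite C" "UNIV \<subseteq> (\<Union>z\<in>C. {y. f x0 / 2 < f (x0 - z + y)})"
  proof (rule compactE_image[OF compact_group, of UNIV "\<lambda>z. {y. f x0 / 2 < f (x0 - z + y)}"])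
    show "UNIV \<subseteq> (\<Union>z\<in>UNIV. {y. f x0 / 2 < f (x0 - z + y)})" using mem by blast
  qed (use op in auto)
  have cont: "continuous_on UNIV (\<lambda>y. f (x0 - z + y))" for z by (rule continuous_on_translate[OF f])
  have "f x0 / 2 \<le> (\<Sum>z\<in>C. f (x0 - z + y))" for y
  proof -
    obtain z where z: "z \<in> C" "f x0 / 2 < f (x0 - z + y)" using C(2) by blast
    have "f (x0 - z + y) \<le> (\<Sum>z\<in>C. f (x0 - z + y))"
      by (rule member_le_sum[OF z(1) pos C(1)])
    then show ?thesis using z(2) by simp
  qed
  then have "mean (\<lambda>y. f x0 / 2) \<le> mean (\<lambda>y. \<Sum>z\<in>C. f (x0 - z + y))"
    by (intro mean_mono continuous_intros cont)
  then have "f x0 / 2 \<le> of_nat (card C) * mean f"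
    by (simp add: mean_sum cont mean_translate[OF f])
  then show ?thesis
    using x0 mean_nonneg[OF f pos] by (cases "mean f = 0") auto
qed

lemma norm_mean_le:
  assumes f: "continuous_on UNIV f"
  shows "norm (mean f) \<le> mean (\<lambda>x. norm (f x))"
proof -
  obtain s where s: "\<And>n::nat. simple (s n)" "uniform_limit UNIV s f sequentially"
    using simple_sequence[OF f] by blast
  have n: "simple (\<lambda>x. norm (s n x))" for n by (rule simple_function_compose1[OF s(1)])
  have "(\<lambda>n. sint (\<lambda>x. norm (s n x))) \<longlonglongrightarrow> mean (\<lambda>x. norm (f x))"
    by (intro mean_tendsto n uniform_limit_norm s continuous_intros f)
  moreover have "norm (sint (s n)) \<le> sint (\<lambda>x. norm (s n x))" for n
    using simple_bochner_integral_norm_bound[of \<mu> "s n"] s(1) by simp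
  ultimately show ?thesis
    using LIMSEQ_le[OF tendsto_norm[OF mean_tendsto[OF f s]]] by blast
qed

lemma tendsto_mean:
  assumes "\<And>n. continuous_on UNIV (f n)" "continuous_on UNIV l" "uniform_limit UNIV f l sequentially"
  shows "(\<lambda>n::nat. mean (f n)) \<longlonglongrightarrow> mean l"
proof (rule tendstoI)
  fix e :: real assume e: "e > 0"
  have "\<forall>\<^sub>F n in sequentially. \<forall>x. dist (f n x) (l x) < e/2"
    using uniform_limitD[OF assms(3), of "e/2"] e by simp
  then show "\<forall>\<^sub>F n in sequentially. dist (mean (f n)) (mean l) < e"
  proof eventually_elim
    case (elim n)
    then have "norm (mean (\<lambda>x. f n x - l x)) \<le> e/2"
      by (intro norm_mean_bound continuous_intros assms) (auto simp: dist_norm less_imp_le)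
    then show ?case using e by (simp add: mean_diff assms dist_norm)
  qed
qed

end


section \<open>The convolution algebra\<close>

text \<open>In the application \<open>a n\<close> is the sum of \<lambda>^(2n+2) over the
  eigenvalues \<lambda> of a selfadjoint convolution operator, with multiplicity. Then
  \<open>l\<close> is the largest \<lambda>^2 and \<open>c\<close> counts the eigenvalues attaining
  it, which explains the exponent \<open>Suc n\<close> and the bound \<open>1 \<le> c\<close>. In
  general, log-convexity makes the ratios increase to \<open>l\<close>, so that
  \<open>a n / l ^ Suc n\<close> decreases, and submultiplicativity keeps it at least 1.\<close>

lemma logconvex_submultiplicative_limit:
  fixes a :: "nat \<Rightarrow> real"
  assumes pos: "\<And>n. 0 < a n"
    and convex: "\<And>n. (a (Suc n))\<^sup>2 \<le> a n * a (Suc (Suc n))"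
    and submult: "\<And>j k. a (j + k + 1) \<le> a j * a k"
  shows "\<exists>l c. 0 < l \<and> 1 \<le> c \<and> (\<lambda>n. a n / l ^ Suc n) \<longlonglongrightarrow> c"
proof -
  define r where "r n = a (Suc n) / a n" for n
  have r_mono: "incseq r"
    by (rule incseq_SucI)
      (use convex pos in \<open>simp add: r_def divide_simps power2_eq_square mult.commute\<close>)
  have r_le: "r n \<le> a 0" for n
    using submult[of n 0] pos[of n] by (simp add: r_def divide_simps mult.commute)
  obtain l where l: "r \<longlonglongrightarrow> l" "\<And>n. r n \<le> l"
    using incseq_convergent[OF r_mono, of "a 0"] r_le by auto
  have rpos: "0 < r n" for n using pos by (simp add: r_def)
  have lpos: "0 < l" using l(2)[of 0] rpos[of 0] by linarith
  define d where "d n = a n / l ^ Suc n" for n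
  have dpos: "0 < d n" for n using pos lpos by (simp add: d_def)
  have "d (Suc n) \<le> d n" for n
  proof -
    have "a (Suc n) \<le> l * a n" using l(2)[of n] pos[of n] by (simp add: r_def divide_simps)
    then show ?thesis using lpos by (simp add: d_def divide_simps mult.commute)
  qed
  then have "decseq d" by (rule decseq_SucI)
  then obtain c where c: "d \<longlonglongrightarrow> c" "\<And>n. c \<le> d n"
    by (rule decseq_convergent[of d 0]) (use dpos less_imp_le in auto)
  have d_ge: "1 \<le> d n" for n
  proof (rule ccontr)
    assume "\<not> 1 \<le> d n"
    then have an: "a n < l ^ Suc n" using lpos by (simp add: d_def divide_simps split: if_splits)
    \<comment> \<open>Along the multiples of \<open>Suc n\<close> the sequence grows at most like a power of \<open>a n\<close>, which is
      less than \<open>l ^ Suc n\<close>; but the ratios tend to \<open>l\<close>.\<close>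
    have "((\<lambda>x. x ^ Suc n) \<longlongrightarrow> l ^ Suc n) (at_left l)"
      by (intro tendsto_intros)
    then have "\<forall>\<^sub>F x in at_left l. a n < x ^ Suc n" using an by (rule order_tendstoD)
    moreover have "\<forall>\<^sub>F x in at_left l. 0 < x" 
      using eventually_at_left_real[OF lpos] by eventually_elim simp
    moreover have "\<forall>\<^sub>F x in at_left l. x < l"
      by (simp add: eventually_at_filter)
    ultimately have "\<forall>\<^sub>F x in at_left l. a n < x ^ Suc n \<and> 0 < x \<and> x < l" by eventually_elim simp
    then obtain \<rho> where \<rho>: "a n < \<rho> ^ Suc n" "0 < \<rho>" "\<rho> < l"
      using eventually_happens trivial_limit_at_left_real by blast
    obtain N where N: "\<And>m. m \<ge> N \<Longrightarrow> \<rho> < r m"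
      using order_tendstoD(1)[OF l(1) \<rho>(3)] by (auto simp: eventually_sequentially)
    have lower: "a N * \<rho> ^ i \<le> a (N + i)" for i
    proof (induction i)
      case (Suc i)
      have "\<rho> * a (N + i) \<le> a (Suc (N + i))"
        using N[of "N + i"] pos[of "N + i"] by (simp add: r_def divide_simps)
      moreover have "\<rho> * (a N * \<rho> ^ i) \<le> \<rho> * a (N + i)"
        using Suc \<rho>(2) by (intro mult_left_mono) auto
      ultimately show ?case by (simp add: ac_simps)
    qed simp
    \<comment> \<open>With \<open>Suc n\<close> regarded as the degree of \<open>a n\<close>, the
      hypothesis \<open>submult\<close> says that \<open>a\<close> is submultiplicative for the
      addition of degrees; subtracting 1 returns from the degree to the index.\<close>
    have upper: "a (Suc k * Suc n - 1) \<le> a n ^ Suc k" for k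
    proof (induction k)
      case (Suc k)
      have "Suc (Suc k) * Suc n - 1 = n + (Suc k * Suc n - 1) + 1" by simp
      then have "a (Suc (Suc k) * Suc n - 1) \<le> a n * a (Suc k * Suc n - 1)"
        using submult[of n "Suc k * Suc n - 1"] by presburger
      also have "\<dots> \<le> a n * a n ^ Suc k" using Suc pos[of n] by (intro mult_left_mono) auto
      finally show ?case by simp
    qed simp
    define q where "q = \<rho> ^ Suc n / a n"
    have q: "1 < q" using \<rho>(1) pos[of n] by (simp add: q_def divide_simps)
    have bound: "a N * q ^ Suc k \<le> \<rho> ^ Suc N" if "N \<le> k" for k
    proof -
      have "N + 1 \<le> Suc k * Suc n" using that by simp
      then have e: "Suc k * Suc n - 1 = N + (Suc k * Suc n - 1 - N)"
        "Suc k * Suc n = Suc N + (Suc k * Suc n - 1 - N)" by linarith+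
      have "a N * \<rho> ^ (Suc k * Suc n) = \<rho> ^ Suc N * (a N * \<rho> ^ (Suc k * Suc n - 1 - N))"
        by (subst e(2)) (simp only: power_add ac_simps)
      also have "\<dots> \<le> \<rho> ^ Suc N * a (Suc k * Suc n - 1)"
        using lower[of "Suc k * Suc n - 1 - N"] e(1) \<rho>(2) by (intro mult_left_mono) auto
      also have "\<dots> \<le> \<rho> ^ Suc N * a n ^ Suc k"
        using upper[of k] \<rho>(2) by (intro mult_left_mono) auto
      finally have "a N * (\<rho> ^ Suc n) ^ Suc k \<le> \<rho> ^ Suc N * a n ^ Suc k"
        by (simp only: power_mult[symmetric] mult.commute[of "Suc n"])
      then show ?thesis
        using pos[of n] by (simp only: q_def power_divide) (simp add: divide_simps del: power_Suc)
    qed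
    obtain K where K: "\<rho> ^ Suc N / a N < q ^ K" using real_arch_pow[OF q] by blast
    also have "q ^ K \<le> q ^ Suc (max K N)" using q by (intro power_increasing) auto
    finally have "\<rho> ^ Suc N / a N < q ^ Suc (max K N)" .
    moreover have "a N * q ^ Suc (max K N) \<le> \<rho> ^ Suc N" by (rule bound) simp
    ultimately show False using pos[of N] by (simp add: divide_simps mult.commute del: power_Suc split: if_splits)
  qed
  have "1 \<le> c" by (rule tendsto_lowerbound[OF c(1)]) (simp_all add: d_ge)
  then show ?thesis using lpos c(1) unfolding d_def by blast
qed

context compact_haar
begin

section \<open>The scalar product of continuous functions\<close>

abbreviation cont :: "('g \<Rightarrow> complex) \<Rightarrow> bool" where
  "cont f \<equiv> continuous_on UNIV f"

definition ip :: "('g \<Rightarrow> complex) \<Rightarrow> ('g \<Rightarrow> complex) \<Rightarrow> complex" where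
  "ip f g = mean (\<lambda>x. f x * cnj (g x))"

definition nsq :: "('g \<Rightarrow> complex) \<Rightarrow> real" where
  "nsq f = mean (\<lambda>x. (cmod (f x))\<^sup>2)"

lemma mean_mult_left:
  fixes f :: "'g \<Rightarrow> complex"
  assumes "cont f" shows "mean (\<lambda>x. c * f x) = c * mean f"
  by (rule mean_bounded_linear[OF bounded_linear_mult_right assms])

lemma mean_mult_right:
  fixes f :: "'g \<Rightarrow> complex"
  assumes "cont f" shows "mean (\<lambda>x. f x * c) = mean f * c"
  by (rule mean_bounded_linear[OF bounded_linear_mult_left assms])

lemma mean_cnj:
  assumes "cont f" shows "mean (\<lambda>x. cnj (f x)) = cnj (mean f)"
  by (rule mean_bounded_linear[OF bounded_linear_cnj assms])

lemma cont_mult_cnj: "cont f \<Longrightarrow> cont g \<Longrightarrow> cont (\<lambda>x. f x * cnj (g x))"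
  by (intro continuous_intros)

lemma ip_commute: "cont f \<Longrightarrow> cont g \<Longrightarrow> ip g f = cnj (ip f g)"
  using mean_cnj[OF cont_mult_cnj, of f g] by (simp add: ip_def mult.commute)

lemma ip_diff_left: "cont f \<Longrightarrow> cont g \<Longrightarrow> cont h \<Longrightarrow> ip (\<lambda>x. f x - g x) h = ip f h - ip g h"
  using mean_diff[OF cont_mult_cnj cont_mult_cnj, of f h g h] by (simp add: ip_def left_diff_distrib)

lemma ip_mult_left: "cont f \<Longrightarrow> cont h \<Longrightarrow> ip (\<lambda>x. c * f x) h = c * ip f h"
  using mean_mult_left[OF cont_mult_cnj, of f h c] by (simp add: ip_def mult.assoc)

lemma ip_mult_right: "cont f \<Longrightarrow> cont h \<Longrightarrow> ip h (\<lambda>x. c * f x) = cnj c * ip h f"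
  using mean_mult_left[OF cont_mult_cnj, of h f "cnj c"] by (simp add: ip_def mult_ac)

lemma ip_diff_right: "cont f \<Longrightarrow> cont g \<Longrightarrow> cont h \<Longrightarrow> ip h (\<lambda>x. f x - g x) = ip h f - ip h g"
  using mean_diff[OF cont_mult_cnj cont_mult_cnj, of h f h g] by (simp add: ip_def right_diff_distrib)

lemma ip_sum_left:
  assumes "\<And>i. i \<in> A \<Longrightarrow> cont (f i)" "cont h"
  shows "ip (\<lambda>x. \<Sum>i\<in>A. f i x) h = (\<Sum>i\<in>A. ip (f i) h)"
  using mean_sum[OF cont_mult_cnj, of A f "\<lambda>_. h"] assms by (simp add: ip_def sum_distrib_right)

lemma cont_cmod_sq: "cont f \<Longrightarrow> continuous_on UNIV (\<lambda>x. (cmod (f x))\<^sup>2)"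
  by (intro continuous_intros)

lemma ip_self: "cont f \<Longrightarrow> ip f f = of_real (nsq f)"
  using mean_bounded_linear[OF bounded_linear_of_real cont_cmod_sq, of f]
  by (simp add: ip_def nsq_def complex_norm_square[symmetric] del: of_real_power)

lemma nsq_nonneg: "cont f \<Longrightarrow> 0 \<le> nsq f"
  unfolding nsq_def by (intro mean_nonneg cont_cmod_sq) auto

lemma nsq_pos: "cont f \<Longrightarrow> f x \<noteq> 0 \<Longrightarrow> 0 < nsq f"
  unfolding nsq_def by (rule mean_pos[OF cont_cmod_sq, where ?x0.0 = x]) auto

lemma nsq_eq_0: "cont f \<Longrightarrow> nsq f = 0 \<Longrightarrow> f x = 0"
  using nsq_pos by fastforce

lemma nsq_mult: "cont f \<Longrightarrow> nsq (\<lambda>x. c * f x) = (cmod c)\<^sup>2 * nsq f"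
  using mean_scaleR[OF cont_cmod_sq, of f "(cmod c)\<^sup>2"]
  by (simp add: nsq_def norm_mult power_mult_distrib)

lemma nsq_diff:
  assumes "cont f" "cont g"
  shows "nsq (\<lambda>x. f x - g x) = nsq f - 2 * Re (ip f g) + nsq g"
proof -
  have "complex_of_real (nsq (\<lambda>x. f x - g x)) = ip (\<lambda>x. f x - g x) (\<lambda>x. f x - g x)"
    by (rule ip_self[symmetric]) (intro continuous_intros assms)
  also have "\<dots> = of_real (nsq f) - (ip f g + cnj (ip f g)) + of_real (nsq g)"
    using assms by (simp add: ip_diff_left ip_diff_right continuous_on_diff ip_self ip_commute[of f g])
  also have "\<dots> = of_real (nsq f - 2 * Re (ip f g) + nsq g)"
    by (simp add: complex_add_cnj)
  finally show ?thesis by (simp only: of_real_eq_iff)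
qed

lemma parallelogram:
  assumes f: "cont f" and g: "cont g"
  shows "nsq (\<lambda>x. f x + g x) + nsq (\<lambda>x. f x - g x) = 2 * nsq f + 2 * nsq g"
proof -
  have "cont (\<lambda>x. - g x)" by (intro continuous_intros g)
  from nsq_diff[OF f this] have "nsq (\<lambda>x. f x + g x) = nsq f + 2 * Re (ip f g) + nsq g"
    using ip_mult_right[OF g f, of "-1"] nsq_mult[OF g, of "-1"] by simp
  then show ?thesis using nsq_diff[OF f g] by simp
qed

lemma Cauchy_Schwarz:
  assumes f: "cont f" and g: "cont g"
  shows "cmod (ip f g) \<le> sqrt (nsq f) * sqrt (nsq g)"
proof (cases "nsq f = 0 \<or> nsq g = 0")
  case True
  then have "(\<forall>x. f x = 0) \<or> (\<forall>x. g x = 0)" using nsq_eq_0 f g by blast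
  then show ?thesis using nsq_nonneg[OF f] nsq_nonneg[OF g] by (auto simp: ip_def)
next
  case False
  define a b where "a = sqrt (nsq f)" and "b = sqrt (nsq g)"
  have ab: "0 < a" "0 < b" "nsq f = a\<^sup>2" "nsq g = b\<^sup>2"
    using False nsq_nonneg[OF f] nsq_nonneg[OF g] by (auto simp: a_def b_def less_le)
  have "cmod (ip f g) \<le> mean (\<lambda>x. cmod (f x) * cmod (g x))"
    unfolding ip_def using norm_mean_le[OF cont_mult_cnj[OF f g]] by (simp add: norm_mult)
  \<comment> \<open>The weights come from the inequality of means for \<open>b * cmod (f x)\<close>
    and \<open>a * cmod (g x)\<close>; after averaging, each of the two squares contributes half of
    \<open>a * b\<close>.\<close>
  also have "\<dots> \<le> mean (\<lambda>x. (b / (2 * a)) * (cmod (f x))\<^sup>2 + (a / (2 * b)) * (cmod (g x))\<^sup>2)"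
  proof (rule mean_mono)
    fix x
    have "(b * cmod (f x) - a * cmod (g x))\<^sup>2 \<ge> 0" by simp
    then have "2 * (a * b) * (cmod (f x) * cmod (g x)) \<le> b\<^sup>2 * (cmod (f x))\<^sup>2 + a\<^sup>2 * (cmod (g x))\<^sup>2"
      by (simp add: power2_diff power_mult_distrib algebra_simps)
    then show "cmod (f x) * cmod (g x) \<le> (b / (2 * a)) * (cmod (f x))\<^sup>2 + (a / (2 * b)) * (cmod (g x))\<^sup>2"
      using ab(1,2) by (simp add: divide_simps power2_eq_square) (simp add: algebra_simps)
  qed (intro continuous_intros f g)+
  also have "\<dots> = (b / (2 * a)) * nsq f + (a / (2 * b)) * nsq g"
    using mean_scaleR[OF cont_cmod_sq, of f "b / (2 * a)"] mean_scaleR[OF cont_cmod_sq, of g "a / (2 * b)"] f g ab(1,2)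
    by (subst mean_add) (auto intro!: continuous_intros simp: nsq_def)
  also have "\<dots> = a * b"
    unfolding ab(3,4) using ab(1,2) by (simp add: divide_simps power2_eq_square)
  finally show ?thesis by (simp add: a_def b_def)
qed

section \<open>Convolution and its involution\<close>

definition star :: "('g \<Rightarrow> complex) \<Rightarrow> 'g \<Rightarrow> complex" where
  "star f = (\<lambda>x. cnj (f (- x)))"

definition conv :: "('g \<Rightarrow> complex) \<Rightarrow> ('g \<Rightarrow> complex) \<Rightarrow> 'g \<Rightarrow> complex" where
  "conv f g = (\<lambda>x. mean (\<lambda>y. f y * g (- y + x)))"

lemma cont_star [simp, intro]: "cont f \<Longrightarrow> cont (star f)"
  unfolding star_def by (intro continuous_intros continuous_on_translate)

lemma star_star [simp]: "star (star f) = f"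
  by (simp add: star_def)

lemma cont_conv_kernel:
  assumes "cont f" "cont g"
  shows "continuous_on UNIV (\<lambda>(x, y). f y * g (- y + x))"
  unfolding case_prod_beta
  by (intro continuous_on_mult continuous_on_compose2[OF assms(1)] continuous_on_compose2[OF assms(2)]
      continuous_intros) auto

lemma cont_conv [simp, intro]: "cont f \<Longrightarrow> cont g \<Longrightarrow> cont (conv f g)"
  unfolding conv_def by (rule continuous_on_mean[OF cont_conv_kernel])

lemma cont_conv_integrand: "cont f \<Longrightarrow> cont g \<Longrightarrow> cont (\<lambda>y. f y * g (- y + x))"
  using continuous_on_curry(1)[OF cont_conv_kernel] by blast

lemma conv_assoc:
  assumes f: "cont f" and g: "cont g" and h: "cont h"
  shows "conv (conv f g) h = conv f (conv g h)"
proof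
  fix x
  have c: "continuous_on UNIV (\<lambda>(y, z). f z * g (- z + y) * h (- y + x))"
    unfolding case_prod_beta
    by (intro continuous_on_mult continuous_on_compose2[OF f] continuous_on_compose2[OF g]
        continuous_on_compose2[OF h] continuous_intros) auto
  have "conv (conv f g) h x = mean (\<lambda>y. mean (\<lambda>z. f z * g (- z + y) * h (- y + x)))"
    unfolding conv_def by (simp only: mean_mult_right[OF cont_conv_integrand[OF f g]])
  also have "\<dots> = mean (\<lambda>z. mean (\<lambda>y. f z * g (- z + y) * h (- y + x)))"
    by (rule mean_swap[OF c])
  also have "\<dots> = mean (\<lambda>z. f z * conv g h (- z + x))"
  proof (rule arg_cong[of _ _ mean], rule ext)
    fix z
    have c': "cont (\<lambda>y. g y * h (- y + (- z + x)))" by (rule cont_conv_integrand[OF g h])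
    have "mean (\<lambda>y. f z * g (- z + y) * h (- y + x))
      = f z * mean (\<lambda>y. g (- z + y) * h (- (- z + y) + (- z + x)))"
      using mean_mult_left[OF continuous_on_translate(1)[OF c', of "- z"], of "f z"]
      by (simp only: minus_add minus_minus add.assoc mult.assoc) (simp add: add.assoc[symmetric])
    also have "\<dots> = f z * conv g h (- z + x)"
      unfolding conv_def by (simp only: mean_translate[OF c', of "- z"])
    finally show "mean (\<lambda>y. f z * g (- z + y) * h (- y + x)) = f z * conv g h (- z + x)" .
  qed
  finally show "conv (conv f g) h x = conv f (conv g h) x" by (simp add: conv_def)
qed

lemma conv_0: "conv f g 0 = ip f (star g)"
  by (simp add: conv_def ip_def star_def)

lemma star_conv:
  assumes f: "cont f" and g: "cont g"
  shows "star (conv f g) = conv (star g) (star f)"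
proof
  fix x
  note c = cont_conv_integrand[OF cont_star[OF g] cont_star[OF f], of x]
  have "star (conv f g) x = mean (\<lambda>y. cnj (f y * g (- y + - x)))"
    unfolding star_def conv_def by (simp only: mean_cnj[OF cont_conv_integrand[OF f g]])
  also have "\<dots> = mean (\<lambda>y. star g (x + y) * star f (- (x + y) + x))"
    by (simp add: star_def minus_add add.assoc mult.commute)
  also have "\<dots> = conv (star g) (star f) x"
    unfolding conv_def by (rule mean_translate[OF c])
  finally show "star (conv f g) x = conv (star g) (star f) x" .
qed

text \<open>Convolution by \<open>star h\<close> is the adjoint of convolution by \<open>h\<close>.
  The averages are exchanged, \<open>x\<close> is translated by \<open>y\<close>, and an inversion
  of \<open>y\<close> brings in \<open>star\<close>.\<close>

lemma ip_conv_left: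
  assumes h: "cont h" and k: "cont k" and q: "cont q"
  shows "ip (conv h k) q = ip k (conv (star h) q)"
proof -
  have c: "continuous_on UNIV (\<lambda>(x, y). h y * k (- y + x) * cnj (q x))"
    unfolding case_prod_beta
    by (intro continuous_on_mult continuous_on_cnj continuous_on_compose2[OF h] continuous_on_compose2[OF k]
        continuous_on_compose2[OF q] continuous_intros) auto
  have c2: "continuous_on UNIV (\<lambda>(x, y). k x * h y * cnj (q (y + x)))"
    unfolding case_prod_beta
    by (intro continuous_on_mult continuous_on_cnj continuous_on_compose2[OF h] continuous_on_compose2[OF k]
        continuous_on_compose2[OF q] continuous_intros) auto
  have c3: "cont (\<lambda>x. h y * k (- y + x) * cnj (q x))" for y by (rule continuous_on_curry(2)[OF c])
  have "ip (conv h k) q = mean (\<lambda>x. mean (\<lambda>y. h y * k (- y + x) * cnj (q x)))"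
    unfolding ip_def conv_def by (simp only: mean_mult_right[OF cont_conv_integrand[OF h k]])
  also have "\<dots> = mean (\<lambda>y. mean (\<lambda>x. h y * k (- y + x) * cnj (q x)))" by (rule mean_swap[OF c])
  also have "\<dots> = mean (\<lambda>y. mean (\<lambda>x. k x * h y * cnj (q (y + x))))"
  proof (rule arg_cong[of _ _ mean], rule ext)
    fix y
    show "mean (\<lambda>x. h y * k (- y + x) * cnj (q x)) = mean (\<lambda>x. k x * h y * cnj (q (y + x)))"
      using mean_translate[OF c3[of y], of y] by (simp add: add.assoc[symmetric] mult.commute)
  qed
  also have "\<dots> = mean (\<lambda>x. mean (\<lambda>y. k x * h y * cnj (q (y + x))))" by (rule mean_swap[OF c2, symmetric])
  also have "\<dots> = mean (\<lambda>x. k x * cnj (conv (star h) q x))"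
  proof (rule arg_cong[of _ _ mean], rule ext)
    fix x
    have ci: "cont (\<lambda>y. star h y * q (- y + x))" by (rule cont_conv_integrand[OF cont_star[OF h] q])
    have "k x * cnj (conv (star h) q x) = mean (\<lambda>y. k x * cnj (star h y * q (- y + x)))"
      unfolding conv_def mean_cnj[OF ci, symmetric]
      by (rule mean_mult_left[symmetric]) (intro continuous_on_cnj ci)
    also have "\<dots> = mean (\<lambda>y. k x * h y * cnj (q (y + x)))"
      using mean_inverse[OF continuous_on_curry(1)[OF c2], of x] by (simp add: star_def mult.assoc)
    finally show "mean (\<lambda>y. k x * h y * cnj (q (y + x))) = k x * cnj (conv (star h) q x)" by simp
  qed
  finally show ?thesis unfolding ip_def .
qed

text \<open>Bounding a supremum by norms of the scalar product is what turns convergence in the weak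
  norm into uniform convergence. The inverted translate of \<open>g\<close> has the same norm as
  \<open>g\<close> by unimodularity.\<close>

lemma norm_conv_le:
  assumes f: "cont f" and g: "cont g"
  shows "cmod (conv f g x) \<le> sqrt (nsq f) * sqrt (nsq g)"
proof -
  have c: "cont (\<lambda>y. cnj (g (- y + x)))"
    by (intro continuous_on_cnj continuous_on_compose2[OF g] continuous_intros) auto
  have "nsq (\<lambda>y. cnj (g (- y + x))) = mean (\<lambda>y. (cmod (g (- y + x)))\<^sup>2)" by (simp add: nsq_def)
  also have "\<dots> = mean (\<lambda>y. (cmod (g (y + x)))\<^sup>2)"
    by (rule mean_inverse[OF continuous_on_translate(2)[OF cont_cmod_sq[OF g]]])
  also have "\<dots> = nsq g" unfolding nsq_def by (rule mean_translate_right[OF cont_cmod_sq[OF g]])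
  finally show ?thesis using Cauchy_Schwarz[OF f c] by (simp add: conv_def ip_def)
qed

lemma conv_diff_right:
  "cont f \<Longrightarrow> cont g \<Longrightarrow> cont h \<Longrightarrow> conv h (\<lambda>x. f x - g x) = (\<lambda>x. conv h f x - conv h g x)"
  unfolding conv_def right_diff_distrib
  by (simp only: mean_diff[OF cont_conv_integrand cont_conv_integrand])

lemma conv_mult_left:
  "cont f \<Longrightarrow> cont g \<Longrightarrow> conv (\<lambda>x. c * f x) g = (\<lambda>x. c * conv f g x)"
  unfolding conv_def mult.assoc
  by (simp only: mean_mult_left[OF cont_conv_integrand])

lemma conv_mult_right:
  "cont f \<Longrightarrow> cont g \<Longrightarrow> conv f (\<lambda>x. c * g x) = (\<lambda>x. c * conv f g x)"
  unfolding conv_def mult.left_commute[of _ c]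
  by (simp only: mean_mult_left[OF cont_conv_integrand])


lemma tendsto_conv:
  assumes "\<And>n. cont (q n)" "\<And>n. cont (s n)" "cont f" "cont g"
    and "uniform_limit UNIV q f sequentially" "uniform_limit UNIV s g sequentially"
  shows "(\<lambda>n::nat. conv (q n) (s n) x) \<longlonglongrightarrow> conv f g x"
  unfolding conv_def
proof (rule tendsto_mean)
  obtain C D where C: "\<And>x. cmod (f x) \<le> C" and D: "\<And>x. cmod (g x) \<le> D"
    using bounded_continuous[OF assms(3)] bounded_continuous[OF assms(4)] by metis
  have "uniform_limit UNIV (\<lambda>n y. s n (- y + x)) (\<lambda>y. g (- y + x)) sequentially"
    using assms(6) by (auto simp: uniform_limit_iff elim!: eventually_mono)
  then show "uniform_limit UNIV (\<lambda>n y. q n y * s n (- y + x)) (\<lambda>y. f y * g (- y + x)) sequentially"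
    using C D by (intro uniform_lim_mult assms) (auto intro!: boundedI)
qed (intro cont_conv_integrand assms)+

lemma tendsto_ip:
  assumes "\<And>n. cont (q n)" "cont f" "cont g" "uniform_limit UNIV q f sequentially"
  shows "(\<lambda>n::nat. ip (q n) g) \<longlonglongrightarrow> ip f g"
  unfolding ip_def
proof (rule tendsto_mean)
  obtain C D where C: "\<And>x. cmod (f x) \<le> C" and D: "\<And>x. cmod (g x) \<le> D"
    using bounded_continuous[OF assms(2)] bounded_continuous[OF assms(3)] by metis
  show "uniform_limit UNIV (\<lambda>n x. q n x * cnj (g x)) (\<lambda>x. f x * cnj (g x)) sequentially"
    using C D by (intro uniform_lim_mult assms uniform_limit_const) (auto intro!: boundedI)
qed (intro cont_mult_cnj assms)+

text \<open>The substitute for completeness of the square integrable functions: the sequence itself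
  may have no continuous limit, but its convolution with a fixed \<open>g\<close> is uniformly
  Cauchy.\<close>

lemma L2_Cauchy_conv_limit:
  assumes g: "cont g" and q: "\<And>n. cont (q n)"
    and Cauchy: "\<And>e. 0 < e \<Longrightarrow> \<exists>N. \<forall>m\<ge>N. \<forall>n\<ge>N. nsq (\<lambda>x. q m x - q n x) < e"
  shows "\<exists>p. cont p \<and> uniform_limit UNIV (\<lambda>n. conv g (q n)) p sequentially"
proof -
  have "uniformly_Cauchy_on UNIV (\<lambda>n. conv g (q n))"
    unfolding uniformly_Cauchy_on_def
  proof (intro allI impI)
    fix e :: real assume e: "e > 0"
    define K where "K = sqrt (nsq g) + 1"
    have K: "0 < K" "sqrt (nsq g) \<le> K" using nsq_nonneg[OF g] by (auto simp: K_def add_nonneg_pos)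
    obtain N where N: "\<And>m n. m \<ge> N \<Longrightarrow> n \<ge> N \<Longrightarrow> nsq (\<lambda>x. q m x - q n x) < (e / K)\<^sup>2"
      using Cauchy[of "(e / K)\<^sup>2"] e K by auto
    show "\<exists>M. \<forall>x\<in>UNIV. \<forall>m\<ge>M. \<forall>n\<ge>M. dist (conv g (q m) x) (conv g (q n) x) < e"
    proof (intro exI ballI allI impI)
      fix x m n assume mn: "m \<ge> N" "n \<ge> N"
      have d: "cont (\<lambda>x. q m x - q n x)" by (intro continuous_on_diff q)
      have "sqrt (nsq (\<lambda>x. q m x - q n x)) < e / K"
        using real_sqrt_less_mono[OF N[OF mn]] e K(1) by simp
      then have "K * sqrt (nsq (\<lambda>x. q m x - q n x)) < e" using K(1) by (simp add: divide_simps mult.commute)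
      moreover have "sqrt (nsq g) * sqrt (nsq (\<lambda>x. q m x - q n x)) \<le> K * sqrt (nsq (\<lambda>x. q m x - q n x))"
        using K(2) nsq_nonneg[OF d] by (intro mult_right_mono) auto
      moreover have "dist (conv g (q m) x) (conv g (q n) x) = cmod (conv g (\<lambda>x. q m x - q n x) x)"
        by (simp add: dist_norm conv_diff_right[OF q q g])
      ultimately show "dist (conv g (q m) x) (conv g (q n) x) < e"
        using norm_conv_le[OF g d, of x] by linarith
    qed
  qed
  then obtain p where p: "uniform_limit UNIV (\<lambda>n. conv g (q n)) p sequentially"
    using Cauchy_uniformly_convergent uniformly_convergent_on_def by blast
  have "cont p"
    by (rule uniform_limit_theorem[OF _ p]) (use g q in auto)
  then show ?thesis using p by blast
qed

text \<open>Convolution by a hermitian \<open>h\<close> is a selfadjoint Hilbert-Schmidt operator,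
  and \<open>b n\<close> represents its power n+1. Suitably normalised even powers converge to the
  projection \<open>p\<close> onto the eigenspaces of largest squared eigenvalue. The factorisation
  \<open>p = conv r h\<close> is recorded because it hands a right factor of \<open>h\<close> on to
  every function \<open>conv f p\<close>.\<close>

theorem convolution_projection:
  assumes h: "cont h" and herm: "star h = h" and nz: "h x0 \<noteq> 0"
  shows "\<exists>p r. cont p \<and> cont r \<and> star p = p \<and> conv p p = p \<and> p = conv r h \<and> p 0 \<noteq> 0"
proof -
  define b where "b n = (conv h ^^ n) h" for n
  have b0: "b 0 = h" and bS: "b (Suc n) = conv h (b n)" for n by (simp_all add: b_def)
  have cb: "cont (b n)" for n by (induction n) (use h in \<open>auto simp: b0 bS\<close>)
  have conv_b: "conv (b j) (b k) = b (j + k + 1)" for j k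
    by (induction j) (simp_all add: b0 bS conv_assoc h cb)
  have star_b: "star (b n) = b n" for n
  proof (induction n)
    case (Suc n)
    then show ?case using conv_b[of n 0] by (simp add: bS b0 star_conv h cb herm)
  qed (simp add: b0 herm)
  have ip_b: "ip (b j) (b k) = b (j + k + 1) 0" for j k
    using conv_0[of "b j" "b k"] by (simp add: star_b conv_b)
  define a where "a n = nsq (b n)" for n
  have a_b: "b (2 * n + 1) 0 = of_real (a n)" for n
    using ip_b[of n n] ip_self[OF cb, of n] by (simp add: a_def mult_2)
  \<comment> \<open>The value at 0 of an even convolution power is a squared norm. Hence
    \<open>0 < a (Suc n)\<close> makes the scalar product of \<open>b n\<close> and
    \<open>b (Suc (Suc n))\<close> nonzero, so the latter function cannot vanish.\<close>
  have a_pos: "0 < a n" for n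
  proof (induction n rule: induct_nat_012)
    case 0
    show ?case using nsq_pos[OF h nz] by (simp add: a_def b0)
  next
    case 1
    have "b 1 0 \<noteq> 0" using a_b[of 0] nsq_pos[OF h nz] by (simp add: a_def b0)
    then show ?case using nsq_pos[OF cb] by (simp add: a_def)
  next
    case (ge2 n)
    have "b (2 * n + 3) 0 = of_real (a (Suc n))" using a_b[of "Suc n"] by (simp add: numeral_3_eq_3)
    then have "ip (b n) (b (Suc (Suc n))) \<noteq> 0" using ge2(2) ip_b[of n "Suc (Suc n)"]
      by (simp add: numeral_3_eq_3 mult_2)
    then have "nsq (b (Suc (Suc n))) \<noteq> 0"
      using nsq_eq_0[OF cb, of "Suc (Suc n)"] by (auto simp: ip_def)
    then show ?case using nsq_nonneg[OF cb, of "Suc (Suc n)"] by (simp add: a_def)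
  qed
  have convex: "(a (Suc n))\<^sup>2 \<le> a n * a (Suc (Suc n))" for n
  proof -
    have "of_real (a (Suc n)) = ip (b n) (b (Suc (Suc n)))"
      using a_b[of "Suc n"] ip_b[of n "Suc (Suc n)"] by (simp add: mult_2)
    then have "cmod (of_real (a (Suc n))) \<le> sqrt (a n) * sqrt (a (Suc (Suc n)))"
      using Cauchy_Schwarz[OF cb cb] by (simp add: a_def)
    then have "a (Suc n) \<le> sqrt (a n * a (Suc (Suc n)))" using a_pos[of "Suc n"] by (simp add: real_sqrt_mult)
    then have "(a (Suc n))\<^sup>2 \<le> (sqrt (a n * a (Suc (Suc n))))\<^sup>2"
      using a_pos[of "Suc n"] by (intro power_mono) auto
    then show ?thesis using a_pos[of n] a_pos[of "Suc (Suc n)"] by simp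
  qed
  \<comment> \<open>The estimate of a convolution is pointwise: \<open>b (2 * n + 1)\<close> is the
    convolution square of \<open>b n\<close>, so its supremum is at most \<open>a n\<close>, and
    \<open>a (j + k + 1)\<close> is the scalar product of two such squares.\<close>
  have submult: "a (j + k + 1) \<le> a j * a k" for j k
  proof -
    have le: "cmod (b (2 * n + 1) x) \<le> a n" for n x
      using norm_conv_le[OF cb cb, of n n x] nsq_nonneg[OF cb, of n] conv_b[of n n]
      by (simp add: a_def mult_2)
    have "of_real (a (j + k + 1)) = ip (b (2 * j + 1)) (b (2 * k + 1))"
      using a_b[of "j + k + 1"] ip_b[of "2 * j + 1" "2 * k + 1"] by (simp add: algebra_simps)
    moreover have "cmod (ip (b (2 * j + 1)) (b (2 * k + 1))) \<le> a j * a k"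
      unfolding ip_def using le[of j] le[of k] a_pos[of j]
      by (intro norm_mean_bound cont_mult_cnj cb) (auto simp: norm_mult intro!: mult_mono)
    ultimately show ?thesis using a_pos[of "j + k + 1"]
      by (metis abs_of_pos norm_of_real)
  qed
  obtain l c where l: "0 < l" "1 \<le> c" "(\<lambda>n. a n / l ^ Suc n) \<longlonglongrightarrow> c"
    using logconvex_submultiplicative_limit[OF a_pos convex submult] by blast
  define d where "d n = a n / l ^ Suc n" for n
  have d: "d \<longlonglongrightarrow> c" using l(3) unfolding d_def .
  define \<kappa> where "\<kappa> n = complex_of_real (1 / l ^ Suc n)" for n
  have \<kappa>: "cnj (\<kappa> n) = \<kappa> n" "of_real l * \<kappa> (Suc n) = \<kappa> n" "\<kappa> m * \<kappa> n = \<kappa> (m + n + 1)"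
    "\<kappa> n * of_real (a n) = of_real (d n)" for m n
    using l(1) by (simp_all add: \<kappa>_def d_def power_add)
  \<comment> \<open>Only even convolution powers of \<open>h\<close> are used, here the power 2n+2
    divided by \<open>l ^ Suc n\<close>: both square roots of \<open>l\<close> may occur as
    eigenvalues, and odd powers would then keep alternating in sign on the negative one.\<close>
  define q where "q n = (\<lambda>x. \<kappa> n * b (2 * n + 1) x)" for n
  have cq: "cont (q n)" for n unfolding q_def by (intro continuous_intros cb)
  have ip_q: "ip (q m) (q n) = of_real (d (m + n + 1))" for m n
  proof -
    have "ip (q m) (q n) = \<kappa> m * (cnj (\<kappa> n) * ip (b (2 * m + 1)) (b (2 * n + 1)))"
      using ip_mult_left[OF cb cq, of "\<kappa> m" "2 * m + 1" n] ip_mult_right[OF cb cb]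
      by (simp add: q_def)
    also have "ip (b (2 * m + 1)) (b (2 * n + 1)) = of_real (a (m + n + 1))"
      using a_b[of "m + n + 1"] ip_b[of "2 * m + 1" "2 * n + 1"] by (simp add: algebra_simps)
    finally show ?thesis by (simp only: \<kappa> mult.assoc[symmetric])
  qed
  have nsq_q: "nsq (\<lambda>x. q m x - q n x) = d (2 * m + 1) - 2 * d (m + n + 1) + d (2 * n + 1)" for m n
  proof -
    have "nsq (q n) = d (2 * n + 1)" for n
      using ip_self[OF cq, of n] ip_q[of n n] by (simp add: mult_2)
    then show ?thesis using nsq_diff[OF cq cq, of m n] ip_q[of m n] by simp
  qed
  have "\<exists>N. \<forall>m\<ge>N. \<forall>n\<ge>N. nsq (\<lambda>x. q m x - q n x) < e" if e: "0 < e" for e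
  proof -
    obtain N where N: "\<And>n. n \<ge> N \<Longrightarrow> \<bar>d n - c\<bar> < e / 4"
      using LIMSEQ_D[OF d, of "e/4"] e by auto
    have "nsq (\<lambda>x. q m x - q n x) < e" if "m \<ge> N" "n \<ge> N" for m n
      using N[of "2 * m + 1"] N[of "2 * n + 1"] N[of "m + n + 1"] that
      unfolding nsq_q by linarith
    then show ?thesis by blast
  qed
  \<comment> \<open>Convolution with \<open>b 1\<close> amounts to a shift of the sequence and a
    factor \<open>l\<close>, so the regularised limit is, up to that factor, the uniform limit of
    \<open>q\<close> itself.\<close>
  from L2_Cauchy_conv_limit[OF cb cq this, of 1] obtain p0 where
    p0: "cont p0" "uniform_limit UNIV (\<lambda>n. conv (b 1) (q n)) p0 sequentially" by blast
  have conv_q: "conv (b 1) (q n) = (\<lambda>x. of_real l * q (Suc n) x)"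
      "conv (q n) (b 1) = (\<lambda>x. of_real l * q (Suc n) x)"
      "conv (q n) (q n) = q (2 * n + 1)" for n
  proof -
    have e: "1 + (2 * n + 1) + 1 = 2 * Suc n + 1" "2 * n + 1 + 1 + 1 = 2 * Suc n + 1"
      "2 * n + 1 + (2 * n + 1) + 1 = 2 * (2 * n + 1) + 1" by simp_all
    show "conv (b 1) (q n) = (\<lambda>x. of_real l * q (Suc n) x)"
      unfolding q_def conv_mult_right[OF cb cb] conv_b e(1) by (simp only: mult.assoc[symmetric] \<kappa>(2))
    show "conv (q n) (b 1) = (\<lambda>x. of_real l * q (Suc n) x)"
      unfolding q_def conv_mult_left[OF cb cb] conv_b e(2) by (simp only: mult.assoc[symmetric] \<kappa>(2))
    have "conv (q n) (q n) = (\<lambda>x. \<kappa> n * conv (q n) (b (2 * n + 1)) x)"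
      using conv_mult_right[OF cq cb, of n "\<kappa> n" "2 * n + 1"] by (simp only: q_def)
    also have "conv (q n) (b (2 * n + 1)) = (\<lambda>x. \<kappa> n * b (2 * (2 * n + 1) + 1) x)"
      unfolding q_def conv_mult_left[OF cb cb] conv_b e(3) ..
    finally show "conv (q n) (q n) = q (2 * n + 1)"
      by (simp only: q_def mult.assoc[symmetric] \<kappa>(3)) (simp only: mult_2)
  qed
  define p where "p x = p0 x / of_real l" for x
  have cp: "cont p" unfolding p_def using l(1) by (intro continuous_intros p0) auto
  have "uniform_limit UNIV (\<lambda>n x. of_real (1 / l) * (of_real l * q (Suc n) x)) (\<lambda>x. of_real (1 / l) * p0 x) sequentially"
    by (rule bounded_linear.uniform_limit[OF bounded_linear_mult_right p0(2)[unfolded conv_q]])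
  moreover have "(\<lambda>n x. of_real (1 / l) * (of_real l * q (Suc n) x)) = (\<lambda>n. q (Suc n))"
    "(\<lambda>x. of_real (1 / l) * p0 x) = p"
    using l(1) by (auto simp: p_def fun_eq_iff)
  ultimately have lim_Suc: "uniform_limit UNIV (\<lambda>n. q (Suc n)) p sequentially" by simp
  then have lim: "uniform_limit UNIV q p sequentially"
    using filterlim_sequentially_Suc[of q] by simp
  have pt: "(\<lambda>n. q n x) \<longlonglongrightarrow> p x" for x
    by (rule tendsto_uniform_limitI[OF lim]) simp
  have "star p = p"
  proof
    fix x
    have "cnj (q n (- x)) = q n x" for n
      using fun_cong[OF star_b[of "2 * n + 1"], of x] by (simp add: q_def star_def \<kappa>(1))
    then have "(\<lambda>n. q n x) \<longlonglongrightarrow> star p x"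
      using tendsto_cnj[OF pt[of "- x"]] by (simp add: star_def)
    then show "star p x = p x" using LIMSEQ_unique pt by blast
  qed
  moreover have "conv p p = p"
  proof
    fix x
    have "(\<lambda>n. q (2 * n + 1) x) \<longlonglongrightarrow> conv p p x"
      using tendsto_conv[OF cq cq cp cp lim lim, of x] by (simp only: conv_q)
    moreover have "(\<lambda>n. q (2 * n + 1) x) \<longlonglongrightarrow> p x"
      using LIMSEQ_subseq_LIMSEQ[OF pt[of x], of "\<lambda>n. 2 * n + 1"] by (auto simp: strict_mono_def o_def)
    ultimately show "conv p p x = p x" using LIMSEQ_unique by blast
  qed
  moreover have "conv p (b 1) = (\<lambda>x. of_real l * p x)"
  proof
    fix x
    have "(\<lambda>n. of_real l * q (Suc n) x) \<longlonglongrightarrow> conv p (b 1) x"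
      using tendsto_conv[OF cq cb cp cb lim uniform_limit_const, of 1 x] by (simp only: conv_q)
    moreover have "(\<lambda>n. of_real l * q (Suc n) x) \<longlonglongrightarrow> of_real l * p x"
      by (intro tendsto_mult_left LIMSEQ_Suc pt)
    ultimately show "conv p (b 1) x = of_real l * p x" using LIMSEQ_unique by blast
  qed
  then have "p = (\<lambda>x. of_real (1 / l) * conv (conv p h) h x)"
    using l(1) by (simp add: fun_eq_iff bS b0 conv_assoc[OF cp h h])
  then have "p = conv (\<lambda>x. of_real (1 / l) * conv p h x) h"
    by (simp only: conv_mult_left[OF cont_conv[OF cp h] h])
  moreover have "cont (\<lambda>x. of_real (1 / l) * conv p h x)" by (intro continuous_intros cont_conv cp h)
  \<comment> \<open>The value at 0 is the trace of the projection. It equals \<open>c\<close>, and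
    the lower bound for \<open>c\<close> excludes the zero projection.\<close>
  moreover have "p 0 \<noteq> 0"
  proof -
    have "q n 0 = of_real (d n)" for n by (simp only: q_def a_b \<kappa>(4))
    then have "(\<lambda>n. q n 0) \<longlonglongrightarrow> of_real c" using tendsto_of_real[OF d] by simp
    then have "p 0 = of_real c" using LIMSEQ_unique pt by blast
    then show ?thesis using l(2) by simp
  qed
  ultimately show ?thesis using cp by blast
qed

end


section \<open>Unitary representations and Schur's lemma\<close>

lemma mat_adjoint_index:
  "i < dim_col A \<Longrightarrow> j < dim_row A \<Longrightarrow> mat_adjoint A $$ (i, j) = conjugate (A $$ (j, i))"
  unfolding mat_adjoint_def by (simp add: mat_of_rows_def)

lemma mat_adjoint_dim [simp]:
  "dim_row (mat_adjoint A) = dim_col A" "dim_col (mat_adjoint A) = dim_row A"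
  by (simp_all add: mat_adjoint_def)

lemma mat_adjoint_carrier [simp]: "A \<in> carrier_mat n m \<Longrightarrow> mat_adjoint A \<in> carrier_mat m n"
  by (intro carrier_matI) simp_all

lemma times_mat_index:
  "A \<in> carrier_mat n m \<Longrightarrow> B \<in> carrier_mat m l \<Longrightarrow> i < n \<Longrightarrow> j < l \<Longrightarrow>
    (A * B) $$ (i, j) = (\<Sum>k<m. A $$ (i, k) * B $$ (k, j))"
  by (auto simp: scalar_prod_def lessThan_atLeast0 intro!: sum.cong)

lemma mult_mat_vec_index:
  "A \<in> carrier_mat n m \<Longrightarrow> v \<in> carrier_vec m \<Longrightarrow> i < n \<Longrightarrow>
    (A *\<^sub>v v) $ i = (\<Sum>k<m. A $$ (i, k) * v $ k)"
  by (auto simp: scalar_prod_def lessThan_atLeast0 intro!: sum.cong)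

lemma unitary_repI:
  assumes "\<And>g. \<pi> g \<in> carrier_mat n n"
    and "\<And>g i j. i < n \<Longrightarrow> j < n \<Longrightarrow>
      (\<Sum>k<n. cnj (\<pi> g $$ (k, i)) * \<pi> g $$ (k, j)) = (if i = j then 1 else 0)"
    and "\<And>g h i j. i < n \<Longrightarrow> j < n \<Longrightarrow> \<pi> (g + h) $$ (i, j) = (\<Sum>k<n. \<pi> g $$ (i, k) * \<pi> h $$ (k, j))"
    and "\<And>i j. i < n \<Longrightarrow> j < n \<Longrightarrow> continuous_on UNIV (\<lambda>g. \<pi> g $$ (i, j))"
  shows "unitary_rep n \<pi>"
  unfolding unitary_rep_def
proof (intro conjI allI impI)
  fix g h
  note c = assms(1)
  show "\<pi> g \<in> carrier_mat n n" by (rule c)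
  show "mat_adjoint (\<pi> g) * \<pi> g = 1\<^sub>m n"
  proof (rule eq_matI)
    fix i j assume "i < dim_row (1\<^sub>m n :: complex mat)" "j < dim_col (1\<^sub>m n :: complex mat)"
    then have ij: "i < n" "j < n" by auto
    have "(mat_adjoint (\<pi> g) * \<pi> g) $$ (i, j) = (\<Sum>k<n. cnj (\<pi> g $$ (k, i)) * \<pi> g $$ (k, j))"
      unfolding times_mat_index[OF mat_adjoint_carrier[OF c] c ij]
      using ij carrier_matD[OF c[of g]] by (intro sum.cong) (simp_all add: mat_adjoint_index)
    then show "(mat_adjoint (\<pi> g) * \<pi> g) $$ (i, j) = 1\<^sub>m n $$ (i, j)"
      using assms(2)[OF ij] ij by simp
  qed (use carrier_matD[OF c[of g]] in auto)
  show "\<pi> (g + h) = \<pi> g * \<pi> h"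
    by (intro eq_matI) (simp_all add: times_mat_index[OF c c] assms(3) carrier_matD[OF c] del: index_mult_mat(1))
qed (use assms(4) in auto)

lemma module_vec_subspaceD:
  assumes "VectorSpace.subspace class_ring W (module_vec TYPE(complex) n)"
  shows "W \<subseteq> carrier_vec n" "0\<^sub>v n \<in> W" "\<And>v w. v \<in> W \<Longrightarrow> w \<in> W \<Longrightarrow> v + w \<in> W"
    "\<And>c v. v \<in> W \<Longrightarrow> c \<cdot>\<^sub>v v \<in> W"
  using assms
  by (auto simp: VectorSpace.subspace_def submodule_def module_vec_simps class_ring_simps)

lemma module_vec_subspaceI:
  assumes "W \<subseteq> carrier_vec n" "0\<^sub>v n \<in> W" "\<And>v w. v \<in> W \<Longrightarrow> w \<in> W \<Longrightarrow> v + w \<in> W"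
    "\<And>c v. v \<in> W \<Longrightarrow> c \<cdot>\<^sub>v v \<in> W"
  shows "VectorSpace.subspace class_ring W (module_vec TYPE(complex) n)"
proof -
  have "vectorspace class_ring (module_vec TYPE(complex) n)" by (rule vec_vs)
  moreover from this have "Module.module class_ring (module_vec TYPE(complex) n)"
    by (simp add: vectorspace_def)
  ultimately show ?thesis
    using assms by (auto simp: VectorSpace.subspace_def submodule_def module_vec_simps class_ring_simps)
qed

lemma unitary_repD:
  assumes "unitary_rep n \<pi>"
  shows "\<pi> g \<in> carrier_mat n n" "mat_adjoint (\<pi> g) * \<pi> g = 1\<^sub>m n" "\<pi> (g + h) = \<pi> g * \<pi> h"
  using assms by (auto simp: unitary_rep_def)

lemma irreducible_unitary_repD:
  assumes "irreducible_unitary_rep n \<pi>"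
  shows "0 < n" "unitary_rep n \<pi>"
    "VectorSpace.subspace class_ring W (module_vec TYPE(complex) n) \<Longrightarrow>
      (\<And>g v. v \<in> W \<Longrightarrow> \<pi> g *\<^sub>v v \<in> W) \<Longrightarrow> W \<noteq> {0\<^sub>v n} \<Longrightarrow> W = carrier_vec n"
  using assms by (auto simp: irreducible_unitary_rep_def)

lemma unitary_rep_zero:
  assumes "unitary_rep n \<pi>"
  shows "\<pi> 0 = 1\<^sub>m n"
proof -
  note r = unitary_repD[OF assms]
  have "\<pi> 0 = mat_adjoint (\<pi> 0) * \<pi> 0 * \<pi> 0" using r(2)[of 0] left_mult_one_mat[OF r(1)[of 0]] by simp
  also have "\<dots> = mat_adjoint (\<pi> 0) * \<pi> (0 + 0)"
    unfolding r(3) by (rule assoc_mult_mat[OF mat_adjoint_carrier[OF r(1)] r(1) r(1)])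
  finally show ?thesis using r(2)[of 0] by simp
qed

lemma unitary_rep_uminus:
  assumes "unitary_rep n \<pi>"
  shows "\<pi> (- g) = mat_adjoint (\<pi> g)"
proof -
  note r = unitary_repD[OF assms]
  have "mat_adjoint (\<pi> g) = mat_adjoint (\<pi> g) * (\<pi> g * \<pi> (- g))"
    using right_mult_one_mat[OF mat_adjoint_carrier[OF r(1)]] r(3)[of g "- g"] unitary_rep_zero[OF assms] by simp
  also have "\<dots> = mat_adjoint (\<pi> g) * \<pi> g * \<pi> (- g)"
    by (rule assoc_mult_mat[OF mat_adjoint_carrier[OF r(1)] r(1) r(1), symmetric])
  also have "\<dots> = \<pi> (- g)" using r(2)[of g] left_mult_one_mat[OF r(1)] by simp
  finally show ?thesis by simp
qed

lemma unitary_rep_adjoint_right: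
  assumes "unitary_rep n \<pi>"
  shows "\<pi> g * mat_adjoint (\<pi> g) = 1\<^sub>m n"
  using unitary_repD(3)[OF assms, of g "- g"] unitary_rep_zero[OF assms] unitary_rep_uminus[OF assms, of g] by simp

section \<open>Intertwining matrices\<close>

lemma mat_adjoint_adjoint: "mat_adjoint (mat_adjoint A) = (A :: complex mat)"
  by (intro eq_matI) (simp_all add: mat_adjoint_index)

lemma mat_adjoint_mult:
  fixes A B :: "complex mat"
  assumes A: "A \<in> carrier_mat n m" and B: "B \<in> carrier_mat m l"
  shows "mat_adjoint (A * B) = mat_adjoint B * mat_adjoint A"
proof (rule eq_matI)
  fix i j assume "i < dim_row (mat_adjoint B * mat_adjoint A)" "j < dim_col (mat_adjoint B * mat_adjoint A)"
  then have ij: "i < l" "j < n" using A B by auto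
  have "mat_adjoint (A * B) $$ (i, j) = cnj ((A * B) $$ (j, i))"
    using ij A B mat_adjoint_index[of i "A * B" j] by simp
  also have "\<dots> = (\<Sum>k<m. mat_adjoint B $$ (i, k) * mat_adjoint A $$ (k, j))"
    unfolding times_mat_index[OF A B ij(2,1)] cnj_sum
    using ij carrier_matD[OF A] carrier_matD[OF B]
    by (intro sum.cong) (simp_all add: mat_adjoint_index mult.commute)
  also have "\<dots> = (mat_adjoint B * mat_adjoint A) $$ (i, j)"
    by (rule times_mat_index[OF mat_adjoint_carrier[OF B] mat_adjoint_carrier[OF A] ij, symmetric])
  finally show "mat_adjoint (A * B) $$ (i, j) = (mat_adjoint B * mat_adjoint A) $$ (i, j)" .
qed (use A B in auto)

text \<open>A complex matrix of positive size has an eigenvalue; the eigenspace of \<open>T\<close>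
  is invariant under \<pi> and nonzero, hence everything.\<close>

lemma Schur_scalar:
  assumes irr: "irreducible_unitary_rep n \<pi>" and T: "T \<in> carrier_mat n n"
    and comm: "\<And>g. T * \<pi> g = \<pi> g * T"
  obtains c where "T = c \<cdot>\<^sub>m 1\<^sub>m n"
proof -
  note I = irreducible_unitary_repD[OF irr]
  note c = unitary_repD(1)[OF I(2)]
  obtain c v where v: "v \<in> carrier_vec n" "v \<noteq> 0\<^sub>v n" "T *\<^sub>v v = c \<cdot>\<^sub>v v"
    using spectrum_non_empty[OF T I(1)] T by (auto simp: spectrum_def eigenvalue_def eigenvector_def)
  define W where "W = {w \<in> carrier_vec n. T *\<^sub>v w = c \<cdot>\<^sub>v w}"
  have "W = carrier_vec n"
  proof (rule I(3))
    show "VectorSpace.subspace class_ring W (module_vec TYPE(complex) n)"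
    proof (rule module_vec_subspaceI)
      show "x + w \<in> W" if "x \<in> W" "w \<in> W" for x w
        using that by (auto simp: W_def mult_add_distrib_mat_vec[OF T] smult_add_distrib_vec[where n=n])
      show "d \<cdot>\<^sub>v w \<in> W" if "w \<in> W" for d w
        using that mult_mat_vec[OF T] by (auto simp: W_def smult_smult_assoc mult.commute)
    qed (use T in \<open>auto simp: W_def\<close>)
    show "\<pi> g *\<^sub>v w \<in> W" if "w \<in> W" for g w
    proof -
      have w: "w \<in> carrier_vec n" "T *\<^sub>v w = c \<cdot>\<^sub>v w" using that by (auto simp: W_def)
      have "T *\<^sub>v (\<pi> g *\<^sub>v w) = \<pi> g *\<^sub>v (T *\<^sub>v w)"
        unfolding assoc_mult_mat_vec[OF T c w(1), symmetric] assoc_mult_mat_vec[OF c T w(1), symmetric] comm ..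
      then show ?thesis using w mult_mat_vec[OF c[of g] w(1)] mult_mat_vec_carrier[OF c[of g] w(1)]
        by (auto simp: W_def)
    qed
    show "W \<noteq> {0\<^sub>v n}" using v by (auto simp: W_def)
  qed
  then have all: "T *\<^sub>v w = c \<cdot>\<^sub>v w" if "w \<in> carrier_vec n" for w using that by (auto simp: W_def)
  have "T = c \<cdot>\<^sub>m 1\<^sub>m n"
  proof (rule eq_matI)
    fix i j assume "i < dim_row (c \<cdot>\<^sub>m 1\<^sub>m n)" "j < dim_col (c \<cdot>\<^sub>m 1\<^sub>m n)"
    then have ij: "i < n" "j < n" by auto
    have "(T *\<^sub>v unit_vec n j) $ i = (\<Sum>k<n. if k = j then T $$ (i, k) else 0)"
      unfolding mult_mat_vec_index[OF T unit_vec_carrier ij(1)]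
      by (intro sum.cong) (use ij in auto)
    then have "(T *\<^sub>v unit_vec n j) $ i = T $$ (i, j)" using ij by simp
    then show "T $$ (i, j) = (c \<cdot>\<^sub>m 1\<^sub>m n) $$ (i, j)" using all[of "unit_vec n j"] ij by simp
  qed (use T in auto)
  then show ?thesis by (rule that)
qed

text \<open>With \<open>S'\<close> the adjoint of \<open>S\<close>, both \<open>S' * S\<close> and
  \<open>S * S'\<close> are scalar. Associativity and a nonzero entry make the two scalars equal,
  and comparing traces makes the dimensions equal, so a positive multiple of \<open>S\<close> is
  unitary. An argument by kernel and range would give only an invertible intertwiner, whereas the
  equivalence relation asks for a unitary one.\<close>

lemma Schur_inequivalent:
  assumes irr: "irreducible_unitary_rep n \<pi>" and irr': "irreducible_unitary_rep n' \<pi>'"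
    and S: "S \<in> carrier_mat n' n" and comm: "\<And>g. S * \<pi> g = \<pi>' g * S"
    and ineq: "(\<pi>, \<pi>') \<notin> unitary_equivalence"
  shows "S = 0\<^sub>m n' n"
proof (rule ccontr)
  assume "S \<noteq> 0\<^sub>m n' n"
  then obtain a b where ab: "a < n'" "b < n" "S $$ (a, b) \<noteq> 0"
    using S by (metis carrier_matD eq_matI index_zero_mat)
  note r = unitary_repD[OF irreducible_unitary_repD(2)[OF irr]]
  note r' = unitary_repD[OF irreducible_unitary_repD(2)[OF irr']]
  define S' where "S' = mat_adjoint S"
  have S': "S' \<in> carrier_mat n n'" using S by (simp add: S'_def)
  have comm': "S' * \<pi>' g = \<pi> g * S'" for g
  proof -
    have "mat_adjoint (S * mat_adjoint (\<pi> g)) = mat_adjoint (mat_adjoint (\<pi>' g) * S)"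
      using comm[of "- g"] unitary_rep_uminus[OF irreducible_unitary_repD(2)[OF irr]]
        unitary_rep_uminus[OF irreducible_unitary_repD(2)[OF irr']] by simp
    then show ?thesis
      unfolding mat_adjoint_mult[OF S mat_adjoint_carrier[OF r(1)]]
        mat_adjoint_mult[OF mat_adjoint_carrier[OF r'(1)] S] S'_def mat_adjoint_adjoint by simp
  qed
  have "S' * S * \<pi> g = \<pi> g * (S' * S)" for g
    unfolding assoc_mult_mat[OF S' S r(1)] comm
    unfolding assoc_mult_mat[OF S' r'(1) S, symmetric] comm'
    by (rule assoc_mult_mat[OF r(1) S' S])
  then obtain \<mu> where \<mu>: "S' * S = \<mu> \<cdot>\<^sub>m 1\<^sub>m n"
    using Schur_scalar[OF irr mult_carrier_mat[OF S' S]] by blast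
  have "S * S' * \<pi>' g = \<pi>' g * (S * S')" for g
    unfolding assoc_mult_mat[OF S S' r'(1)] comm'
    unfolding assoc_mult_mat[OF S r(1) S', symmetric] comm
    by (rule assoc_mult_mat[OF r'(1) S S'])
  then obtain \<nu> where \<nu>: "S * S' = \<nu> \<cdot>\<^sub>m 1\<^sub>m n'"
    using Schur_scalar[OF irr' mult_carrier_mat[OF S S']] by blast
  have entry: "S' $$ (i, j) = cnj (S $$ (j, i))" if "i < n" "j < n'" for i j
    using that S mat_adjoint_index[of i S j] by (simp add: S'_def)
  have "S * (S' * S) = S * S' * S" by (rule assoc_mult_mat[OF S S' S, symmetric])
  then have "\<mu> \<cdot>\<^sub>m S = \<nu> \<cdot>\<^sub>m S"
    unfolding \<mu> \<nu> mult_smult_distrib[OF S one_carrier_mat] mult_smult_assoc_mat[OF one_carrier_mat S]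
      right_mult_one_mat[OF S] left_mult_one_mat[OF S] .
  then have "(\<mu> \<cdot>\<^sub>m S) $$ (a, b) = (\<nu> \<cdot>\<^sub>m S) $$ (a, b)" by simp
  then have \<mu>\<nu>: "\<mu> = \<nu>" using ab S by simp
  have diag: "(\<Sum>k<n'. of_real ((cmod (S $$ (k, i)))\<^sup>2)) = \<mu>" if "i < n" for i
  proof -
    have "\<mu> = (S' * S) $$ (i, i)" using \<mu> that by simp
    also have "\<dots> = (\<Sum>k<n'. of_real ((cmod (S $$ (k, i)))\<^sup>2))"
      unfolding times_mat_index[OF S' S that that]
      by (intro sum.cong) (use that in \<open>simp_all add: entry complex_norm_square mult.commute del: of_real_power\<close>)
    finally show ?thesis by simp
  qed
  have diag': "(\<Sum>i<n. of_real ((cmod (S $$ (k, i)))\<^sup>2)) = \<nu>" if "k < n'" for k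
  proof -
    have "\<nu> = (S * S') $$ (k, k)" using \<nu> that by simp
    also have "\<dots> = (\<Sum>i<n. of_real ((cmod (S $$ (k, i)))\<^sup>2))"
      unfolding times_mat_index[OF S S' that that]
      by (intro sum.cong) (use that in \<open>simp_all add: entry complex_norm_square del: of_real_power\<close>)
    finally show ?thesis by simp
  qed
  define m where "m = (\<Sum>k<n'. (cmod (S $$ (k, b)))\<^sup>2)"
  have \<mu>m: "\<mu> = of_real m" using diag[OF ab(2)] by (simp add: m_def)
  have "(cmod (S $$ (a, b)))\<^sup>2 \<le> m" unfolding m_def by (rule member_le_sum) (use ab in auto)
  moreover have "0 < (cmod (S $$ (a, b)))\<^sup>2" using ab(3) by simp
  ultimately have m: "0 < m" by linarith
  \<comment> \<open>Both traces are the sum of the squared moduli of all entries of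
    \<open>S\<close>.\<close>
  have "of_nat n * \<mu> = (\<Sum>i<n. \<Sum>k<n'. of_real ((cmod (S $$ (k, i)))\<^sup>2))" using diag by simp
  also have "\<dots> = (\<Sum>k<n'. \<Sum>i<n. of_real ((cmod (S $$ (k, i)))\<^sup>2))" by (rule sum.swap)
  also have "\<dots> = of_nat n' * \<nu>" using diag' by simp
  finally have "of_nat n * \<mu> = of_nat n' * \<mu>" by (simp add: \<mu>\<nu>)
  then have nn: "n' = n" using m by (simp add: \<mu>m)
  define s where "s = complex_of_real (1 / sqrt m)"
  define U where "U = s \<cdot>\<^sub>m S"
  have U: "U \<in> carrier_mat n n" using S nn by (simp add: U_def)
  have adjU: "mat_adjoint U = s \<cdot>\<^sub>m S'"
    using S by (intro eq_matI) (auto simp: U_def S'_def mat_adjoint_index s_def)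
  have "s * (s * \<mu>) = 1"
    using m by (simp add: s_def \<mu>m flip: of_real_mult)
  moreover have "mat_adjoint U * U = s \<cdot>\<^sub>m (s \<cdot>\<^sub>m (S' * S))"
    unfolding adjU unfolding U_def mult_smult_assoc_mat[OF S' smult_carrier_mat[OF S]] mult_smult_distrib[OF S' S] ..
  ultimately have "mat_adjoint U * U = 1\<^sub>m n"
    unfolding \<mu> by (intro eq_matI) auto
  moreover have "U * \<pi> g = \<pi>' g * U" for g
    unfolding U_def using mult_smult_assoc_mat[OF S r(1)] mult_smult_distrib[OF r'(1) S] comm by simp
  ultimately have "(\<pi>, \<pi>') \<in> unitary_equivalence"
    unfolding unitary_equivalence_def using irr irr' U nn by blast
  then show False using ineq by blast
qed

section \<open>Unitary equivalence and the dual\<close>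

lemma equiv_unitary_equivalence:
  "equiv {\<pi>. \<exists>n. irreducible_unitary_rep n \<pi>} unitary_equivalence" (is "equiv ?X ?r")
proof (rule equivI)
  show "?r \<subseteq> ?X \<times> ?X"
    by (auto simp: unitary_equivalence_def)
  show "refl_on ?X ?r"
  proof (rule refl_onI)
    fix \<pi> assume "\<pi> \<in> ?X"
    then obtain n where irr: "irreducible_unitary_rep n \<pi>" by blast
    have "mat_adjoint (1\<^sub>m n) * 1\<^sub>m n = (1\<^sub>m n :: complex mat)"
      by (intro eq_matI) (auto simp: mat_adjoint_index)
    moreover have "1\<^sub>m n * \<pi> g = \<pi> g * 1\<^sub>m n" for g
      using unitary_repD(1)[OF irreducible_unitary_repD(2)[OF irr], of g]
      by (simp only: left_mult_one_mat right_mult_one_mat)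
    ultimately show "(\<pi>, \<pi>) \<in> ?r"
      unfolding unitary_equivalence_def using irr one_carrier_mat by blast
  qed
  show "sym ?r"
  proof (rule symI)
    fix \<pi> \<pi>' assume "(\<pi>, \<pi>') \<in> ?r"
    then obtain n U where irr: "irreducible_unitary_rep n \<pi>" "irreducible_unitary_rep n \<pi>'"
      and U: "U \<in> carrier_mat n n" "mat_adjoint U * U = 1\<^sub>m n" "\<And>g. U * \<pi> g = \<pi>' g * U"
      by (auto simp: unitary_equivalence_def)
    have UU: "U * mat_adjoint U = 1\<^sub>m n"
      by (rule mat_mult_left_right_inverse[OF mat_adjoint_carrier[OF U(1)] U(1) U(2)])
    note A = mat_adjoint_carrier[OF U(1)]
    have "mat_adjoint U * \<pi>' g = \<pi> g * mat_adjoint U" for g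
    proof -
      note c = unitary_repD(1)[OF irreducible_unitary_repD(2)[OF irr(1)], of g]
        unitary_repD(1)[OF irreducible_unitary_repD(2)[OF irr(2)], of g]
      have "mat_adjoint U * \<pi>' g = mat_adjoint U * (\<pi>' g * (U * mat_adjoint U))" using UU c(2) by simp
      also have "\<dots> = mat_adjoint U * (U * \<pi> g * mat_adjoint U)"
        unfolding U(3) by (simp only: assoc_mult_mat[OF c(2) U(1) A])
      also have "\<dots> = mat_adjoint U * U * (\<pi> g * mat_adjoint U)"
        using assoc_mult_mat[OF U(1) c(1) A] assoc_mult_mat[OF A U(1) mult_carrier_mat[OF c(1) A]] by simp
      also have "\<dots> = \<pi> g * mat_adjoint U" unfolding U(2) by (rule left_mult_one_mat[OF mult_carrier_mat[OF c(1) A]])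
      finally show ?thesis .
    qed
    then show "(\<pi>', \<pi>) \<in> ?r"
      unfolding unitary_equivalence_def using irr A UU
      by (auto intro!: exI[of _ n] bexI[of _ "mat_adjoint U"] simp: mat_adjoint_adjoint)
  qed
  show "trans ?r"
  proof (rule transI)
    fix \<pi> \<pi>' \<pi>''
    assume "(\<pi>, \<pi>') \<in> ?r" "(\<pi>', \<pi>'') \<in> ?r"
    then obtain n U n' V where irr: "irreducible_unitary_rep n \<pi>" "irreducible_unitary_rep n \<pi>'"
      "irreducible_unitary_rep n' \<pi>'" "irreducible_unitary_rep n' \<pi>''"
      and U: "U \<in> carrier_mat n n" "mat_adjoint U * U = 1\<^sub>m n" "\<And>g. U * \<pi> g = \<pi>' g * U"
      and V: "V \<in> carrier_mat n' n'" "mat_adjoint V * V = 1\<^sub>m n'" "\<And>g. V * \<pi>' g = \<pi>'' g * V"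
      unfolding unitary_equivalence_def by blast
    note c = unitary_repD(1)[OF irreducible_unitary_repD(2)]
    have nn: "n' = n" using c[OF irr(2), of 0] c[OF irr(3), of 0] by auto
    note V = V[unfolded nn]
    have VU: "V * U \<in> carrier_mat n n" by (rule mult_carrier_mat[OF V(1) U(1)])
    have "mat_adjoint (V * U) * (V * U) = mat_adjoint U * (mat_adjoint V * (V * U))"
      unfolding mat_adjoint_mult[OF V(1) U(1)]
      by (rule assoc_mult_mat[OF mat_adjoint_carrier[OF U(1)] mat_adjoint_carrier[OF V(1)] VU])
    also have "mat_adjoint V * (V * U) = mat_adjoint V * V * U"
      by (rule assoc_mult_mat[OF mat_adjoint_carrier[OF V(1)] V(1) U(1), symmetric])
    finally have "mat_adjoint (V * U) * (V * U) = 1\<^sub>m n"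
      by (simp only: V(2) left_mult_one_mat[OF U(1)] U(2))
    moreover have "V * U * \<pi> g = \<pi>'' g * (V * U)" for g
      unfolding assoc_mult_mat[OF V(1) U(1) c[OF irr(1)]] U(3)
      unfolding assoc_mult_mat[OF V(1) c[OF irr(2)] U(1), symmetric] V(3)
      by (rule assoc_mult_mat[OF c[OF irr(4)[unfolded nn]] V(1) U(1)])
    ultimately show "(\<pi>, \<pi>'') \<in> ?r"
      unfolding unitary_equivalence_def using irr nn VU by blast
  qed
qed

lemma unitary_dual_irreducible:
  assumes "D \<in> unitary_dual" "\<pi> \<in> D"
  obtains n where "irreducible_unitary_rep n \<pi>"
  using assms in_quotient_imp_subset[OF equiv_unitary_equivalence, of D] by (auto simp: unitary_dual_def)

lemma unitary_dual_related:
  assumes "D \<in> unitary_dual" "\<pi> \<in> D" "\<pi>' \<in> D"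
  shows "(\<pi>, \<pi>') \<in> unitary_equivalence"
  using assms quotient_eq_iff[OF equiv_unitary_equivalence, of D D \<pi> \<pi>'] by (auto simp: unitary_dual_def)

lemma unitary_dual_unrelated:
  assumes "D \<in> unitary_dual" "D' \<in> unitary_dual" "D \<noteq> D'" "\<pi> \<in> D" "\<pi>' \<in> D'"
  shows "(\<pi>, \<pi>') \<notin> unitary_equivalence"
  using assms quotient_eq_iff[OF equiv_unitary_equivalence, of D D' \<pi> \<pi>'] by (auto simp: unitary_dual_def)

lemma irreducible_in_unitary_dual:
  assumes "irreducible_unitary_rep n \<pi>"
  obtains D where "D \<in> unitary_dual" "\<pi> \<in> D"
proof
  show "unitary_equivalence `` {\<pi>} \<in> unitary_dual"
    unfolding unitary_dual_def using assms by (intro quotientI) blast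
  show "\<pi> \<in> unitary_equivalence `` {\<pi>}"
    using equiv_class_self[OF equiv_unitary_equivalence] assms by blast
qed

lemma irreducible_dim_unique:
  assumes "irreducible_unitary_rep n \<pi>" "\<pi> g \<in> carrier_mat m m"
  shows "n = m"
  using unitary_repD(1)[OF irreducible_unitary_repD(2)[OF assms(1)], of g] assms(2) by auto

text \<open>Solved for \<pi>, the equivalence puts the entries of \<pi> into the linear span of
  those of \<open>\<pi>'\<close>. Vanishing of all coefficient integrals thus passes from one
  representative of a class to every other.\<close>

lemma unitary_equivalence_entries:
  assumes irr: "irreducible_unitary_rep n \<pi>" and r: "(\<pi>, \<pi>') \<in> unitary_equivalence"
  obtains U where "U \<in> carrier_mat n n" "irreducible_unitary_rep n \<pi>'"
    "\<And>g. \<pi> g = mat_adjoint U * (\<pi>' g * U)" "mat_adjoint U * U = 1\<^sub>m n"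
proof -
  obtain m U where m: "irreducible_unitary_rep m \<pi>" "irreducible_unitary_rep m \<pi>'"
    and U: "U \<in> carrier_mat m m" "mat_adjoint U * U = 1\<^sub>m m" "\<And>g. U * \<pi> g = \<pi>' g * U"
    using r unfolding unitary_equivalence_def by blast
  note c = unitary_repD(1)[OF irreducible_unitary_repD(2)[OF m(1)]]
  have nm: "n = m" by (rule irreducible_dim_unique[OF irr c])
  have "\<pi> g = mat_adjoint U * (\<pi>' g * U)" for g
    using assoc_mult_mat[OF mat_adjoint_carrier[OF U(1)] U(1) c[of g]] U(2,3) left_mult_one_mat[OF c] by simp
  then show ?thesis using that U m nm by blast
qed

lemma irreducible_trivial_rep: "irreducible_unitary_rep 1 (\<lambda>g. 1\<^sub>m 1)"
  unfolding irreducible_unitary_rep_def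
proof (intro conjI allI impI)
  have "mat_adjoint (1\<^sub>m 1) * 1\<^sub>m 1 = (1\<^sub>m 1 :: complex mat)"
    by (intro eq_matI) (auto simp: mat_adjoint_index)
  then show "unitary_rep 1 (\<lambda>g :: 'a. 1\<^sub>m 1)" unfolding unitary_rep_def by simp
next
  fix W assume W: "VectorSpace.subspace class_ring W (module_vec TYPE(complex) 1) \<and>
    (\<forall>g :: 'a. \<forall>v\<in>W. 1\<^sub>m 1 *\<^sub>v v \<in> W)"
  note Ws = module_vec_subspaceD[OF conjunct1[OF W]]
  show "W = {0\<^sub>v 1} \<or> W = carrier_vec 1"
  proof (cases "W = {0\<^sub>v 1}")
    case False
    then obtain v where v: "v \<in> W" "v \<noteq> 0\<^sub>v 1" using Ws(2) by blast
    then have vc: "v \<in> carrier_vec 1" using Ws(1) by auto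
    have v0: "v $ 0 \<noteq> 0"
    proof
      assume "v $ 0 = 0"
      then have "v = 0\<^sub>v 1" using vc by (intro eq_vecI) auto
      then show False using v(2) by blast
    qed
    have "u \<in> W" if u: "u \<in> carrier_vec 1" for u
    proof -
      have "u = (u $ 0 / v $ 0) \<cdot>\<^sub>v v" using u vc v0 by (intro eq_vecI) auto
      then show ?thesis using Ws(4)[OF v(1)] by metis
    qed
    then show ?thesis using Ws(1) by blast
  qed simp
qed simp


section \<open>The Peter-Weyl theorem\<close>

context compact_haar
begin

section \<open>Orthonormal families in spaces of continuous functions\<close>

definition function_space :: "('g \<Rightarrow> complex) set \<Rightarrow> bool" where
  "function_space V \<longleftrightarrow> (\<forall>f\<in>V. cont f) \<and> (\<lambda>x. 0) \<in> V \<and>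
     (\<forall>f\<in>V. \<forall>g\<in>V. (\<lambda>x. f x + g x) \<in> V) \<and> (\<forall>c. \<forall>f\<in>V. (\<lambda>x. c * f x) \<in> V)"

lemma function_spaceD:
  assumes "function_space V"
  shows "f \<in> V \<Longrightarrow> cont f" "(\<lambda>x. 0) \<in> V" "f \<in> V \<Longrightarrow> g \<in> V \<Longrightarrow> (\<lambda>x. f x + g x) \<in> V"
    "f \<in> V \<Longrightarrow> (\<lambda>x. c * f x) \<in> V"
  using assms by (auto simp: function_space_def)

lemma function_space_diff:
  assumes V: "function_space V" and "f \<in> V" "g \<in> V"
  shows "(\<lambda>x. f x - g x) \<in> V"
  using function_spaceD(3)[OF V assms(2) function_spaceD(4)[OF V assms(3), of "-1"]] by simp

lemma function_space_sum:
  assumes V: "function_space V" and "\<And>i. i \<in> A \<Longrightarrow> f i \<in> V"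
  shows "(\<lambda>x. \<Sum>i\<in>A. f i x) \<in> V"
  using assms(2)
  by (induction A rule: infinite_finite_induct) (auto intro: function_spaceD[OF V])

definition orthonormal_in :: "('g \<Rightarrow> complex) set \<Rightarrow> nat \<Rightarrow> (nat \<Rightarrow> 'g \<Rightarrow> complex) \<Rightarrow> bool" where
  "orthonormal_in V n e \<longleftrightarrow> (\<forall>i<n. e i \<in> V) \<and> (\<forall>i<n. \<forall>j<n. ip (e i) (e j) = (if i = j then 1 else 0))"

lemma ip_orthonormal_sum:
  assumes V: "function_space V" and e: "orthonormal_in V n e" and j: "j < n"
  shows "ip (\<lambda>x. \<Sum>i<n. c i * e i x) (e j) = c j"
proof -
  have ce: "cont (e i)" if "i < n" for i using e that function_spaceD(1)[OF V] by (auto simp: orthonormal_in_def)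
  have "ip (\<lambda>x. \<Sum>i<n. c i * e i x) (e j) = (\<Sum>i<n. ip (\<lambda>x. c i * e i x) (e j))"
    by (rule ip_sum_left) (use ce j in \<open>auto intro: continuous_on_mult_left\<close>)
  also have "\<dots> = (\<Sum>i<n. c i * ip (e i) (e j))"
    by (rule sum.cong) (use ce j in \<open>auto simp: ip_mult_left\<close>)
  also have "\<dots> = (\<Sum>i<n. if i = j then c i else 0)"
    by (rule sum.cong) (use e j in \<open>auto simp: orthonormal_in_def\<close>)
  finally show ?thesis using j by simp
qed

lemma Bessel_inequality:
  assumes V: "function_space V" and e: "orthonormal_in V n e" and k: "cont k"
  shows "(\<Sum>i<n. (cmod (ip k (e i)))\<^sup>2) \<le> nsq k"
proof -
  have ce: "cont (e i)" if "i < n" for i using e that function_spaceD(1)[OF V] by (auto simp: orthonormal_in_def)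
  define s where "s x = (\<Sum>i<n. ip k (e i) * e i x)" for x
  have cs: "cont s" unfolding s_def by (intro continuous_intros) (use ce in auto)
  have *: "ip s f = (\<Sum>i<n. ip k (e i) * ip (e i) f)" if "cont f" for f
  proof -
    have "ip s f = (\<Sum>i<n. ip (\<lambda>x. ip k (e i) * e i x) f)"
      unfolding s_def by (rule ip_sum_left) (use ce that in \<open>auto intro: continuous_on_mult_left\<close>)
    also have "\<dots> = (\<Sum>i<n. ip k (e i) * ip (e i) f)"
      by (rule sum.cong) (use ce that in \<open>auto simp: ip_mult_left\<close>)
    finally show ?thesis .
  qed
  have "ip s k = (\<Sum>i<n. of_real ((cmod (ip k (e i)))\<^sup>2))"
    unfolding *[OF k]
    by (rule sum.cong) (use ce k in \<open>auto simp: ip_commute[of k] complex_norm_square simp del: of_real_power\<close>)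
  then have 1: "ip s k = of_real (\<Sum>i<n. (cmod (ip k (e i)))\<^sup>2)" by (simp only: of_real_sum)
  have "ip s s = (\<Sum>i<n. of_real ((cmod (ip k (e i)))\<^sup>2))"
    unfolding *[OF cs]
  proof (rule sum.cong)
    fix i assume "i \<in> {..<n}"
    then have "ip s (e i) = ip k (e i)" unfolding s_def using ip_orthonormal_sum[OF V e, of i] by simp
    then have "ip (e i) s = cnj (ip k (e i))"
      using ip_commute[OF cs ce, of i] \<open>i \<in> {..<n}\<close> by simp
    then show "ip k (e i) * ip (e i) s = of_real ((cmod (ip k (e i)))\<^sup>2)"
      by (simp add: complex_norm_square del: of_real_power)
  qed simp
  then have "of_real (nsq s) = complex_of_real (\<Sum>i<n. (cmod (ip k (e i)))\<^sup>2)"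
    unfolding ip_self[OF cs] by (simp only: of_real_sum)
  then have 2: "nsq s = (\<Sum>i<n. (cmod (ip k (e i)))\<^sup>2)" by (simp only: of_real_eq_iff)
  have "cont (\<lambda>x. s x - k x)" by (intro continuous_on_diff cs k)
  from nsq_nonneg[OF this] show ?thesis
    unfolding nsq_diff[OF cs k] 1 2 by simp
qed

text \<open>A Gram-Schmidt step: a nonzero remainder, once normalised, would prolong the family.
  Maximal length thus plays the role of dimension.\<close>

lemma maximal_orthonormal_expansion:
  assumes V: "function_space V" and e: "orthonormal_in V n e"
    and max: "\<And>e'. \<not> orthonormal_in V (Suc n) e'" and f: "f \<in> V"
  shows "f = (\<lambda>x. \<Sum>i<n. ip f (e i) * e i x)"
proof (rule ccontr)
  assume neq: "f \<noteq> (\<lambda>x. \<Sum>i<n. ip f (e i) * e i x)"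
  define s where "s = (\<lambda>x. \<Sum>i<n. ip f (e i) * e i x)"
  define r where "r = (\<lambda>x. f x - s x)"
  have eV: "e i \<in> V" if "i < n" for i using e that by (auto simp: orthonormal_in_def)
  have sV: "s \<in> V" unfolding s_def by (intro function_space_sum[OF V] function_spaceD(4)[OF V]) (use eV in auto)
  have rV: "r \<in> V" unfolding r_def by (rule function_space_diff[OF V f sV])
  note c = function_spaceD(1)[OF V]
  have orth: "ip r (e j) = 0" if "j < n" for j
    unfolding r_def ip_diff_left[OF c[OF f] c[OF sV] c[OF eV[OF that]]]
    using ip_orthonormal_sum[OF V e that, of "\<lambda>i. ip f (e i)"] by (simp add: s_def)
  have "\<exists>x. r x \<noteq> 0" using neq by (auto simp: r_def s_def fun_eq_iff)
  then have pos: "0 < nsq r" using nsq_pos[OF c[OF rV]] by blast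
  define \<beta> where "\<beta> = complex_of_real (1 / sqrt (nsq r))"
  define u where "u = (\<lambda>x. \<beta> * r x)"
  have uV: "u \<in> V" unfolding u_def by (rule function_spaceD(4)[OF V rV])
  have "nsq u = 1"
    unfolding u_def nsq_mult[OF c[OF rV]] using pos by (simp add: \<beta>_def norm_divide power_divide)
  then have uu: "ip u u = 1" using ip_self[OF c[OF uV]] by simp
  have ue: "ip u (e j) = 0" "ip (e j) u = 0" if "j < n" for j
    using orth[OF that] ip_mult_left[OF c[OF rV] c[OF eV[OF that]], of \<beta>]
      ip_commute[OF c[OF uV] c[OF eV[OF that]]] by (simp_all add: u_def)
  have "orthonormal_in V (Suc n) (e(n := u))"
    using e uV uu ue by (auto simp: orthonormal_in_def less_Suc_eq)
  then show False using max by blast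
qed

text \<open>For functions fixed by convolution with \<open>p\<close>, evaluation at \<open>x\<close>
  is the scalar product with a translate \<open>k\<close> of \<open>p\<close>, inverted and
  conjugated. Bessel's inequality bounds the sum of the squared moduli at \<open>x\<close> by
  \<open>nsq p\<close>; averaging over \<open>x\<close> counts the family.\<close>

lemma orthonormal_card_le:
  assumes V: "function_space V" and e: "orthonormal_in V n e"
    and p: "cont p" and fix_p: "\<And>f. f \<in> V \<Longrightarrow> conv p f = f"
  shows "real n \<le> nsq p"
proof -
  have eV: "e i \<in> V" if "i < n" for i using e that by (auto simp: orthonormal_in_def)
  note ce = function_spaceD(1)[OF V eV]
  have "(\<Sum>i<n. (cmod (e i x))\<^sup>2) \<le> nsq p" for x
  proof -
    define k where "k y = cnj (p (x + - y))" for y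
    have ck: "cont k" unfolding k_def
      by (intro continuous_on_cnj continuous_on_compose2[OF p] continuous_intros) auto
    have "e i x = ip (e i) k" if i: "i < n" for i
    proof -
      have c: "cont (\<lambda>y. p y * e i (- y + x))" by (rule cont_conv_integrand[OF p ce[OF i]])
      have "e i x = mean (\<lambda>y. p y * e i (- y + x))"
        using fun_cong[OF fix_p[OF eV[OF i]], of x] by (simp add: conv_def)
      also have "\<dots> = mean (\<lambda>y. p (x + y) * e i (- (x + y) + x))"
        by (rule mean_translate[OF c, symmetric])
      also have "\<dots> = mean (\<lambda>y. p (x + - y) * e i (- (x + - y) + x))"
        by (rule mean_inverse[OF continuous_on_translate(1)[OF c], symmetric])
      also have "\<dots> = ip (e i) k"
        unfolding ip_def k_def by (simp only: minus_add minus_minus add.assoc left_minus complex_cnj_cnj mult.commute add_0_right)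
      finally show ?thesis .
    qed
    then have "(\<Sum>i<n. (cmod (e i x))\<^sup>2) = (\<Sum>i<n. (cmod (ip k (e i)))\<^sup>2)"
      using ip_commute[OF ck ce] by (intro sum.cong) auto
    also have "\<dots> \<le> nsq k" by (rule Bessel_inequality[OF V e ck])
    also have "nsq k = mean (\<lambda>y. (cmod (p (x + - y)))\<^sup>2)" by (simp add: nsq_def k_def)
    also have "\<dots> = mean (\<lambda>y. (cmod (p (x + y)))\<^sup>2)"
      by (rule mean_inverse[OF continuous_on_translate(1)[OF cont_cmod_sq[OF p]]])
    also have "\<dots> = nsq p" unfolding nsq_def by (rule mean_translate[OF cont_cmod_sq[OF p]])
    finally show ?thesis .
  qed
  then have "mean (\<lambda>x. \<Sum>i<n. (cmod (e i x))\<^sup>2) \<le> mean (\<lambda>x. nsq p)"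
    by (intro mean_mono continuous_on_sum cont_cmod_sq continuous_on_const) (use ce in auto)
  moreover have "mean (\<lambda>x. \<Sum>i<n. (cmod (e i x))\<^sup>2) = (\<Sum>i<n. nsq (e i))"
    unfolding nsq_def by (rule mean_sum) (use ce in \<open>auto intro: cont_cmod_sq\<close>)
  moreover have "nsq (e i) = 1" if "i < n" for i
    using ip_self[OF ce[OF that]] e that by (simp add: orthonormal_in_def)
  ultimately show ?thesis by simp
qed

section \<open>Right translations and irreducible subspaces\<close>

definition right_invariant :: "('g \<Rightarrow> complex) set \<Rightarrow> bool" where
  "right_invariant V \<longleftrightarrow> (\<forall>f\<in>V. \<forall>g. (\<lambda>x. f (x + g)) \<in> V)"

text \<open>Left convolutions commute with right translations, so the functions fixed by a left
  convolution form a representation space.\<close>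

lemma conv_translate_right: "conv f (\<lambda>x. k (x + g)) = (\<lambda>x. conv f k (x + g))"
  by (simp add: conv_def add.assoc)

lemma ip_translate_right:
  assumes "cont f" "cont k"
  shows "ip (\<lambda>x. f (x + g)) (\<lambda>x. k (x + g)) = ip f k"
  unfolding ip_def by (rule mean_translate_right[OF cont_mult_cnj[OF assms]])

text \<open>An invariant function space of minimal dimension inside the fixed space of a convolution
  projection carries an irreducible representation.\<close>

lemma irreducible_subrepresentation:
  assumes p: "cont p" "conv p p = p" "p x0 \<noteq> 0"
  shows "\<exists>n e \<pi>. irreducible_unitary_rep n \<pi> \<and>
    (\<forall>i<n. cont (e i) \<and> conv p (e i) = e i \<and> ip (e i) (e i) = 1) \<and>
    (\<forall>g. \<forall>j<n. \<forall>x. e j (x + g) = (\<Sum>i<n. \<pi> g $$ (i, j) * e i x))"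
proof -
  define E where "E = {f. cont f \<and> conv p f = f}"
  define S where "S = {V. function_space V \<and> right_invariant V \<and> V \<subseteq> E \<and> (\<exists>f\<in>V. \<exists>x. f x \<noteq> 0)}"
  define P where "P V n \<longleftrightarrow> (\<exists>e. orthonormal_in V n e)" for V n
  define d where "d V = (GREATEST n. P V n)" for V
  have conv_add: "conv p (\<lambda>x. f x + g x) = (\<lambda>x. conv p f x + conv p g x)" if "cont f" "cont g" for f g
    unfolding conv_def distrib_left
    using mean_add[OF cont_conv_integrand[OF p(1) that(1)] cont_conv_integrand[OF p(1) that(2)]] by simp
  have "function_space E"
    unfolding function_space_def
    by (auto simp: E_def conv_add conv_mult_right p intro!: continuous_intros) (simp add: conv_def)
  moreover have "right_invariant E"
    by (auto simp: E_def right_invariant_def conv_translate_right intro: continuous_on_translate)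
  ultimately have "E \<in> S" using p by (auto simp: S_def E_def)
  then obtain V where V: "V \<in> S" and V_min: "\<And>V'. V' \<in> S \<Longrightarrow> d V \<le> d V'"
    using ex_has_least_nat[of "\<lambda>V. V \<in> S" E d] by blast
  \<comment> \<open>This bound ensures that the greatest elements defining \<open>d\<close> are
    attained, so that \<open>d\<close> really is the maximal length of an orthonormal family. The
    minimal \<open>V\<close> could be chosen beforehand because \<open>d\<close> takes natural
    values.\<close>
  have bound: "n \<le> nat \<lfloor>nsq p\<rfloor>" if "V' \<in> S" "P V' n" for V' n
    using that orthonormal_card_le[of V' n _ p] p(1)
    by (intro le_nat_floor) (auto simp: S_def E_def P_def subset_iff)
  have d_ortho: "P V' (d V')" if "V' \<in> S" for V'
    unfolding d_def
  proof (rule GreatestI_ex_nat)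
    show "\<exists>n. P V' n" by (auto simp: P_def orthonormal_in_def intro: exI[of _ 0])
  qed (rule bound[OF that])
  have d_max: "n \<le> d V'" if "V' \<in> S" "P V' n" for V' n
    unfolding d_def using bound[OF that(1)] by (intro Greatest_le_nat[of "P V'", OF that(2)])
  define n where "n = d V"
  obtain e where e: "orthonormal_in V n e" using d_ortho[OF V] by (auto simp: P_def n_def)
  have fs: "function_space V" and inv: "right_invariant V" and VE: "V \<subseteq> E" using V by (auto simp: S_def)
  have expand: "f = (\<lambda>x. \<Sum>i<n. ip f (e i) * e i x)" if "f \<in> V" for f
  proof (rule maximal_orthonormal_expansion[OF fs e _ that])
    show "\<not> orthonormal_in V (Suc n) e'" for e'
      using d_max[OF V, of "Suc n"] by (auto simp: P_def n_def)
  qed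
  have eV: "e i \<in> V" if "i < n" for i using e that by (auto simp: orthonormal_in_def)
  note ce = function_spaceD(1)[OF fs eV]
  have ReV: "(\<lambda>x. e j (x + g)) \<in> V" if "j < n" for j g using inv eV[OF that] by (auto simp: right_invariant_def)
  note cRe = function_spaceD(1)[OF fs ReV]
  have n_pos: "0 < n"
  proof (rule ccontr)
    assume "\<not> 0 < n"
    then have "f x = 0" if "f \<in> V" for f x using fun_cong[OF expand[OF that], of x] by simp
    then show False using V by (auto simp: S_def)
  qed
  \<comment> \<open>The matrix of right translation by \<open>g\<close> in the basis
    \<open>e\<close>; translating on the right gives a homomorphism without inverting
    \<open>g\<close>.\<close>
  define \<pi> where "\<pi> g = mat n n (\<lambda>(i, j). ip (\<lambda>x. e j (x + g)) (e i))" for g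
  have \<pi>c: "\<pi> g \<in> carrier_mat n n" for g by (simp add: \<pi>_def)
  have \<pi>i: "\<pi> g $$ (i, j) = ip (\<lambda>x. e j (x + g)) (e i)" if "i < n" "j < n" for g i j
    using that by (simp add: \<pi>_def)
  have translate: "e j (x + g) = (\<Sum>i<n. \<pi> g $$ (i, j) * e i x)" if "j < n" for j g x
    using fun_cong[OF expand[OF ReV[OF that, of g]], of x] that by (simp add: \<pi>i)
  have coeff: "ip f (e i) = c i" if "f = (\<lambda>x. \<Sum>i<n. c i * e i x)" "i < n" for f c i
    using ip_orthonormal_sum[OF fs e that(2), of c] that(1) by simp
  have hom: "\<pi> (g + h) $$ (i, j) = (\<Sum>k<n. \<pi> g $$ (i, k) * \<pi> h $$ (k, j))" if "i < n" "j < n" for g h i j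
  proof -
    have "e j (x + (g + h)) = (\<Sum>k<n. \<pi> h $$ (k, j) * e k (x + g))" for x
      using translate[OF that(2), of "x + g" h] by (simp only: add.assoc)
    then have "(\<lambda>x. e j (x + (g + h))) = (\<lambda>x. \<Sum>k<n. \<pi> h $$ (k, j) * e k (x + g))" by (rule ext)
    also have "\<dots> = (\<lambda>x. \<Sum>k<n. \<Sum>i<n. \<pi> h $$ (k, j) * (\<pi> g $$ (i, k) * e i x))"
      using translate by (simp add: sum_distrib_left)
    also have "\<dots> = (\<lambda>x. \<Sum>i<n. (\<Sum>k<n. \<pi> g $$ (i, k) * \<pi> h $$ (k, j)) * e i x)"
      by (subst sum.swap) (simp add: sum_distrib_right sum_distrib_left mult_ac)
    finally have "ip (\<lambda>x. e j (x + (g + h))) (e i) = (\<Sum>k<n. \<pi> g $$ (i, k) * \<pi> h $$ (k, j))"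
      by (rule coeff[OF _ that(1)])
    then show ?thesis using that by (simp only: \<pi>i)
  qed
  have unit: "(\<Sum>k<n. cnj (\<pi> g $$ (k, i)) * \<pi> g $$ (k, j)) = (if i = j then 1 else 0)" if "i < n" "j < n" for g i j
  proof -
    have "(if i = j then 1 else 0) = ip (\<lambda>x. e j (x + g)) (\<lambda>x. e i (x + g))"
      using ip_translate_right[OF ce ce, OF that(2,1)] e that by (auto simp: orthonormal_in_def)
    also have "(\<lambda>x. e j (x + g)) = (\<lambda>x. \<Sum>k<n. \<pi> g $$ (k, j) * e k x)" using translate[OF that(2)] by simp
    also have "ip \<dots> (\<lambda>x. e i (x + g)) = (\<Sum>k<n. ip (\<lambda>x. \<pi> g $$ (k, j) * e k x) (\<lambda>x. e i (x + g)))"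
      by (rule ip_sum_left) (use ce cRe that in \<open>auto intro: continuous_on_mult_left\<close>)
    also have "\<dots> = (\<Sum>k<n. cnj (\<pi> g $$ (k, i)) * \<pi> g $$ (k, j))"
    proof (rule sum.cong)
      fix k assume "k \<in> {..<n}"
      then have k: "k < n" by simp
      have "ip (e k) (\<lambda>x. e i (x + g)) = cnj (\<pi> g $$ (k, i))"
        using ip_commute[OF cRe[OF that(1)] ce[OF k]] that k by (simp add: \<pi>i)
      then show "ip (\<lambda>x. \<pi> g $$ (k, j) * e k x) (\<lambda>x. e i (x + g)) = cnj (\<pi> g $$ (k, i)) * \<pi> g $$ (k, j)"
        using ip_mult_left[OF ce[OF k] cRe[OF that(1)]] by simp
    qed simp
    finally show ?thesis by simp
  qed
  have cont_\<pi>: "continuous_on UNIV (\<lambda>g. \<pi> g $$ (i, j))" if "i < n" "j < n" for i j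
    unfolding \<pi>i[OF that] ip_def
  proof (rule continuous_on_mean)
    show "continuous_on UNIV (\<lambda>(g, x). e j (x + g) * cnj (e i x))"
      unfolding case_prod_beta
      by (intro continuous_on_mult continuous_on_cnj continuous_on_compose2[OF ce[OF that(1)]]
        continuous_on_compose2[OF ce[OF that(2)]] continuous_intros) auto
  qed
  have rep: "unitary_rep n \<pi>" by (rule unitary_repI[OF \<pi>c unit hom cont_\<pi>])
  have "W = {0\<^sub>v n} \<or> W = carrier_vec n"
    if W: "VectorSpace.subspace class_ring W (module_vec TYPE(complex) n)"
      and Winv: "\<forall>g. \<forall>v\<in>W. \<pi> g *\<^sub>v v \<in> W" for W
  proof (cases "W = {0\<^sub>v n}")
    case False
    note Ws = module_vec_subspaceD[OF W]
    \<comment> \<open>Coordinates with respect to \<open>e\<close> transport an invariant subspace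
      \<open>W\<close> of vectors to an invariant function space, to which the minimality of
      \<open>V\<close> applies.\<close>
    define F where "F v = (\<lambda>x. \<Sum>i<n. v $ i * e i x)" for v :: "complex vec"
    have F_V: "F v \<in> V" for v unfolding F_def
      by (intro function_space_sum[OF fs] function_spaceD(4)[OF fs]) (use eV in auto)
    have F_coeff: "ip (F v) (e i) = v $ i" if "i < n" for v i by (rule coeff[OF F_def that])
    have FW: "F ` W \<in> S"
      unfolding S_def
    proof (intro CollectI conjI)
      show "function_space (F ` W)"
        unfolding function_space_def
      proof (intro conjI ballI allI)
        show "cont f" if "f \<in> F ` W" for f using that F_V function_spaceD(1)[OF fs] by blast
        have "F (0\<^sub>v n) = (\<lambda>x. 0)" by (simp add: F_def)
        then show "(\<lambda>x. 0) \<in> F ` W" using Ws(2) by force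
        show "(\<lambda>x. f x + g x) \<in> F ` W" if fg: "f \<in> F ` W" "g \<in> F ` W" for f g
        proof -
          obtain v w where vw: "v \<in> W" "w \<in> W" "f = F v" "g = F w" using fg by blast
          then have "v \<in> carrier_vec n" "w \<in> carrier_vec n" using Ws(1) by auto
          then have "F (v + w) = (\<lambda>x. f x + g x)"
            using vw by (simp add: F_def distrib_right sum.distrib)
          then show ?thesis using Ws(3)[OF vw(1,2)] by (metis imageI)
        qed
        show "(\<lambda>x. c * f x) \<in> F ` W" if f: "f \<in> F ` W" for c f
        proof -
          obtain v where v: "v \<in> W" "f = F v" using f by blast
          then have "v \<in> carrier_vec n" using Ws(1) by auto
          then have "F (c \<cdot>\<^sub>v v) = (\<lambda>x. c * f x)"
            using v by (simp add: F_def sum_distrib_left mult.assoc)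
          then show ?thesis using Ws(4)[OF v(1)] by (metis imageI)
        qed
      qed
      show "right_invariant (F ` W)"
        unfolding right_invariant_def
      proof (intro ballI allI)
        fix f g assume "f \<in> F ` W"
        then obtain v where v: "v \<in> W" "f = F v" by blast
        then have vc: "v \<in> carrier_vec n" using Ws(1) by auto
        have "(\<lambda>x. f (x + g)) = (\<lambda>x. \<Sum>j<n. \<Sum>i<n. v $ j * (\<pi> g $$ (i, j) * e i x))"
          unfolding v(2) F_def using translate by (simp add: sum_distrib_left)
        also have "\<dots> = (\<lambda>x. \<Sum>i<n. (\<Sum>j<n. \<pi> g $$ (i, j) * v $ j) * e i x)"
          by (subst sum.swap) (simp add: sum_distrib_right sum_distrib_left mult_ac)
        also have "\<dots> = F (\<pi> g *\<^sub>v v)"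
          unfolding F_def by (intro ext sum.cong) (simp_all add: mult_mat_vec_index[OF \<pi>c vc] del: index_mult_mat_vec)
        finally show "(\<lambda>x. f (x + g)) \<in> F ` W" using Winv v(1) by simp
      qed
      show "F ` W \<subseteq> E" using F_V VE by blast
      obtain v where v: "v \<in> W" "v \<noteq> 0\<^sub>v n" using False Ws(2) by blast
      then obtain i where i: "i < n" "v $ i \<noteq> 0" using Ws(1) by (metis carrier_vecD eq_vecI index_zero_vec subsetD)
      then have "ip (F v) (e i) \<noteq> 0" by (simp add: F_coeff)
      then have "\<exists>x. F v x \<noteq> 0" by (rule contrapos_np) (simp add: ip_def)
      then show "\<exists>f\<in>F ` W. \<exists>x. f x \<noteq> 0" using v(1) by blast
    qed
    \<comment> \<open>By minimality \<open>F ` W\<close> contains an orthonormal family of the maximal size \<open>n\<close>, which spans \<open>V\<close>.\<close>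
    have "n \<le> d (F ` W)" using V_min[OF FW] by (simp add: n_def)
    obtain e' where e': "orthonormal_in (F ` W) (d (F ` W)) e'" using d_ortho[OF FW] by (auto simp: P_def)
    have "F ` W \<subseteq> V" using F_V by blast
    moreover have lt: "i < d (F ` W)" if "i < n" for i using that \<open>n \<le> d (F ` W)\<close> by simp
    ultimately have e'V: "orthonormal_in V n e'"
      using e' unfolding orthonormal_in_def by blast
    have fsW: "function_space (F ` W)" using FW by (simp add: S_def)
    have "e j \<in> F ` W" if "j < n" for j
    proof -
      have "e j = (\<lambda>x. \<Sum>i<n. ip (e j) (e' i) * e' i x)"
      proof (rule maximal_orthonormal_expansion[OF fs e'V _ eV[OF that]])
        show "\<not> orthonormal_in V (Suc n) e''" for e''
          using d_max[OF V, of "Suc n"] by (auto simp: P_def n_def)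
      qed
      moreover have "(\<lambda>x. \<Sum>i<n. ip (e j) (e' i) * e' i x) \<in> F ` W"
        using e' lt
        by (intro function_space_sum[OF fsW] function_spaceD(4)[OF fsW]) (auto simp: orthonormal_in_def)
      ultimately show ?thesis by simp
    qed
    note eFW = this
    have unitW: "unit_vec n j \<in> W" if j: "j < n" for j
    proof -
      obtain v where v: "v \<in> W" "e j = F v" using eFW[OF j] by blast
      have "v $ i = unit_vec n j $ i" if "i < n" for i
      proof -
        have "ip (e j) (e i) = (if j = i then 1 else 0)" using e that j by (simp add: orthonormal_in_def)
        then show ?thesis using F_coeff[OF that, of v] that j by (simp add: v(2) unit_vec_def)
      qed
      then have "v = unit_vec n j" using v(1) Ws(1) by (intro eq_vecI) auto
      then show ?thesis using v(1) by simp
    qed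
    have "carrier_vec n \<subseteq> W"
    proof
      fix v :: "complex vec" assume v: "v \<in> carrier_vec n"
      have part: "vec n (\<lambda>i. if i < m then v $ i else 0) \<in> W" if "m \<le> n" for m
        using that
      proof (induction m)
        case 0
        have "vec n (\<lambda>i. if i < 0 then v $ i else 0) = 0\<^sub>v n" by (intro eq_vecI) auto
        then show ?case using Ws(2) by simp
      next
        case (Suc m)
        have "vec n (\<lambda>i. if i < Suc m then v $ i else 0)
          = vec n (\<lambda>i. if i < m then v $ i else 0) + v $ m \<cdot>\<^sub>v unit_vec n m"
          using Suc.prems by (intro eq_vecI) (auto simp: unit_vec_def less_Suc_eq)
        then show ?case using Suc Ws(3,4) unitW by simp
      qed
      have "vec n (\<lambda>i. if i < n then v $ i else 0) = v" using v by (intro eq_vecI) auto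
      then show "v \<in> W" using part[of n] by simp
    qed
    then show ?thesis using Ws(1) by blast
  qed simp
  then have "irreducible_unitary_rep n \<pi>"
    unfolding irreducible_unitary_rep_def using n_pos rep by blast
  moreover have "cont (e i) \<and> conv p (e i) = e i \<and> ip (e i) (e i) = 1" if "i < n" for i
    using ce[OF that] eV[OF that] VE e that by (auto simp: E_def orthonormal_in_def)
  ultimately show ?thesis using translate by blast
qed

end

text \<open>\<open>N\<close> stands for the continuous functions that annihilate the orbit of an
  algebra element. Abstracting from the orbit keeps the Peter-Weyl argument among complex functions,
  where a scalar product is available.\<close>

locale coefficient_space = compact_haar \<mu> for \<mu> :: "('g::{topological_group_add, t2_space}) measure" +
  fixes N :: "('g \<Rightarrow> complex) set"
  assumes function_space_N: "function_space N"
    and conv_N: "\<And>h k. cont h \<Longrightarrow> k \<in> N \<Longrightarrow> conv h k \<in> N"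
    and coefficients_N: "\<And>n \<pi> i j. irreducible_unitary_rep n \<pi> \<Longrightarrow> i < n \<Longrightarrow> j < n \<Longrightarrow> (\<lambda>g. \<pi> g $$ (i, j)) \<in> N"
    and closed_N: "\<And>q l. (\<And>n. q n \<in> N) \<Longrightarrow> cont l \<Longrightarrow> uniform_limit UNIV q l sequentially \<Longrightarrow> l \<in> N"
begin

lemma orthogonal_conv:
  assumes "cont h" "cont w" "\<And>q. q \<in> N \<Longrightarrow> ip w q = 0" "q \<in> N"
  shows "ip (conv h w) q = 0"
  using ip_conv_left[OF assms(1,2) function_spaceD(1)[OF function_space_N assms(4)]]
    assms(3) conv_N[OF cont_star[OF assms(1)] assms(4)] by simp

text \<open>For \<open>w\<close> nonzero, the projection made from \<open>star w * w\<close>, in the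
  sense of convolution, fixes a unit function \<open>e 0\<close> that transforms under an
  irreducible \<pi>. Its image \<open>star (e 0)\<close> is a combination of entries of \<pi>, hence
  in \<open>N\<close>; it also has the form \<open>conv f w\<close>, hence is orthogonal to
  \<open>N\<close>, and so to itself. The order of the two factors leaves \<open>w\<close> on the
  right, where left convolutions preserve orthogonality.\<close>

theorem orthogonal_eq_0:
  assumes w: "cont w" and orth: "\<And>q. q \<in> N \<Longrightarrow> ip w q = 0"
  shows "w x = 0"
proof (rule ccontr)
  assume wx: "w x \<noteq> 0"
  define h where "h = conv (star w) w"
  have h: "cont h" "star h = h" using w by (simp_all add: h_def star_conv)
  have "star w (- x) \<noteq> 0" using wx by (simp add: star_def)
  then have "0 < nsq (star w)" by (rule nsq_pos[OF cont_star[OF w]])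
  then have "h 0 \<noteq> 0" using ip_self[OF cont_star[OF w]] by (simp add: h_def conv_0)
  then obtain p r where p: "cont p" "cont r" "star p = p" "conv p p = p" "p = conv r h" "p 0 \<noteq> 0"
    using convolution_projection[OF h] by blast
  obtain n e \<pi> where irr: "irreducible_unitary_rep n \<pi>"
    and e: "\<And>i. i < n \<Longrightarrow> cont (e i)" "\<And>i. i < n \<Longrightarrow> conv p (e i) = e i" "\<And>i. i < n \<Longrightarrow> ip (e i) (e i) = 1"
    and tr: "\<And>g j x. j < n \<Longrightarrow> e j (x + g) = (\<Sum>i<n. \<pi> g $$ (i, j) * e i x)"
    using irreducible_subrepresentation[OF p(1,4,6)] by blast
  have n: "0 < n" using irr by (simp add: irreducible_unitary_rep_def)
  let ?f = "star (e 0)"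
  have cf: "cont ?f" using e(1)[OF n] by simp
  have inv: "\<pi> (- g) $$ (i, j) = cnj (\<pi> g $$ (j, i))" if ij: "i < n" "j < n" for g i j
    using mat_adjoint_index[of i "\<pi> g" j] ij carrier_matD[OF unitary_repD(1)[OF irreducible_unitary_repD(2)[OF irr], of g]]
      unitary_rep_uminus[OF irreducible_unitary_repD(2)[OF irr], of g] by simp
  have "?f = (\<lambda>g. \<Sum>i<n. cnj (e i 0) * \<pi> g $$ (0, i))"
  proof
    fix g
    show "?f g = (\<Sum>i<n. cnj (e i 0) * \<pi> g $$ (0, i))"
      using tr[OF n, of 0 "- g"] n by (simp add: star_def inv mult.commute)
  qed
  also have "\<dots> \<in> N"
    by (intro function_space_sum[OF function_space_N] function_spaceD(4)[OF function_space_N] coefficients_N[OF irr] n)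
      auto
  finally have fN: "?f \<in> N" .
  have "?f = conv ?f p" using star_conv[OF p(1) e(1)[OF n]] e(2)[OF n] p(3) by simp
  also have "\<dots> = conv (conv (conv ?f r) (star w)) w"
    unfolding p(5) h_def using cf p(2) w by (simp add: conv_assoc)
  finally have f: "?f = conv (conv (conv ?f r) (star w)) w" .
  have "ip ?f ?f = 0"
    by (subst (1) f, rule orthogonal_conv) (use cf p(2) w orth fN in auto)
  then have "nsq ?f = 0" using ip_self[OF cf] by simp
  then have "?f (- x) = 0" for x by (rule nsq_eq_0[OF cf])
  then have "e 0 x = 0" for x by (simp add: star_def)
  then have "e 0 = (\<lambda>x. 0)" by (rule ext)
  then show False using e(3)[OF n] by (simp add: ip_def)
qed

text \<open>Rather than projecting onto the closure of \<open>N\<close> in the Hilbert space of square integrable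
  functions, regularise by \<open>h\<close> a sequence in \<open>N\<close> minimising the distance to \<open>k\<close>: the error then
  converges uniformly, to a continuous function orthogonal to \<open>N\<close>.\<close>

theorem conv_mem:
  assumes h: "cont h" and k: "cont k"
  shows "conv h k \<in> N"
proof -
  note cN = function_spaceD(1)[OF function_space_N]
  define D where "D = (\<lambda>m. nsq (\<lambda>x. k x - m x)) ` N"
  define d where "d = Inf D"
  have nn: "0 \<le> nsq (\<lambda>x. k x - m x)" if "m \<in> N" for m
    by (intro nsq_nonneg continuous_on_diff k cN that)
  have bdd: "bdd_below D" unfolding D_def by (rule bdd_belowI2[of _ 0]) (rule nn)
  have ne: "D \<noteq> {}" using function_spaceD(2)[OF function_space_N] by (auto simp: D_def)
  have d_le: "d \<le> nsq (\<lambda>x. k x - m x)" if "m \<in> N" for m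
    unfolding d_def by (rule cInf_lower[OF _ bdd]) (use that in \<open>auto simp: D_def\<close>)
  have "\<exists>m\<in>N. nsq (\<lambda>x. k x - m x) < d + 1 / real (Suc n)" for n
    using cInf_lessD[OF ne, of "d + 1 / real (Suc n)"] by (auto simp: d_def D_def)
  then obtain m where m: "\<And>n. m n \<in> N" "\<And>n. nsq (\<lambda>x. k x - m n x) < d + 1 / real (Suc n)" by metis
  define f where "f n = (\<lambda>x. k x - m n x)" for n
  have cf: "cont (f n)" for n unfolding f_def by (intro continuous_on_diff k cN m)
  have f_lt: "nsq (f n) < d + 1 / real (Suc n)" for n using m(2) by (simp add: f_def)
  \<comment> \<open>The midpoint of two near-minimisers still competes for the distance, and the
    parallelogram law then forces them to be close.\<close>
  have dist: "nsq (\<lambda>x. f i x - f j x) \<le> 2 * (1 / real (Suc i)) + 2 * (1 / real (Suc j))" for i j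
  proof -
    have avg: "(\<lambda>x. (1/2) * (m i x + m j x)) \<in> N"
      by (intro function_spaceD(4)[OF function_space_N] function_spaceD(3)[OF function_space_N] m)
    have ca: "cont (\<lambda>x. k x - (1/2) * (m i x + m j x))" by (intro continuous_on_diff k cN avg)
    have "(\<lambda>x. f i x + f j x) = (\<lambda>x. 2 * (k x - (1/2) * (m i x + m j x)))"
      by (simp add: f_def fun_eq_iff algebra_simps)
    then have "nsq (\<lambda>x. f i x + f j x) = 4 * nsq (\<lambda>x. k x - (1/2) * (m i x + m j x))"
      using nsq_mult[OF ca, of 2] by simp
    also have "\<dots> \<ge> 4 * d" using d_le[OF avg] by simp
    finally show ?thesis using parallelogram[OF cf cf, of i j] f_lt[of i] f_lt[of j] by linarith
  qed
  have "\<exists>K. \<forall>i\<ge>K. \<forall>j\<ge>K. nsq (\<lambda>x. f i x - f j x) < \<epsilon>" if "0 < \<epsilon>" for \<epsilon>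
  proof -
    have "0 < \<epsilon> / 4" using that by simp
    then obtain K where K: "1 / real (Suc K) < \<epsilon> / 4" by (rule nat_approx_posE)
    have small: "1 / real (Suc i) < \<epsilon> / 4" if "i \<ge> K" for i
    proof -
      have "1 / real (Suc i) \<le> 1 / real (Suc K)" using that by (intro divide_left_mono) auto
      then show ?thesis using K by linarith
    qed
    have "nsq (\<lambda>x. f i x - f j x) < \<epsilon>" if "i \<ge> K" "j \<ge> K" for i j
      using dist[of i j] small[OF that(1)] small[OF that(2)] by linarith
    then show ?thesis by blast
  qed
  from L2_Cauchy_conv_limit[OF h cf this] obtain w where
    w: "cont w" "uniform_limit UNIV (\<lambda>n. conv h (f n)) w sequentially" by blast
  have tend: "(\<lambda>n. ip (f n) q) \<longlonglongrightarrow> 0" if q: "q \<in> N" for q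
  proof -
    \<comment> \<open>The step width in the variation of \<open>m n\<close> along \<open>q\<close>:
      with \<open>s * nsq q \<le> 1\<close> the quadratic term costs at most half of the linear
      gain. The added 1 avoids a division by zero when \<open>q\<close> vanishes.\<close>
    define s where "s = 1 / (nsq q + 1)"
    have s: "0 < s" "s * nsq q \<le> 1" "0 \<le> nsq q"
      using nsq_nonneg[OF cN[OF q]] by (auto simp: s_def divide_simps)
    have le: "(cmod (ip (f n) q))\<^sup>2 \<le> (1 / s) * (1 / real (Suc n))" for n
    proof -
      define z where "z = ip (f n) q"
      define t where "t = of_real s * z"
      have ct: "cont (\<lambda>x. t * q x)" by (intro continuous_on_mult_left cN q)
      have "(\<lambda>x. m n x + t * q x) \<in> N"
        by (intro function_spaceD(3)[OF function_space_N] function_spaceD(4)[OF function_space_N] m q)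
      from d_le[OF this] have "d \<le> nsq (\<lambda>x. f n x - t * q x)" by (simp add: f_def diff_diff_eq)
      also have "\<dots> = nsq (f n) - 2 * Re (cnj t * z) + (cmod t)\<^sup>2 * nsq q"
        unfolding nsq_diff[OF cf ct] ip_mult_right[OF cN[OF q] cf] nsq_mult[OF cN[OF q]] z_def ..
      also have "Re (cnj t * z) = s * (cmod z)\<^sup>2"
        unfolding cmod_power2 by (simp add: t_def algebra_simps power2_eq_square)
      also have "(cmod t)\<^sup>2 * nsq q = s * (cmod z)\<^sup>2 * (s * nsq q)"
        using s(1) by (simp add: t_def norm_mult power_mult_distrib power2_eq_square)
      also have "\<dots> \<le> s * (cmod z)\<^sup>2 * 1" using s by (intro mult_left_mono) auto
      finally have "s * (cmod z)\<^sup>2 \<le> 1 / real (Suc n)" using f_lt[of n] by linarith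
      then show ?thesis using s(1) by (simp add: z_def divide_simps mult_ac)
    qed
    have "(\<lambda>n. (1 / s) * (1 / real (Suc n))) \<longlonglongrightarrow> (1 / s) * 0"
      by (rule tendsto_mult_left[OF LIMSEQ_Suc[OF lim_1_over_n]])
    then have lim: "(\<lambda>n. (1 / s) * (1 / real (Suc n))) \<longlonglongrightarrow> 0" by (simp only: mult_zero_right)
    have "(\<lambda>n. (cmod (ip (f n) q))\<^sup>2) \<longlonglongrightarrow> 0"
      by (rule tendsto_sandwich[OF _ _ tendsto_const lim]) (simp_all only: le zero_le_power2 eventually_True)
    then have "(\<lambda>n. sqrt ((cmod (ip (f n) q))\<^sup>2)) \<longlonglongrightarrow> sqrt 0" by (rule tendsto_real_sqrt)
    then show ?thesis by (simp add: tendsto_norm_zero_iff)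
  qed
  \<comment> \<open>The regularisation passes to \<open>q\<close> as convolution by
    \<open>star h\<close>, under which \<open>N\<close> is stable, so the limit inherits the
    asymptotic orthogonality.\<close>
  have "ip w q = 0" if q: "q \<in> N" for q
  proof -
    have "(\<lambda>n. ip (conv h (f n)) q) \<longlonglongrightarrow> ip w q"
      by (rule tendsto_ip[OF cont_conv[OF h cf] w(1) cN[OF q] w(2)])
    moreover have "(\<lambda>n. ip (conv h (f n)) q) \<longlonglongrightarrow> 0"
      unfolding ip_conv_left[OF h cf cN[OF q]] by (rule tend[OF conv_N[OF cont_star[OF h] q]])
    ultimately show ?thesis by (rule LIMSEQ_unique)
  qed
  then have "w x = 0" for x by (rule orthogonal_eq_0[OF w(1)])
  then have w0: "w = (\<lambda>x. 0)" by (rule ext)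
  have "uniform_limit UNIV (\<lambda>n. conv h (m n)) (conv h k) sequentially"
  proof (rule uniform_limitI)
    fix \<epsilon> :: real assume "0 < \<epsilon>"
    from uniform_limitD[OF w(2) this]
    show "\<forall>\<^sub>F n in sequentially. \<forall>x\<in>UNIV. dist (conv h (m n) x) (conv h k x) < \<epsilon>"
      unfolding f_def conv_diff_right[OF k cN[OF m(1)] h] w0
      by (simp add: dist_norm norm_minus_commute)
  qed
  then show ?thesis by (rule closed_N[OF conv_N[OF h m(1)] cont_conv[OF h k]])
qed

end


section \<open>C*-algebras and algebraic Hilbert spaces\<close>

lemma norm_adj: "norm (adj x) = norm (x :: 'a::unital_cstar_algebra)"
proof -
  have le: "norm x \<le> norm (adj x)" for x :: 'a
  proof (cases "x = 0")
    case False
    have "norm x * norm x = norm (adj x * x)" by (simp add: cstar_identity power2_eq_square)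
    also have "\<dots> \<le> norm (adj x) * norm x" by (rule norm_mult_ineq)
    finally show ?thesis using False by simp
  qed simp
  show ?thesis using le[of x] le[of "adj x"] by (simp add: adj_adj)
qed

lemma scaleC_scaleR: "c *\<^sub>C (r *\<^sub>R x) = r *\<^sub>R (c *\<^sub>C (x :: 'a::unital_cstar_algebra))"
  by (simp add: scaleC_of_real[symmetric] scaleC_scaleC mult.commute)

lemma bounded_linear_adj: "bounded_linear (adj :: 'a \<Rightarrow> 'a::unital_cstar_algebra)"
proof (rule bounded_linear_intro[where K = 1])
  show "adj (r *\<^sub>R x) = r *\<^sub>R adj (x :: 'a)" for r x
    using adj_scaleC[of "complex_of_real r" x] by (simp add: scaleC_of_real)
qed (simp_all add: adj_add norm_adj)

lemma bounded_bilinear_scaleC: "bounded_bilinear (scaleC :: complex \<Rightarrow> 'a \<Rightarrow> 'a::unital_cstar_algebra)"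
proof
  show "(r *\<^sub>R c) *\<^sub>C x = r *\<^sub>R (c *\<^sub>C (x :: 'a))" for r c x
    by (simp add: scaleC_of_real[symmetric] scaleC_scaleC scaleR_conv_of_real)
  show "\<exists>K. \<forall>c x. norm (c *\<^sub>C (x :: 'a)) \<le> norm c * norm x * K"
    by (rule exI[of _ 1]) (simp add: norm_scaleC)
qed (simp_all add: scaleC_add_left scaleC_add_right scaleC_scaleR)

lemmas bounded_linear_scaleC_right = bounded_bilinear.bounded_linear_right[OF bounded_bilinear_scaleC]

lemma adj_1 [simp]: "adj 1 = 1"
  by (metis adj_adj adj_mult mult_1 mult_1_right)

lemma adj_sum: "adj (\<Sum>i\<in>A. f i) = (\<Sum>i\<in>A. adj (f i))"
  by (rule linear_sum[OF bounded_linear.linear[OF bounded_linear_adj]])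

text \<open>The coefficients of the identity that the square of the series of (1+t)^(1/2) is 1+t,
  read off from Vandermonde's convolution.\<close>

lemma gbinomial_half_convolution:
  "(\<Sum>i\<le>k. ((1/2 :: real) gchoose i) * ((1/2) gchoose (k - i))) = (if k \<le> 1 then 1 else 0)"
proof -
  have "(\<Sum>i\<le>k. ((1/2 :: real) gchoose i) * ((1/2) gchoose (k - i))) = (1/2 + 1/2) gchoose k"
    using gbinomial_Vandermonde[of "1/2 :: real" "1/2" k] by (simp add: atMost_atLeast0)
  also have "\<dots> = of_nat (1 choose k)" using binomial_gbinomial[of 1 k, where ?'a = real] by simp
  also have "\<dots> = (if k \<le> 1 then 1 else 0)" by (auto simp: not_le le_Suc_eq)
  finally show ?thesis .
qed

text \<open>The square root of \<open>1 - x\<close> is given by the binomial series.\<close>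

lemma selfadjoint_sqrt:
  fixes a :: "'a::unital_cstar_algebra"
  assumes a: "adj a = a" and na: "norm a < 1"
  obtains b where "adj b = b" "b * b = 1 - a * a" "a * b = b * a"
proof -
  define x where "x = a * a"
  have x: "adj x = x" "a * x = x * a" by (simp_all add: x_def adj_mult a mult.assoc)
  have "norm x \<le> norm a * norm a" unfolding x_def by (rule norm_mult_ineq)
  also have "\<dots> \<le> norm a" using na by (intro mult_left_le) auto
  also have "\<dots> < 1" by (rule na)
  finally have nx: "norm x < 1" .
  define c where "c n = ((1/2 :: real) gchoose n) * (-1) ^ n" for n
  define f where "f n = c n *\<^sub>R x ^ n" for n
  have "ereal (norm (norm x)) < conv_radius (\<lambda>n. (1/2 :: real) gchoose n)"
    using nx by (simp add: conv_radius_gchoose one_ereal_def)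
  then have "summable (\<lambda>n. norm (((1/2 :: real) gchoose n) * (norm x) ^ n))"
    by (intro abs_summable_in_conv_radius) simp
  then have sf: "summable (\<lambda>n. norm (f n))"
  proof (rule summable_comparison_test'[where N = 0])
    fix n
    have "norm (f n) = \<bar>(1/2 :: real) gchoose n\<bar> * norm (x ^ n)"
      by (simp add: f_def c_def abs_mult power_abs)
    also have "\<dots> \<le> \<bar>(1/2 :: real) gchoose n\<bar> * norm x ^ n"
      by (intro mult_left_mono norm_power_ineq) auto
    finally show "norm (norm (f n)) \<le> norm (((1/2 :: real) gchoose n) * (norm x) ^ n)"
      by (simp add: abs_mult)
  qed
  note sf' = summable_norm_cancel[OF sf]
  define b where "b = suminf f"
  have conv: "(\<Sum>i\<le>k. f i * f (k - i)) = (if k \<le> 1 then (-1) ^ k *\<^sub>R x ^ k else 0)" for k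
  proof -
    have "(\<Sum>i\<le>k. f i * f (k - i)) = (\<Sum>i\<le>k. (c i * c (k - i)) *\<^sub>R x ^ k)"
      by (intro sum.cong) (auto simp: f_def power_add[symmetric])
    also have "\<dots> = (\<Sum>i\<le>k. (-1) ^ k * (((1/2 :: real) gchoose i) * ((1/2) gchoose (k - i)))) *\<^sub>R x ^ k"
      unfolding scaleR_left.sum
      by (intro sum.cong) (auto simp: c_def power_add[symmetric] mult_ac)
    also have "\<dots> = (if k \<le> 1 then (-1) ^ k *\<^sub>R x ^ k else 0)"
      unfolding sum_distrib_left[symmetric] gbinomial_half_convolution by simp
    finally show ?thesis .
  qed
  have "(\<lambda>k. \<Sum>i\<le>k. f i * f (k - i)) sums (b * b)"
    unfolding b_def by (rule Cauchy_product_sums[OF sf sf])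
  moreover have "(\<lambda>k. \<Sum>i\<le>k. f i * f (k - i)) sums (\<Sum>k\<in>{0, 1}. (\<Sum>i\<le>k. f i * f (k - i)))"
    by (rule sums_finite) (auto simp: conv)
  ultimately have "b * b = (\<Sum>k\<in>{0, 1}. (\<Sum>i\<le>k. f i * f (k - i)))" by (rule sums_unique2)
  then have "b * b = 1 - x" unfolding conv by simp
  moreover have "adj b = b"
  proof -
    have "adj (x ^ n) = x ^ n" for n
      by (induction n) (simp_all add: adj_mult x(1) power_commutes)
    then have "adj (f n) = f n" for n
      unfolding f_def using linear_scale[OF bounded_linear.linear[OF bounded_linear_adj], of "c n" "x ^ n"] by simp
    then show ?thesis
      unfolding b_def using bounded_linear.suminf[OF bounded_linear_adj sf'] by simp
  qed
  moreover have "a * b = b * a"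
  proof -
    have "a * x ^ n = x ^ n * a" for n
      by (induction n) (simp_all add: mult.assoc x(2), metis mult.assoc x(2))
    then have "a * f n = f n * a" for n by (simp add: f_def)
    then show ?thesis
      unfolding b_def using suminf_mult[OF sf', of a] suminf_mult2[OF sf', of a] by simp
  qed
  ultimately show ?thesis using that by (simp add: x_def)
qed

context
  fixes \<theta> :: "'f::unital_cstar_algebra \<Rightarrow> 'f"
  assumes aut: "star_automorphism \<theta>"
begin

lemma star_automorphism_simps:
  "\<theta> (x + y) = \<theta> x + \<theta> y" "\<theta> (c *\<^sub>C x) = c *\<^sub>C \<theta> x" "\<theta> (x * y) = \<theta> x * \<theta> y" "\<theta> (adj x) = adj (\<theta> x)"
  "\<theta> 0 = 0" "\<theta> 1 = 1" "\<theta> (r *\<^sub>R x) = r *\<^sub>R \<theta> x"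
proof -
  show add: "\<theta> (x + y) = \<theta> x + \<theta> y" and sc: "\<theta> (c *\<^sub>C x) = c *\<^sub>C \<theta> x"
    and mult: "\<theta> (x * y) = \<theta> x * \<theta> y" and "\<theta> (adj x) = adj (\<theta> x)" for c x y
    using aut by (auto simp: star_automorphism_def)
  show "\<theta> 0 = 0" using add[of 0 0] by simp
  show "\<theta> (r *\<^sub>R x) = r *\<^sub>R \<theta> x" using sc[of "of_real r" x] by (simp add: scaleC_of_real)
  obtain y where "\<theta> y = 1" using aut unfolding star_automorphism_def bij_def surj_def by metis
  then show "\<theta> 1 = 1" using mult[of 1 y] by simp
qed

text \<open>A selfadjoint element of norm less than 1 is the real part of a unitary, and unitaries are
  mapped to unitaries.\<close>

lemma star_automorphism_norm_le: "norm (\<theta> x) \<le> norm x"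
proof -
  note simps = star_automorphism_simps
  have sa1: "norm (\<theta> a) \<le> 1" if a: "adj a = a" "norm a < 1" for a
  proof -
    obtain b where b: "adj b = b" "b * b = 1 - a * a" "a * b = b * a"
      using selfadjoint_sqrt[OF a] by blast
    define u where "u = a + \<i> *\<^sub>C b"
    have adju: "adj u = a - \<i> *\<^sub>C b" by (simp add: u_def adj_add adj_scaleC a b(1))
    have "adj u * u = a * a + b * b"
      unfolding adju unfolding u_def
      by (simp add: algebra_simps mult_scaleC_left mult_scaleC_right scaleC_scaleC b(3))
    then have "adj u * u = 1" by (simp add: b(2))
    then have "(norm (\<theta> u))\<^sup>2 = 1" unfolding cstar_identity[symmetric] simps(3,4)[symmetric] by (simp add: simps)
    then have nu: "norm (\<theta> u) = 1" using power2_eq_imp_eq[of "norm (\<theta> u)" 1] by simp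
    have "\<theta> a = (1/2) *\<^sub>R (\<theta> u + \<theta> (adj u))"
      unfolding simps(1)[symmetric] simps(7)[symmetric] adju by (simp add: u_def scaleR_2[symmetric])
    also have "norm \<dots> \<le> (1/2) * (norm (\<theta> u) + norm (\<theta> (adj u)))"
      using norm_triangle_ineq[of "\<theta> u" "\<theta> (adj u)"] by simp
    finally show ?thesis by (simp add: simps(4) norm_adj nu)
  qed
  have sa: "norm (\<theta> a) \<le> norm a" if a: "adj a = a" for a
  proof (rule field_le_epsilon)
    fix e :: real assume e: "0 < e"
    define r where "r = norm a + e"
    have r: "0 < r" "norm a < r" using e by (auto simp: r_def add_nonneg_pos)
    have "adj (inverse r *\<^sub>R a) = inverse r *\<^sub>R a"
      using linear_scale[OF bounded_linear.linear[OF bounded_linear_adj], of "inverse r" a] a by simp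
    moreover have "norm (inverse r *\<^sub>R a) < 1" using r by (simp add: divide_simps)
    ultimately have "norm (\<theta> (inverse r *\<^sub>R a)) \<le> 1" by (rule sa1)
    then show "norm (\<theta> a) \<le> norm a + e" using r by (simp add: simps(7) divide_simps r_def split: if_splits)
  qed
  have "(norm (\<theta> x))\<^sup>2 = norm (\<theta> (adj x * x))" by (simp add: simps cstar_identity)
  also have "\<dots> \<le> norm (adj x * x)" by (rule sa) (simp add: adj_mult adj_adj)
  also have "\<dots> = (norm x)\<^sup>2" by (rule cstar_identity)
  finally show ?thesis by (rule power2_le_imp_le) simp
qed

lemma star_automorphism_bounded_linear: "bounded_linear \<theta>"
  using star_automorphism_simps star_automorphism_norm_le by (intro bounded_linear_intro[where K = 1]) auto

end

section \<open>Orthonormal bases and the canonical endomorphism\<close>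

lemma orthonormal_basis_adj_mult:
  "orthonormal_basis H \<Phi> \<Longrightarrow> i < length \<Phi> \<Longrightarrow> j < length \<Phi> \<Longrightarrow> adj (\<Phi> ! i) * \<Phi> ! j = (if i = j then 1 else 0)"
  by (simp add: orthonormal_basis_def)

lemma orthonormal_basis_span_induct:
  assumes "orthonormal_basis H \<Phi>" "x \<in> H" "P 0" "\<And>x y. P x \<Longrightarrow> P y \<Longrightarrow> P (x + y)"
    "\<And>c x. P x \<Longrightarrow> P (c *\<^sub>C x)" "\<And>i. i < length \<Phi> \<Longrightarrow> P (\<Phi> ! i)"
  shows "P x"
proof -
  have "x \<in> complex_vec.span (set \<Phi>)" using assms(1,2) by (simp add: orthonormal_basis_def)
  then show ?thesis
    by (induction rule: complex_vec.span_induct_alt) (use assms(3-) in \<open>auto simp: in_set_conv_nth\<close>)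
qed

lemma orthonormal_basis_nth_mem: "orthonormal_basis H \<Phi> \<Longrightarrow> i < length \<Phi> \<Longrightarrow> \<Phi> ! i \<in> H"
  unfolding orthonormal_basis_def using complex_vec.span_base nth_mem by blast

lemma orthonormal_basis_sum_mult:
  assumes "orthonormal_basis H \<Phi>" "j < length \<Phi>"
  shows "(\<Sum>k<length \<Phi>. \<Phi> ! k * A * adj (\<Phi> ! k)) * \<Phi> ! j = \<Phi> ! j * A"
proof -
  have "(\<Sum>k<length \<Phi>. \<Phi> ! k * A * adj (\<Phi> ! k)) * \<Phi> ! j = (\<Sum>k<length \<Phi>. if k = j then \<Phi> ! k * A else 0)"
    unfolding sum_distrib_right
    by (intro sum.cong) (use assms in \<open>simp_all add: orthonormal_basis_adj_mult mult.assoc\<close>)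
  then show ?thesis using assms(2) by simp
qed

lemma adj_mult_orthonormal_basis_sum:
  assumes "orthonormal_basis H \<Phi>" "j < length \<Phi>"
  shows "adj (\<Phi> ! j) * (\<Sum>k<length \<Phi>. \<Phi> ! k * A * adj (\<Phi> ! k)) = A * adj (\<Phi> ! j)"
proof -
  have "adj (\<Phi> ! j) * (\<Sum>k<length \<Phi>. \<Phi> ! k * A * adj (\<Phi> ! k)) = (\<Sum>k<length \<Phi>. if k = j then A * adj (\<Phi> ! k) else 0)"
    unfolding sum_distrib_left
    by (intro sum.cong) (use assms in \<open>simp_all add: orthonormal_basis_adj_mult mult.assoc[symmetric]\<close>)
  then show ?thesis using assms(2) by simp
qed

lemma orthonormal_basis_sum_mult_mem:
  assumes "orthonormal_basis H \<Phi>" "x \<in> H"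
  shows "(\<Sum>k<length \<Phi>. \<Phi> ! k * A * adj (\<Phi> ! k)) * x = x * A"
  by (rule orthonormal_basis_span_induct[OF assms])
    (use assms(1) in \<open>simp_all add: distrib_left distrib_right mult_scaleC_left mult_scaleC_right orthonormal_basis_sum_mult\<close>)

text \<open>The definition grants full support for one basis \<open>\<Psi>\<close> only. The sum
  over any other basis acts from the left as the identity on \<open>H\<close>, so multiplying it by
  the support sum of \<open>\<Psi>\<close> changes nothing on either side.\<close>

lemma orthonormal_basis_support:
  assumes "algebraic_hilbert_space H" "orthonormal_basis H \<Phi>"
  shows "(\<Sum>k<length \<Phi>. \<Phi> ! k * adj (\<Phi> ! k)) = 1"
proof -
  obtain \<Psi> where \<Psi>: "orthonormal_basis H \<Psi>" "(\<Sum>j<length \<Psi>. \<Psi> ! j * adj (\<Psi> ! j)) = 1"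
    using assms(1) by (auto simp: algebraic_hilbert_space_def)
  let ?P = "\<Sum>k<length \<Phi>. \<Phi> ! k * 1 * adj (\<Phi> ! k)"
  have "?P = ?P * (\<Sum>j<length \<Psi>. \<Psi> ! j * adj (\<Psi> ! j))" by (simp add: \<Psi>(2))
  also have "\<dots> = (\<Sum>j<length \<Psi>. (?P * \<Psi> ! j) * adj (\<Psi> ! j))" by (simp add: sum_distrib_left mult.assoc)
  also have "\<dots> = (\<Sum>j<length \<Psi>. \<Psi> ! j * adj (\<Psi> ! j))"
    using orthonormal_basis_sum_mult_mem[OF assms(2) orthonormal_basis_nth_mem[OF \<Psi>(1)], of _ 1]
    by (intro sum.cong) simp_all
  finally show ?thesis by (simp add: \<Psi>(2))
qed

text \<open>The sums for two bases agree as left multipliers on \<open>H\<close>, where each sends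
  \<open>x\<close> to \<open>x * A\<close>; full support of \<open>H\<close> turns this into
  equality, so the choice in the definition is immaterial.\<close>

lemma canonical_endo_eq:
  assumes H: "algebraic_hilbert_space H" and \<Phi>: "orthonormal_basis H \<Phi>"
  shows "canonical_endo H A = (\<Sum>k<length \<Phi>. \<Phi> ! k * A * adj (\<Phi> ! k))"
proof -
  define \<Psi> where "\<Psi> = (SOME \<Psi>. orthonormal_basis H \<Psi>)"
  have \<Psi>: "orthonormal_basis H \<Psi>" unfolding \<Psi>_def by (rule someI[of _ \<Phi>]) (rule \<Phi>)
  let ?S = "\<Sum>k<length \<Psi>. \<Psi> ! k * A * adj (\<Psi> ! k)"
  have "canonical_endo H A = ?S * (\<Sum>k<length \<Phi>. \<Phi> ! k * adj (\<Phi> ! k))"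
    by (simp add: canonical_endo_def Let_def \<Psi>_def orthonormal_basis_support[OF H \<Phi>])
  also have "\<dots> = (\<Sum>k<length \<Phi>. (?S * \<Phi> ! k) * adj (\<Phi> ! k))" by (simp add: sum_distrib_left mult.assoc)
  also have "\<dots> = (\<Sum>k<length \<Phi>. \<Phi> ! k * A * adj (\<Phi> ! k))"
    using orthonormal_basis_sum_mult_mem[OF \<Psi> orthonormal_basis_nth_mem[OF \<Phi>]]
    by (intro sum.cong) simp_all
  finally show ?thesis .
qed

text \<open>Reduces an algebra-valued intertwiner to a complex matrix. Only finite sums are
  involved, so a coordinate functional of an algebraic basis suffices and continuity is not asked
  for.\<close>

lemma ex_complex_functional:
  fixes x :: "'a::unital_cstar_algebra"
  assumes "x \<noteq> 0"
  obtains \<phi> :: "'a \<Rightarrow> complex" where "\<And>y z. \<phi> (y + z) = \<phi> y + \<phi> z" "\<And>c y. \<phi> (c *\<^sub>C y) = c * \<phi> y" "\<phi> x \<noteq> 0"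
proof -
  define B where "B = complex_vec.extend_basis {x}"
  have ind: "complex_vec.independent {x}" using assms by simp
  have B: "complex_vec.independent B" "complex_vec.span B = UNIV" "x \<in> B"
    using complex_vec.independent_extend_basis[OF ind] complex_vec.span_extend_basis[OF ind]
      complex_vec.extend_basis_superset[OF ind] by (auto simp: B_def)
  show ?thesis
  proof (rule that[of "\<lambda>y. complex_vec.representation B y x"])
    show "complex_vec.representation B (y + z) x = complex_vec.representation B y x + complex_vec.representation B z x" for y z
      by (simp add: complex_vec.representation_add[OF B(1)] B(2))
    show "complex_vec.representation B (c *\<^sub>C y) x = c * complex_vec.representation B y x" for c y
      by (simp add: complex_vec.representation_scale[OF B(1)] B(2))
    show "complex_vec.representation B x x \<noteq> 0" by (simp add: complex_vec.representation_basis[OF B(1) B(3)])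
  qed
qed


section \<open>Relative commutant and intertwiners\<close>

lemma carries_classE:
  assumes "spectral_hilbert_space \<mu> \<alpha> D H" "D \<in> unitary_dual"
  obtains \<Phi> \<pi> where "algebraic_hilbert_space H" "orthonormal_basis H \<Phi>" "\<pi> \<in> D"
    "irreducible_unitary_rep (length \<Phi>) \<pi>"
    "\<And>g j. j < length \<Phi> \<Longrightarrow> \<alpha> g (\<Phi> ! j) = (\<Sum>i<length \<Phi>. \<pi> g $$ (i, j) *\<^sub>C \<Phi> ! i)"
proof -
  have H: "algebraic_hilbert_space H" and "carries_class \<alpha> H D"
    using assms(1) by (simp_all add: spectral_hilbert_space_def)
  then obtain \<Phi> \<pi> where \<Phi>: "orthonormal_basis H \<Phi>" "\<pi> \<in> D"
    "\<And>g. \<pi> g \<in> carrier_mat (length \<Phi>) (length \<Phi>)"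
    "\<And>g j. j < length \<Phi> \<Longrightarrow> \<alpha> g (\<Phi> ! j) = (\<Sum>i<length \<Phi>. \<pi> g $$ (i, j) *\<^sub>C \<Phi> ! i)"
    unfolding carries_class_def by metis
  obtain n where n: "irreducible_unitary_rep n \<pi>" by (rule unitary_dual_irreducible[OF assms(2) \<Phi>(2)])
  then have "irreducible_unitary_rep (length \<Phi>) \<pi>" using irreducible_dim_unique[OF n \<Phi>(3)] by simp
  then show ?thesis using that H \<Phi> by blast
qed

section \<open>Fixed points and averaged orbits\<close>

locale cstar_dynamics = compact_haar \<mu> for \<mu> :: "('g::{topological_group_add, t2_space}) measure" +
  fixes \<alpha> :: "'g \<Rightarrow> 'f::unital_cstar_algebra \<Rightarrow> 'f"
  assumes action: "cstar_action \<alpha>"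
begin

abbreviation "fixed \<equiv> fixed_point_algebra \<alpha>"

lemma aut: "star_automorphism (\<alpha> g)" and action_add: "\<alpha> (g + h) x = \<alpha> g (\<alpha> h x)"
  and cont_action: "continuous_on UNIV (\<lambda>g. \<alpha> g x)"
  using action by (auto simp: cstar_action_def)

lemmas action_simps = star_automorphism_simps[OF aut]
lemmas action_bounded_linear = star_automorphism_bounded_linear[OF aut]

lemma action_diff: "\<alpha> g (x - y) = \<alpha> g x - \<alpha> g y"
  by (rule linear_diff[OF bounded_linear.linear[OF action_bounded_linear]])

lemma fixed_iff: "A \<in> fixed \<longleftrightarrow> (\<forall>g. \<alpha> g A = A)"
  by (simp add: fixed_point_algebra_def)

lemma fixed_mult: "A \<in> fixed \<Longrightarrow> B \<in> fixed \<Longrightarrow> A * B \<in> fixed"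
  by (simp add: fixed_iff action_simps)

lemma intertwiners_0: "0 \<in> intertwiners fixed \<sigma> \<tau>"
  by (simp add: intertwiners_def fixed_iff action_simps)

lemma mean_fixed: "mean (\<lambda>g. \<alpha> g x) \<in> fixed"
  unfolding fixed_iff
proof
  fix h
  have "\<alpha> h (mean (\<lambda>g. \<alpha> g x)) = mean (\<lambda>g. \<alpha> h (\<alpha> g x))"
    by (rule mean_bounded_linear[OF action_bounded_linear cont_action, symmetric])
  also have "\<dots> = mean (\<lambda>g. \<alpha> (h + g) x)" by (simp only: action_add)
  also have "\<dots> = mean (\<lambda>g. \<alpha> g x)" by (rule mean_translate[OF cont_action])
  finally show "\<alpha> h (mean (\<lambda>g. \<alpha> g x)) = mean (\<lambda>g. \<alpha> g x)" .
qed

lemma action_commutant: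
  assumes F: "F \<in> commutant fixed"
  shows "\<alpha> g F \<in> commutant fixed"
  unfolding commutant_def
proof (intro CollectI ballI)
  fix A assume A: "A \<in> fixed"
  then have "F * A = A * F" using F by (simp add: commutant_def)
  then have "\<alpha> g F * \<alpha> g A = \<alpha> g A * \<alpha> g F" by (simp only: action_simps(3)[symmetric])
  then show "\<alpha> g F * A = A * \<alpha> g F" using A by (simp add: fixed_iff)
qed

text \<open>The integrated form of the action. The conjugate is the one produced by
  \<open>adj (\<alpha> g (\<Phi> ! j))\<close>, so that matrix coefficients themselves can be
  inserted for \<open>k\<close>.\<close>

definition smear :: "('g \<Rightarrow> complex) \<Rightarrow> 'f \<Rightarrow> 'f" where
  "smear k x = mean (\<lambda>g. cnj (k g) *\<^sub>C \<alpha> g x)"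

lemma cont_smear_integrand: "cont k \<Longrightarrow> continuous_on UNIV (\<lambda>g. cnj (k g) *\<^sub>C \<alpha> g x)"
  by (intro bounded_bilinear.continuous_on[OF bounded_bilinear_scaleC] continuous_on_cnj cont_action)

lemma smear_commutant:
  assumes "cont k" "F \<in> commutant fixed"
  shows "smear k F \<in> commutant fixed"
  unfolding commutant_def
proof (intro CollectI ballI)
  fix A assume A: "A \<in> fixed"
  note c = cont_smear_integrand[OF assms(1)]
  have "smear k F * A = mean (\<lambda>g. (cnj (k g) *\<^sub>C \<alpha> g F) * A)"
    unfolding smear_def by (rule mean_bounded_linear[OF bounded_linear_mult_left c, symmetric])
  also have "\<dots> = mean (\<lambda>g. A * (cnj (k g) *\<^sub>C \<alpha> g F))"
    using action_commutant[OF assms(2)] A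
    by (simp add: mult_scaleC_left mult_scaleC_right commutant_def)
  also have "\<dots> = A * smear k F"
    unfolding smear_def by (rule mean_bounded_linear[OF bounded_linear_mult_right c])
  finally show "smear k F * A = A * smear k F" .
qed

text \<open>The integrated action represents the convolution algebra; hence the functions
  annihilating a given orbit form a left ideal.\<close>

lemma smear_conv:
  assumes h: "cont h" and k: "cont k"
  shows "smear (conv h k) x = smear h (smear k x)"
proof -
  have c: "continuous_on UNIV (\<lambda>(g, y). cnj (h y * k (- y + g)) *\<^sub>C \<alpha> g x)"
    unfolding case_prod_beta
    by (intro bounded_bilinear.continuous_on[OF bounded_bilinear_scaleC] continuous_on_cnj continuous_on_mult
      continuous_on_compose2[OF h] continuous_on_compose2[OF k] continuous_on_compose2[OF cont_action]
      continuous_intros) auto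
  have "smear (conv h k) x = mean (\<lambda>g. mean (\<lambda>y. cnj (h y * k (- y + g)) *\<^sub>C \<alpha> g x))"
    unfolding smear_def
  proof (rule arg_cong[of _ _ mean], rule ext)
    fix g
    have "cnj (conv h k g) = mean (\<lambda>y. cnj (h y * k (- y + g)))"
      unfolding conv_def by (rule mean_cnj[OF cont_conv_integrand[OF h k], symmetric])
    moreover have "mean (\<lambda>y. cnj (h y * k (- y + g)) *\<^sub>C \<alpha> g x) = mean (\<lambda>y. cnj (h y * k (- y + g))) *\<^sub>C \<alpha> g x"
      by (rule mean_bounded_linear[OF bounded_bilinear.bounded_linear_left[OF bounded_bilinear_scaleC]
          continuous_on_cnj[OF cont_conv_integrand[OF h k]]])
    ultimately show "cnj (conv h k g) *\<^sub>C \<alpha> g x = mean (\<lambda>y. cnj (h y * k (- y + g)) *\<^sub>C \<alpha> g x)"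
      by (simp only:)
  qed
  also have "\<dots> = mean (\<lambda>y. mean (\<lambda>g. cnj (h y * k (- y + g)) *\<^sub>C \<alpha> g x))" by (rule mean_swap[OF c])
  also have "\<dots> = mean (\<lambda>y. cnj (h y) *\<^sub>C \<alpha> y (smear k x))"
  proof (rule arg_cong[of _ _ mean], rule ext)
    fix y
    note ck = cont_smear_integrand[OF k, of x]
    have "cnj (h y) *\<^sub>C \<alpha> y (smear k x) = mean (\<lambda>g. cnj (h y) *\<^sub>C \<alpha> y (cnj (k g) *\<^sub>C \<alpha> g x))"
      unfolding smear_def
      by (rule mean_bounded_linear[OF bounded_linear_compose[OF bounded_linear_scaleC_right action_bounded_linear] ck, symmetric])
    also have "\<dots> = mean (\<lambda>g. cnj (h y * k (- y + (y + g))) *\<^sub>C \<alpha> (y + g) x)"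
      by (simp add: action_simps action_add scaleC_scaleC add.assoc[symmetric])
    also have "\<dots> = mean (\<lambda>g. cnj (h y * k (- y + g)) *\<^sub>C \<alpha> g x)"
      by (rule mean_translate[OF continuous_on_curry(2)[OF c]])
    finally show "mean (\<lambda>g. cnj (h y * k (- y + g)) *\<^sub>C \<alpha> g x) = cnj (h y) *\<^sub>C \<alpha> y (smear k x)" by simp
  qed
  finally show ?thesis by (simp add: smear_def)
qed

text \<open>The weight is cut out by the orbit itself: \<open>r\<close> is positive at 0 and
  vanishes where \<alpha> moves \<open>x\<close> by at least \<open>e\<close>. The mass
  \<open>J\<close> of the weight is kept as a factor instead of being normalised to 1.\<close>

lemma approximate_identity:
  assumes "0 < e"
  obtains k J where "cont k" "0 < J" "norm (smear k x - J *\<^sub>R x) \<le> e * J"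
proof -
  define r where "r g = max 0 (e - norm (\<alpha> g x - x))" for g
  have cr: "continuous_on UNIV r" unfolding r_def by (intro continuous_intros cont_action)
  have "\<alpha> 0 x = x"
  proof -
    have "\<alpha> 0 (\<alpha> 0 x) = \<alpha> 0 x" using action_add[of 0 0 x] by simp
    moreover have "inj (\<alpha> 0)" using aut[of 0] by (simp add: star_automorphism_def bij_is_inj)
    ultimately show ?thesis by (simp add: inj_eq)
  qed
  then have "0 < r 0" using assms by (simp add: r_def)
  then have J: "0 < mean r" by (intro mean_pos[OF cr]) (auto simp: r_def)
  have c: "continuous_on UNIV (\<lambda>g. r g *\<^sub>R \<alpha> g x)" by (intro continuous_intros cr cont_action)
  have "mean r *\<^sub>R x = mean (\<lambda>g. r g *\<^sub>R x)"
    by (rule mean_bounded_linear[OF bounded_linear_scaleR_left cr, symmetric])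
  moreover have "smear (\<lambda>g. of_real (r g)) x = mean (\<lambda>g. r g *\<^sub>R \<alpha> g x)"
    by (simp add: smear_def scaleC_of_real)
  ultimately have "smear (\<lambda>g. of_real (r g)) x - mean r *\<^sub>R x = mean (\<lambda>g. r g *\<^sub>R (\<alpha> g x - x))"
    using mean_diff[OF c, of "\<lambda>g. r g *\<^sub>R x"] cr by (simp add: scaleR_diff_right continuous_intros)
  also have "norm \<dots> \<le> mean (\<lambda>g. norm (r g *\<^sub>R (\<alpha> g x - x)))"
    by (intro norm_mean_le continuous_intros cr cont_action)
  also have "\<dots> \<le> mean (\<lambda>g. e *\<^sub>R r g)"
  proof (intro mean_mono continuous_intros cr cont_action)
    fix g
    show "norm (r g *\<^sub>R (\<alpha> g x - x)) \<le> e *\<^sub>R r g"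
    proof (cases "norm (\<alpha> g x - x) \<le> e")
      case True
      have "r g * norm (\<alpha> g x - x) \<le> r g * e" by (rule mult_left_mono[OF True]) (simp add: r_def)
      then show ?thesis by (simp add: r_def mult.commute)
    qed (simp add: r_def)
  qed
  also have "\<dots> = e * mean r" using mean_scaleR[OF cr] by simp
  finally show ?thesis using J cr by (intro that[of "\<lambda>g. of_real (r g)" "mean r"]) (auto intro: continuous_intros)
qed

text \<open>The functions annihilating the orbit of \<open>x\<close> form a coefficient space, which
  is known to contain convolutions of continuous functions, not single ones. So \<open>x\<close> is
  approximated by smearing twice, and the double smear vanishes.\<close>

lemma eq_0_if_coefficients_0:
  assumes coeff: "\<And>n \<pi> i j. irreducible_unitary_rep n \<pi> \<Longrightarrow> i < n \<Longrightarrow> j < n \<Longrightarrow> smear (\<lambda>g. \<pi> g $$ (i, j)) x = 0"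
  shows "x = 0"
proof -
  define N where "N = {k. cont k \<and> smear k x = 0}"
  have smear_add: "smear (\<lambda>g. f g + k g) x = smear f x + smear k x" if "cont f" "cont k" for f k
    using mean_add[OF cont_smear_integrand cont_smear_integrand, OF that] by (simp add: smear_def scaleC_add_left)
  have smear_mult: "smear (\<lambda>g. c * f g) x = cnj c *\<^sub>C smear f x" if "cont f" for c f
    using mean_bounded_linear[OF bounded_linear_scaleC_right cont_smear_integrand, OF that]
    by (simp add: smear_def scaleC_scaleC)
  have cont_coeff: "cont (\<lambda>g. \<pi> g $$ (i, j))" if "irreducible_unitary_rep n \<pi>" "i < n" "j < n" for n \<pi> i j
    using that by (simp add: irreducible_unitary_rep_def unitary_rep_def)
  interpret coefficient_space \<mu> N
  proof
    show "function_space N"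
      unfolding function_space_def
      by (auto simp: N_def smear_add smear_mult intro: continuous_intros) (simp add: smear_def)
    show "conv h k \<in> N" if "cont h" "k \<in> N" for h k
      using that by (simp add: N_def smear_conv) (simp add: smear_def action_simps)
    show "(\<lambda>g. \<pi> g $$ (i, j)) \<in> N" if "irreducible_unitary_rep n \<pi>" "i < n" "j < n" for n \<pi> i j
      using that coeff cont_coeff by (simp add: N_def)
    show "l \<in> N" if q: "\<And>n. q n \<in> N" and l: "cont l" and lim: "uniform_limit UNIV q l sequentially" for q l
    proof -
      obtain B where B: "\<And>g. norm (\<alpha> g x) \<le> B" using bounded_continuous[OF cont_action] by metis
      obtain C where C: "\<And>g. cmod (cnj (l g)) \<le> C" using bounded_continuous[OF continuous_on_cnj[OF l]] by metis
      have "uniform_limit UNIV (\<lambda>n g. cnj (q n g) *\<^sub>C \<alpha> g x) (\<lambda>g. cnj (l g) *\<^sub>C \<alpha> g x) sequentially"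
        by (rule bounded_bilinear.bounded_uniform_limit[OF bounded_bilinear_scaleC])
          (use B C in \<open>auto intro!: boundedI bounded_linear.uniform_limit[OF bounded_linear_cnj lim] uniform_limit_const\<close>)
      then have "(\<lambda>n. smear (q n) x) \<longlonglongrightarrow> smear l x"
        unfolding smear_def using q l by (intro tendsto_mean cont_smear_integrand) (auto simp: N_def)
      moreover have "smear (q n) x = 0" for n using q by (simp add: N_def)
      ultimately show ?thesis using l by (simp add: N_def LIMSEQ_const_iff)
    qed
  qed
  have "norm x \<le> e" if e: "0 < e" for e
  proof -
    have "0 < e / 2" using e by simp
    then obtain k J where k: "cont k" "0 < J" "norm (smear k x - J *\<^sub>R x) \<le> e / 2 * J"
      by (rule approximate_identity)
    \<comment> \<open>The second tolerance is proportional to \<open>J\<close>, because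
      \<open>smear k x\<close> approximates \<open>J *\<^sub>R x\<close> rather than
      \<open>x\<close>; in the end \<open>J\<close> cancels.\<close>
    have "0 < e / 2 * J" using e k(2) by simp
    then obtain h I where h: "cont h" "0 < I" "norm (smear h (smear k x) - I *\<^sub>R smear k x) \<le> (e / 2 * J) * I"
      by (rule approximate_identity)
    have "smear h (smear k x) = 0" using conv_mem[OF h(1) k(1)] by (simp add: N_def smear_conv h(1) k(1))
    then have "norm (smear k x) \<le> e / 2 * J" using h(2,3) by simp
    then have "norm (J *\<^sub>R x) \<le> e * J"
      using k(3) norm_triangle_ineq4[of "smear k x" "smear k x - J *\<^sub>R x"] by simp
    then show ?thesis using k(2) by simp
  qed
  then have "norm x \<le> 0" by (rule field_le_epsilon[of _ 0, simplified])
  then show ?thesis by simp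
qed

text \<open>A fixed \<open>A\<close> passes through \<open>T j i\<close> because the endomorphism of
  \<open>H\<close> moves past \<open>\<Phi> ! i\<close> on one side, that of \<open>H'\<close> past
  \<open>adj (\<Psi> ! j)\<close> on the other, and \<open>X\<close> exchanges the two.
  \<open>X\<close> is recovered from all \<open>T j i\<close> since both Hilbert spaces have support
  1.\<close>

lemma fixed_commutant_imp_disjoint:
  assumes sub: "commutant fixed \<subseteq> fixed"
    and D: "D \<in> unitary_dual" "spectral_hilbert_space \<mu> \<alpha> D H"
    and D': "D' \<in> unitary_dual" "spectral_hilbert_space \<mu> \<alpha> D' H'"
    and neq: "D \<noteq> D'" and X: "X \<in> intertwiners fixed (canonical_endo H) (canonical_endo H')"
  shows "X = 0"
proof -
  obtain \<Phi> \<pi> where \<Phi>: "algebraic_hilbert_space H" "orthonormal_basis H \<Phi>" "\<pi> \<in> D"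
    "irreducible_unitary_rep (length \<Phi>) \<pi>"
    "\<And>g j. j < length \<Phi> \<Longrightarrow> \<alpha> g (\<Phi> ! j) = (\<Sum>i<length \<Phi>. \<pi> g $$ (i, j) *\<^sub>C \<Phi> ! i)"
    by (rule carries_classE[OF D(2,1), OF that])
  obtain \<Psi> \<pi>' where \<Psi>: "algebraic_hilbert_space H'" "orthonormal_basis H' \<Psi>" "\<pi>' \<in> D'"
    "irreducible_unitary_rep (length \<Psi>) \<pi>'"
    "\<And>g j. j < length \<Psi> \<Longrightarrow> \<alpha> g (\<Psi> ! j) = (\<Sum>i<length \<Psi>. \<pi>' g $$ (i, j) *\<^sub>C \<Psi> ! i)"
    by (rule carries_classE[OF D'(2,1), OF that])
  define n where "n = length \<Phi>"
  define m where "m = length \<Psi>"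
  note \<Phi> = \<Phi>[folded n_def] and \<Psi> = \<Psi>[folded m_def]
  have ineq: "(\<pi>, \<pi>') \<notin> unitary_equivalence" by (rule unitary_dual_unrelated[OF D(1) D'(1) neq \<Phi>(3) \<Psi>(3)])
  have XA: "\<alpha> g X = X" and tw: "\<And>A. A \<in> fixed \<Longrightarrow> X * canonical_endo H A = canonical_endo H' A * X" for g
    using X by (auto simp: intertwiners_def fixed_iff)
  define T where "T j i = adj (\<Psi> ! j) * X * \<Phi> ! i" for j i
  have T_fixed: "\<alpha> g (T j i) = T j i" if ji: "j < m" "i < n" for j i g
  proof -
    have "T j i * A = A * T j i" if A: "A \<in> fixed" for A
    proof -
      have "T j i * A = adj (\<Psi> ! j) * (X * canonical_endo H A) * \<Phi> ! i"
        using orthonormal_basis_sum_mult[OF \<Phi>(2), folded n_def, OF ji(2), of A]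
        by (simp add: T_def canonical_endo_eq[OF \<Phi>(1,2)] n_def mult.assoc)
      also have "\<dots> = adj (\<Psi> ! j) * canonical_endo H' A * X * \<Phi> ! i" by (simp add: tw[OF A] mult.assoc)
      also have "\<dots> = A * T j i"
        using adj_mult_orthonormal_basis_sum[OF \<Psi>(2), folded m_def, OF ji(1), of A]
        by (simp add: T_def canonical_endo_eq[OF \<Psi>(1,2)] m_def mult.assoc)
      finally show ?thesis .
    qed
    then show ?thesis using sub by (auto simp: commutant_def fixed_iff subset_iff)
  qed
  \<comment> \<open>Since \<open>X\<close> and \<open>T j i\<close> are both fixed, applying
    \<alpha> moves only the two basis vectors; this makes invariance an intertwining
    relation.\<close>
  have T_rep: "T j i = (\<Sum>l<m. \<Sum>k<n. (cnj (\<pi>' g $$ (l, j)) * \<pi> g $$ (k, i)) *\<^sub>C T l k)" if ji: "j < m" "i < n" for j i g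
  proof -
    have "T j i = adj (\<alpha> g (\<Psi> ! j)) * X * \<alpha> g (\<Phi> ! i)"
      using T_fixed[OF ji, of g] by (simp add: T_def action_simps XA)
    also have "\<dots> = (\<Sum>l<m. cnj (\<pi>' g $$ (l, j)) *\<^sub>C adj (\<Psi> ! l)) * X * (\<Sum>k<n. \<pi> g $$ (k, i) *\<^sub>C \<Phi> ! k)"
      unfolding \<Psi>(5)[OF ji(1)] \<Phi>(5)[OF ji(2)] by (simp add: adj_sum adj_scaleC)
    also have "\<dots> = (\<Sum>l<m. \<Sum>k<n. (cnj (\<pi>' g $$ (l, j)) * \<pi> g $$ (k, i)) *\<^sub>C T l k)"
      unfolding sum_distrib_right sum_distrib_left T_def
      by (subst sum.swap) (simp add: mult_scaleC_left mult_scaleC_right scaleC_scaleC mult.assoc mult.commute)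
    finally show ?thesis .
  qed
  have "T j i = 0" if ji: "j < m" "i < n" for j i
  proof (rule ccontr)
    assume "T j i \<noteq> 0"
    then obtain \<phi> where \<phi>: "\<And>y z. \<phi> (y + z) = \<phi> y + \<phi> z" "\<And>c y. \<phi> (c *\<^sub>C y) = c * \<phi> y" "\<phi> (T j i) \<noteq> 0"
      by (rule ex_complex_functional) blast
    have "\<phi> 0 = 0" using \<phi>(1)[of 0 0] by simp
    then have \<phi>_sum: "\<phi> (\<Sum>i\<in>A. f i) = (\<Sum>i\<in>A. \<phi> (f i))" for A :: "nat set" and f
      by (induction A rule: infinite_finite_induct) (simp_all add: \<phi>(1))
    define S where "S = mat m n (\<lambda>(j, i). \<phi> (T j i))"
    have S: "S \<in> carrier_mat m n" by (simp add: S_def)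
    note c = unitary_repD(1)[OF irreducible_unitary_repD(2)[OF \<Phi>(4)]]
    note r' = unitary_repD[OF irreducible_unitary_repD(2)[OF \<Psi>(4)]]
    note a' = mat_adjoint_carrier[OF r'(1)]
    have S_eq: "S = mat_adjoint (\<pi>' g) * (S * \<pi> g)" for g
    proof (rule eq_matI)
      fix j i assume "j < dim_row (mat_adjoint (\<pi>' g) * (S * \<pi> g))" "i < dim_col (mat_adjoint (\<pi>' g) * (S * \<pi> g))"
      then have ji: "j < m" "i < n" using c[of g] a'[of g] by auto
      have "(mat_adjoint (\<pi>' g) * (S * \<pi> g)) $$ (j, i)
        = (\<Sum>l<m. mat_adjoint (\<pi>' g) $$ (j, l) * (S * \<pi> g) $$ (l, i))"
        by (rule times_mat_index[OF a' mult_carrier_mat[OF S c] ji])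
      also have "\<dots> = (\<Sum>l<m. \<Sum>k<n. (cnj (\<pi>' g $$ (l, j)) * \<pi> g $$ (k, i)) * \<phi> (T l k))"
      proof (rule sum.cong)
        fix l assume "l \<in> {..<m}"
        then have l: "l < m" by simp
        have "mat_adjoint (\<pi>' g) $$ (j, l) = cnj (\<pi>' g $$ (l, j))"
          using mat_adjoint_index[of j "\<pi>' g" l] carrier_matD[OF r'(1)[of g]] ji l by simp
        then show "mat_adjoint (\<pi>' g) $$ (j, l) * (S * \<pi> g) $$ (l, i)
          = (\<Sum>k<n. (cnj (\<pi>' g $$ (l, j)) * \<pi> g $$ (k, i)) * \<phi> (T l k))"
          unfolding times_mat_index[OF S c l ji(2)] sum_distrib_left
          by (intro sum.cong) (use l in \<open>simp_all add: S_def mult_ac\<close>)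
      qed simp
      also have "\<dots> = \<phi> (T j i)"
        by (subst T_rep[OF ji, of g]) (simp add: \<phi>_sum \<phi>(2))
      finally show "S $$ (j, i) = (mat_adjoint (\<pi>' g) * (S * \<pi> g)) $$ (j, i)" using ji by (simp add: S_def)
    qed (use carrier_matD[OF S] carrier_matD[OF c[of g]] carrier_matD[OF r'(1)[of g]] in auto)
    have "S * \<pi> g = \<pi>' g * S" for g
    proof -
      have "\<pi>' g * S = \<pi>' g * (mat_adjoint (\<pi>' g) * (S * \<pi> g))" by (simp only: S_eq[of g, symmetric])
      also have "\<dots> = \<pi>' g * mat_adjoint (\<pi>' g) * (S * \<pi> g)"
        by (rule assoc_mult_mat[OF r'(1) a' mult_carrier_mat[OF S c], symmetric])
      also have "\<dots> = S * \<pi> g"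
        unfolding unitary_rep_adjoint_right[OF irreducible_unitary_repD(2)[OF \<Psi>(4)]]
        by (rule left_mult_one_mat[OF mult_carrier_mat[OF S c]])
      finally show ?thesis by simp
    qed
    from Schur_inequivalent[OF \<Phi>(4) \<Psi>(4) S this ineq] have "S = 0\<^sub>m m n" .
    then have "S $$ (j, i) = 0" using ji by simp
    then show False using \<phi>(3) ji by (simp add: S_def)
  qed
  then have T0: "adj (\<Psi> ! j) * X * \<Phi> ! i = 0" if "j < m" "i < n" for j i using that by (simp add: T_def)
  have "X = (\<Sum>j<m. \<Psi> ! j * adj (\<Psi> ! j)) * X * (\<Sum>i<n. \<Phi> ! i * adj (\<Phi> ! i))"
    using orthonormal_basis_support[OF \<Phi>(1,2)] orthonormal_basis_support[OF \<Psi>(1,2)] by (simp add: n_def m_def)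
  also have "\<dots> = (\<Sum>j<m. \<Sum>i<n. \<Psi> ! j * (adj (\<Psi> ! j) * X * \<Phi> ! i) * adj (\<Phi> ! i))"
    unfolding sum_distrib_right sum_distrib_left by (subst sum.swap) (simp add: mult.assoc)
  also have "\<dots> = 0" by (simp add: T0)
  finally show ?thesis .
qed

text \<open>\<open>\<rho>0\<close> is meant to be the endomorphism of the trivial class, implemented
  by the fixed isometry \<phi>: multiplying by \<phi> sends intertwiners into the identity to
  intertwiners into \<open>\<rho>0\<close>, and loses nothing because
  \<open>adj \<phi> * \<phi> = 1\<close>. That \<open>X\<close> intertwines is seen on the products
  \<open>X * \<Phi> ! k\<close>, which are smears of \<open>F\<close> and so commute with the fixed
  points.\<close>

lemma disjoint_imp_coefficient_0:
  assumes D: "D \<in> unitary_dual" "spectral_hilbert_space \<mu> \<alpha> D H"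
    and \<Phi>0: "\<phi> \<in> fixed" "adj \<phi> * \<phi> = 1" "\<And>A. A \<in> fixed \<Longrightarrow> \<rho>0 A * \<phi> = \<phi> * A"
    and disj: "intertwiners fixed (canonical_endo H) \<rho>0 = {0}"
    and F: "F \<in> commutant fixed"
  obtains n \<pi> where "irreducible_unitary_rep n \<pi>" "\<pi> \<in> D"
    "\<And>i j. i < n \<Longrightarrow> j < n \<Longrightarrow> smear (\<lambda>g. \<pi> g $$ (i, j)) F = 0"
proof -
  obtain \<Phi> \<pi> where \<Phi>: "algebraic_hilbert_space H" "orthonormal_basis H \<Phi>" "\<pi> \<in> D"
    "irreducible_unitary_rep (length \<Phi>) \<pi>"
    "\<And>g j. j < length \<Phi> \<Longrightarrow> \<alpha> g (\<Phi> ! j) = (\<Sum>i<length \<Phi>. \<pi> g $$ (i, j) *\<^sub>C \<Phi> ! i)"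
    by (rule carries_classE[OF D(2,1), OF that])
  have "smear (\<lambda>g. \<pi> g $$ (i, j)) F = 0" if ij: "i < length \<Phi>" "j < length \<Phi>" for i j
  proof -
    define X where "X = mean (\<lambda>g. \<alpha> g (F * adj (\<Phi> ! j)))"
    have X: "X \<in> fixed" unfolding X_def by (rule mean_fixed)
    have X\<Phi>: "X * \<Phi> ! k = smear (\<lambda>g. \<pi> g $$ (k, j)) F" if k: "k < length \<Phi>" for k
    proof -
      have "X * \<Phi> ! k = mean (\<lambda>g. \<alpha> g (F * adj (\<Phi> ! j)) * \<Phi> ! k)"
        unfolding X_def by (rule mean_bounded_linear[OF bounded_linear_mult_left cont_action, symmetric])
      also have "\<dots> = smear (\<lambda>g. \<pi> g $$ (k, j)) F"
        unfolding smear_def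
      proof (rule arg_cong[of _ _ mean], rule ext)
        fix g
        have "adj (\<alpha> g (\<Phi> ! j)) * \<Phi> ! k = (\<Sum>l<length \<Phi>. cnj (\<pi> g $$ (l, j)) *\<^sub>C (adj (\<Phi> ! l) * \<Phi> ! k))"
          unfolding \<Phi>(5)[OF ij(2)] by (simp add: adj_sum adj_scaleC sum_distrib_right mult_scaleC_left)
        also have "\<dots> = (\<Sum>l<length \<Phi>. if l = k then cnj (\<pi> g $$ (l, j)) *\<^sub>C 1 else 0)"
          by (intro sum.cong) (use k in \<open>simp_all add: orthonormal_basis_adj_mult[OF \<Phi>(2)]\<close>)
        also have "\<dots> = cnj (\<pi> g $$ (k, j)) *\<^sub>C 1" using k by simp
        finally have "adj (\<alpha> g (\<Phi> ! j)) * \<Phi> ! k = cnj (\<pi> g $$ (k, j)) *\<^sub>C 1" .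
        then show "\<alpha> g (F * adj (\<Phi> ! j)) * \<Phi> ! k = cnj (\<pi> g $$ (k, j)) *\<^sub>C \<alpha> g F"
          by (simp add: action_simps mult.assoc mult_scaleC_right)
      qed
      finally show ?thesis .
    qed
    have cont_coeff: "cont (\<lambda>g. \<pi> g $$ (k, j))" if "k < length \<Phi>" for k
      using \<Phi>(4) that ij(2) by (simp add: irreducible_unitary_rep_def unitary_rep_def)
    have "X * canonical_endo H A = A * X" if A: "A \<in> fixed" for A
    proof -
      have "X * canonical_endo H A = (\<Sum>k<length \<Phi>. (X * \<Phi> ! k) * A * adj (\<Phi> ! k))"
        by (simp add: canonical_endo_eq[OF \<Phi>(1,2)] sum_distrib_left mult.assoc)
      also have "\<dots> = (\<Sum>k<length \<Phi>. A * (X * \<Phi> ! k) * adj (\<Phi> ! k))"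
      proof (rule sum.cong)
        fix k assume "k \<in> {..<length \<Phi>}"
        then have "X * \<Phi> ! k \<in> commutant fixed" using X\<Phi> smear_commutant[OF cont_coeff F] by simp
        then show "(X * \<Phi> ! k) * A * adj (\<Phi> ! k) = A * (X * \<Phi> ! k) * adj (\<Phi> ! k)"
          using A by (simp add: commutant_def)
      qed simp
      also have "\<dots> = A * X * (\<Sum>k<length \<Phi>. \<Phi> ! k * adj (\<Phi> ! k))"
        by (simp add: sum_distrib_left mult.assoc)
      finally show ?thesis by (simp add: orthonormal_basis_support[OF \<Phi>(1,2)])
    qed
    then have "\<phi> * X \<in> intertwiners fixed (canonical_endo H) \<rho>0"
      using \<Phi>0 X by (simp add: intertwiners_def fixed_mult mult.assoc) (simp add: mult.assoc[symmetric])
    then have "\<phi> * X = 0" using disj by blast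
    then have "X = 0" using \<Phi>0(2) by (metis mult.assoc mult_1 mult_zero_right)
    then show ?thesis using X\<Phi>[OF ij(1)] by simp
  qed
  then show ?thesis using that \<Phi>(3,4) by blast
qed

text \<open>With \<open>M\<close> the average of \<open>F\<close>, the trivial coefficient of
  \<open>F - M\<close> vanishes by construction. The others vanish because each nontrivial class is
  disjoint from the trivial one, so \<open>F\<close> equals the fixed element
  \<open>M\<close>.\<close>

lemma disjoint_imp_fixed:
  assumes H: "\<And>D. D \<in> unitary_dual \<Longrightarrow> spectral_hilbert_space \<mu> \<alpha> D (H D)"
    and disj: "\<And>D D'. D \<in> unitary_dual \<Longrightarrow> D' \<in> unitary_dual \<Longrightarrow> D \<noteq> D' \<Longrightarrow>
      intertwiners fixed (canonical_endo (H D)) (canonical_endo (H D')) = {0}"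
    and F: "F \<in> commutant fixed"
  shows "F \<in> fixed"
proof -
  define triv :: "'g \<Rightarrow> complex mat" where "triv = (\<lambda>g. 1\<^sub>m 1)"
  have irr_triv: "irreducible_unitary_rep 1 triv" unfolding triv_def by (rule irreducible_trivial_rep)
  obtain \<iota> where \<iota>: "\<iota> \<in> unitary_dual" "triv \<in> \<iota>" by (rule irreducible_in_unitary_dual[OF irr_triv])
  \<comment> \<open>Conjugating the identity by a unitary changes nothing, so the class of
    \<open>triv\<close> has no other member; the basis vector of its Hilbert space is therefore a
    fixed isometry.\<close>
  have triv_class: "n = 1 \<and> \<pi> g = 1\<^sub>m 1" if \<pi>: "\<pi> \<in> \<iota>" "irreducible_unitary_rep n \<pi>" for \<pi> n g
  proof -
    obtain U where U: "U \<in> carrier_mat n n" "irreducible_unitary_rep n triv"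
      "\<And>g. \<pi> g = mat_adjoint U * (triv g * U)" "mat_adjoint U * U = 1\<^sub>m n"
      by (rule unitary_equivalence_entries[OF \<pi>(2) unitary_dual_related[OF \<iota>(1) \<pi>(1) \<iota>(2)], OF that])
    have n: "n = 1" by (rule irreducible_dim_unique[OF U(2)]) (simp add: triv_def)
    then show ?thesis using U(1,3,4) by (simp add: triv_def)
  qed
  obtain \<Phi> \<pi> where \<Phi>: "algebraic_hilbert_space (H \<iota>)" "orthonormal_basis (H \<iota>) \<Phi>" "\<pi> \<in> \<iota>"
    "irreducible_unitary_rep (length \<Phi>) \<pi>"
    "\<And>g j. j < length \<Phi> \<Longrightarrow> \<alpha> g (\<Phi> ! j) = (\<Sum>i<length \<Phi>. \<pi> g $$ (i, j) *\<^sub>C \<Phi> ! i)"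
    by (rule carries_classE[OF H[OF \<iota>(1)] \<iota>(1), OF that])
  have len: "length \<Phi> = 1" and \<pi>1: "\<pi> g = 1\<^sub>m 1" for g using triv_class[OF \<Phi>(3,4)] by auto
  have \<phi>_fixed: "\<Phi> ! 0 \<in> fixed" using \<Phi>(5)[of 0] len \<pi>1 by (simp add: fixed_iff)
  have \<phi>_unit: "adj (\<Phi> ! 0) * \<Phi> ! 0 = 1" using orthonormal_basis_adj_mult[OF \<Phi>(2), of 0 0] len by simp
  have \<phi>_tw: "canonical_endo (H \<iota>) A * \<Phi> ! 0 = \<Phi> ! 0 * A" for A
    using orthonormal_basis_sum_mult[OF \<Phi>(2), of 0 A] len by (simp add: canonical_endo_eq[OF \<Phi>(1,2)])
  define M where "M = mean (\<lambda>g. \<alpha> g F)"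
  have M: "M \<in> fixed" unfolding M_def by (rule mean_fixed)
  have "M \<in> commutant fixed"
    using smear_commutant[OF continuous_on_const F, of 1] by (simp add: M_def smear_def)
  then have F0: "F - M \<in> commutant fixed" using F by (simp add: commutant_def algebra_simps)
  have "smear (\<lambda>g. \<sigma> g $$ (i, j)) (F - M) = 0" if \<sigma>: "irreducible_unitary_rep n \<sigma>" "i < n" "j < n" for n \<sigma> i j
  proof -
    obtain D where D: "D \<in> unitary_dual" "\<sigma> \<in> D" by (rule irreducible_in_unitary_dual[OF \<sigma>(1)])
    show ?thesis
    proof (cases "D = \<iota>")
      case True
      then have n: "n = 1" and \<sigma>1: "\<sigma> g = 1\<^sub>m 1" for g using triv_class D(2) \<sigma>(1) by auto
      have "smear (\<lambda>g. \<sigma> g $$ (i, j)) (F - M) = mean (\<lambda>g. \<alpha> g F - M)"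
        using \<sigma>(2,3) M by (simp add: smear_def \<sigma>1 n action_diff fixed_iff)
      also have "\<dots> = 0" by (simp add: mean_diff cont_action M_def)
      finally show ?thesis .
    next
      case False
      obtain m \<tau> where \<tau>: "irreducible_unitary_rep m \<tau>" "\<tau> \<in> D"
        "\<And>i j. i < m \<Longrightarrow> j < m \<Longrightarrow> smear (\<lambda>g. \<tau> g $$ (i, j)) (F - M) = 0"
        by (rule disjoint_imp_coefficient_0[OF D(1) H[OF D(1)] \<phi>_fixed \<phi>_unit \<phi>_tw disj[OF D(1) \<iota>(1) False] F0, OF that])
      obtain U where U: "U \<in> carrier_mat n n" "irreducible_unitary_rep n \<tau>"
        "\<And>g. \<sigma> g = mat_adjoint U * (\<tau> g * U)" "mat_adjoint U * U = 1\<^sub>m n"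
        by (rule unitary_equivalence_entries[OF \<sigma>(1) unitary_dual_related[OF D \<tau>(2)], OF that])
      note c = unitary_repD(1)[OF irreducible_unitary_repD(2)[OF U(2)]]
      have m: "m = n" by (rule irreducible_dim_unique[OF \<tau>(1) c])
      have ct: "cont (\<lambda>g. \<tau> g $$ (l, k))" if "l < n" "k < n" for l k
        using U(2) that by (simp add: irreducible_unitary_rep_def unitary_rep_def)
      let ?u = "\<lambda>l k. mat_adjoint U $$ (i, l) * U $$ (k, j)"
      have entry: "\<sigma> g $$ (i, j) = (\<Sum>l<n. \<Sum>k<n. ?u l k * \<tau> g $$ (l, k))" for g
      proof -
        have "\<sigma> g $$ (i, j) = (\<Sum>l<n. mat_adjoint U $$ (i, l) * (\<tau> g * U) $$ (l, j))"
          unfolding U(3) by (rule times_mat_index[OF mat_adjoint_carrier[OF U(1)] mult_carrier_mat[OF c U(1)] \<sigma>(2,3)])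
        also have "\<dots> = (\<Sum>l<n. \<Sum>k<n. ?u l k * \<tau> g $$ (l, k))"
        proof (rule sum.cong)
          fix l assume "l \<in> {..<n}"
          then have l: "l < n" by simp
          show "mat_adjoint U $$ (i, l) * (\<tau> g * U) $$ (l, j) = (\<Sum>k<n. ?u l k * \<tau> g $$ (l, k))"
            unfolding times_mat_index[OF c U(1) l \<sigma>(3)] sum_distrib_left
            by (intro sum.cong) (simp_all add: mult_ac)
        qed simp
        finally show ?thesis .
      qed
      have "smear (\<lambda>g. \<sigma> g $$ (i, j)) (F - M)
        = mean (\<lambda>g. \<Sum>l<n. \<Sum>k<n. cnj (?u l k) *\<^sub>C (cnj (\<tau> g $$ (l, k)) *\<^sub>C \<alpha> g (F - M)))"
        unfolding smear_def entry by (simp add: complex_vec.scale_sum_left scaleC_scaleC)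
      also have "\<dots> = (\<Sum>l<n. \<Sum>k<n. mean (\<lambda>g. cnj (?u l k) *\<^sub>C (cnj (\<tau> g $$ (l, k)) *\<^sub>C \<alpha> g (F - M))))"
      proof -
        have cc: "continuous_on UNIV (\<lambda>g. cnj (?u l k) *\<^sub>C (cnj (\<tau> g $$ (l, k)) *\<^sub>C \<alpha> g (F - M)))" if "l < n" "k < n" for l k
          by (rule bounded_linear.continuous_on[OF bounded_linear_scaleC_right cont_smear_integrand[OF ct[OF that]]])
        have "mean (\<lambda>g. \<Sum>l<n. \<Sum>k<n. cnj (?u l k) *\<^sub>C (cnj (\<tau> g $$ (l, k)) *\<^sub>C \<alpha> g (F - M)))
          = (\<Sum>l<n. mean (\<lambda>g. \<Sum>k<n. cnj (?u l k) *\<^sub>C (cnj (\<tau> g $$ (l, k)) *\<^sub>C \<alpha> g (F - M))))"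
          by (rule mean_sum, rule continuous_on_sum, rule cc) simp_all
        also have "\<dots> = (\<Sum>l<n. \<Sum>k<n. mean (\<lambda>g. cnj (?u l k) *\<^sub>C (cnj (\<tau> g $$ (l, k)) *\<^sub>C \<alpha> g (F - M))))"
          by (rule sum.cong[OF refl], rule mean_sum, rule cc) simp_all
        finally show ?thesis .
      qed
      also have "\<dots> = (\<Sum>l<n. \<Sum>k<n. cnj (?u l k) *\<^sub>C smear (\<lambda>g. \<tau> g $$ (l, k)) (F - M))"
        unfolding smear_def
        by (intro sum.cong mean_bounded_linear[OF bounded_linear_scaleC_right] cont_smear_integrand ct) auto
      also have "\<dots> = 0" using \<tau>(3) by (simp add: m)
      finally show ?thesis .
    qed
  qed
  then have "F - M = 0" by (rule eq_0_if_coefficients_0)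
  then show ?thesis using M by simp
qed

end

theorem proposition4p3:
  fixes \<mu> :: "('g::{topological_group_add, t2_space}) measure"
    and \<alpha> :: "'g \<Rightarrow> 'f::unital_cstar_algebra \<Rightarrow> 'f"
    and H :: "('g \<Rightarrow> complex mat) set \<Rightarrow> 'f set"
  assumes system: "hilbert_cstar_system \<mu> \<alpha>"
    and H: "\<And>D. D \<in> unitary_dual \<Longrightarrow> spectral_hilbert_space \<mu> \<alpha> D (H D)"
  shows "let \<A> = fixed_point_algebra \<alpha>;
             \<Z> = commutant \<A> \<inter> \<A>;
             \<rho> = (\<lambda>D. canonical_endo (H D))
         in (commutant \<A> \<inter> (UNIV :: 'f set) = \<Z> \<longleftrightarrow>
              (\<forall>D\<in>unitary_dual. \<forall>D'\<in>unitary_dual. D \<noteq> D' \<longrightarrow>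
                 intertwiners \<A> (\<rho> D) (\<rho> D') = {0})) \<and>
            (commutant \<A> \<inter> (UNIV :: 'f set) = \<Z> \<longleftrightarrow>
              pairwise (\<lambda>D D'. disjoint_endos \<A> (\<rho> D) (\<rho> D')) unitary_dual)"
proof -
  interpret cstar_dynamics \<mu> \<alpha>
    using system by unfold_locales (simp_all add: hilbert_cstar_system_def)
  have "commutant fixed \<inter> UNIV = commutant fixed \<inter> fixed \<longleftrightarrow> commutant fixed \<subseteq> fixed" by blast
  also have "\<dots> \<longleftrightarrow> (\<forall>D\<in>unitary_dual. \<forall>D'\<in>unitary_dual. D \<noteq> D' \<longrightarrow>
      intertwiners fixed (canonical_endo (H D)) (canonical_endo (H D')) = {0})"
  proof
    assume sub: "commutant fixed \<subseteq> fixed"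
    show "\<forall>D\<in>unitary_dual. \<forall>D'\<in>unitary_dual. D \<noteq> D' \<longrightarrow>
      intertwiners fixed (canonical_endo (H D)) (canonical_endo (H D')) = {0}"
    proof (intro ballI impI)
      fix D D' :: "('g \<Rightarrow> complex mat) set" assume D: "D \<in> unitary_dual" "D' \<in> unitary_dual" "D \<noteq> D'"
      show "intertwiners fixed (canonical_endo (H D)) (canonical_endo (H D')) = {0}"
        using fixed_commutant_imp_disjoint[OF sub D(1) H[OF D(1)] D(2) H[OF D(2)] D(3)] intertwiners_0 by blast
    qed
  next
    assume disj: "\<forall>D\<in>unitary_dual. \<forall>D'\<in>unitary_dual. D \<noteq> D' \<longrightarrow>
      intertwiners fixed (canonical_endo (H D)) (canonical_endo (H D')) = {0}"
    show "commutant fixed \<subseteq> fixed"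
      by (rule subsetI, rule disjoint_imp_fixed[OF H]) (use disj in simp_all)
  qed
  finally show ?thesis unfolding Let_def pairwise_def disjoint_endos_def by blast
qed

end
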